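(* Let $m$ be a positive integer and $q$ a prime number, and assume there is an integer $t$ with $\gcd\{t,m\}=1$ whose residue class in $(\mathbb{Z}/m\mathbb{Z})^\times$ has order exactly $q$. Define $m'=m/\gcd\{m,t-1\}$. Assume there exist integers $a_0,a_1,\ldots,a_{q-2},b$ such that $bm'=a_0+a_1t+\cdots+a_{q-2}t^{q-2}$ and $N_{\mathbb{Q}(\zeta_q)/\mathbb{Q}}(\alpha)=\pm m'$, where $\alpha:=a_0+a_1\zeta_q+\cdots+a_{q-2}\zeta_q^{q-2}$. Let $G_{m,q}=\langle \sigma,\tau : \sigma^m=\tau^q=1,\ \tau^{-1}\sigma\tau=\sigma^t\rangle$. If $k$ is a field with $\zeta_m,\zeta_q\in k$, then $k(G_{m,q})$ is rational over $k$.
   Context: For a finite group $G$ and a field $k$, let $k(x(g):g\in G)$ be the rational function field in variables $x(g)$ indexed by $G$, with $G$ acting by $k$-automorphisms via $h\cdot x(g)=x(hg)$; then $k(G)$ denotes the fixed field of this action. $\zeta_e$ denotes a primitive $e$-th root of unity; $N_{\mathbb{Q}(\zeta_q)/\mathbb{Q}}$ is the field norm. Saying $\zeta_r\in k$ includes the requirement that either $\operatorname{char}k=0$ or $\operatorname{char}k\nmid r$. Rational means purely transcendental. *)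

theory Defs
  imports
    "HOL-Algebra.Algebraic_Closure_Type"
    "HOL-Algebra.Embedded_Algebras"
    "HOL-Algebra.Generated_Fields"
    "HOL-Library.Poly_Mapping"
    "HOL-Number_Theory.Number_Theory"
    "Jordan_Normal_Form.Determinant"
begin

section \<open>Subfields of a field\<close>

text \<open>
  Fields are subfields of an arbitrary type of class \<open>field\<close>; the ring record below gives access
  to \<^const>\<open>subfield\<close>, \<^const>\<open>generate_field\<close> and \<^const>\<open>ring_iso\<close>.
\<close>

abbreviation amb :: "'a::field ring" where
  "amb \<equiv> ring_of_type_algebra"

text \<open>The field \<open>k(S)\<close>.\<close>

definition adjoin :: "'a::field set \<Rightarrow> 'a set \<Rightarrow> 'a set" where
  "adjoin k S = generate_field amb (k \<union> S)"

definition primitive_root_of_unity :: "nat \<Rightarrow> 'a::field \<Rightarrow> bool" where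
  "primitive_root_of_unity n z \<longleftrightarrow> n > 0 \<and> z ^ n = 1 \<and> (\<forall>j. 0 < j \<and> j < n \<longrightarrow> z ^ j \<noteq> 1)"

text \<open>
  The convention for \<open>\<zeta>\<^sub>r \<in> k\<close>; a subfield has the characteristic of the ambient field.
\<close>

definition contains_root_of_unity :: "'a::field set \<Rightarrow> nat \<Rightarrow> bool" where
  "contains_root_of_unity k r \<longleftrightarrow>
     (CHAR('a) = 0 \<or> \<not> CHAR('a) dvd r) \<and> (\<exists>z\<in>k. primitive_root_of_unity r z)"


section \<open>Purely transcendental extensions\<close>

text \<open>
  A polynomial in variables from \<open>'i\<close> maps monomials to coefficients, and a monomial maps
  variables to exponents.
\<close>

definition mpoly_eval :: "('i \<Rightarrow> 'a::field) \<Rightarrow> (('i \<Rightarrow>\<^sub>0 nat) \<Rightarrow>\<^sub>0 'a) \<Rightarrow> 'a" where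
  "mpoly_eval x p =
     (\<Sum>m\<in>Poly_Mapping.keys p. Poly_Mapping.lookup p m *
        (\<Prod>i\<in>Poly_Mapping.keys m. x i ^ Poly_Mapping.lookup m i))"

text \<open>
  Independence of a family, not of its image: a family with a repetition is dependent.
\<close>

definition alg_independent :: "'a::field set \<Rightarrow> ('i \<Rightarrow> 'a) \<Rightarrow> 'i set \<Rightarrow> bool" where
  "alg_independent k x I \<longleftrightarrow>
     (\<forall>p. (\<forall>m. Poly_Mapping.lookup p m \<in> k) \<and> (\<forall>m\<in>Poly_Mapping.keys p. Poly_Mapping.keys m \<subseteq> I) \<and>
        mpoly_eval x p = 0 \<longrightarrow> p = 0)"

text \<open>
  \<open>K\<close> is the rational function field over \<open>k\<close> in the variables \<open>x i\<close>, \<open>i \<in> I\<close>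
  (which determines \<open>K\<close> up to an isomorphism over \<open>k\<close> preserving the variables).
\<close>

definition rational_function_field ::
    "'a::field set \<Rightarrow> ('i \<Rightarrow> 'a) \<Rightarrow> 'i set \<Rightarrow> 'a set \<Rightarrow> bool" where
  "rational_function_field k x I K \<longleftrightarrow>
     subfield k amb \<and> alg_independent k x I \<and> K = adjoin k (x ` I)"

definition purely_transcendental :: "'a::field set \<Rightarrow> 'a set \<Rightarrow> bool" where
  "purely_transcendental k L \<longleftrightarrow> (\<exists>S. alg_independent k (\<lambda>s. s) S \<and> L = adjoin k S)"


section \<open>The action of a group on the variables indexed by it\<close>

text \<open>Every \<open>act h\<close> is a \<open>k\<close>-automorphism of \<open>K\<close> with \<open>h \<cdot> x(g) = x(hg)\<close>. If \<open>K\<close>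
  is the rational function field in the variables \<open>x(g)\<close>, there is exactly one such map on \<open>K\<close>.\<close>

definition variable_action ::
    "'a::field set \<Rightarrow> ('g, 'b) monoid_scheme \<Rightarrow> ('g \<Rightarrow> 'a) \<Rightarrow> 'a set \<Rightarrow> ('g \<Rightarrow> 'a \<Rightarrow> 'a) \<Rightarrow> bool"
  where
  "variable_action k G x K act \<longleftrightarrow>
     (\<forall>h\<in>carrier G.
        act h \<in> ring_iso (amb\<lparr>carrier := K\<rparr>) (amb\<lparr>carrier := K\<rparr>) \<and>
        (\<forall>c\<in>k. act h c = c) \<and>
        (\<forall>g\<in>carrier G. act h (x g) = x (h \<otimes>\<^bsub>G\<^esub> g)))"

definition fixed_field :: "('g, 'b) monoid_scheme \<Rightarrow> 'a set \<Rightarrow> ('g \<Rightarrow> 'a \<Rightarrow> 'a) \<Rightarrow> 'a set" where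
  "fixed_field G K act = {r \<in> K. \<forall>h\<in>carrier G. act h r = r}"


section \<open>The norm of a finite field extension\<close>

definition field_basis :: "'a::field set \<Rightarrow> 'a set \<Rightarrow> 'a list \<Rightarrow> bool" where
  "field_basis K L bs \<longleftrightarrow> ring.independent amb K bs \<and> ring.Span amb K bs = L"

text \<open>
  The determinant of the \<open>K\<close>-linear map \<open>y \<mapsto> \<alpha> y\<close> on \<open>L\<close>, whose matrix has the coordinates of
  \<open>\<alpha>\<close> times the \<open>j\<close>-th basis vector as its \<open>j\<close>-th column.
\<close>

definition field_norm :: "'a::field set \<Rightarrow> 'a set \<Rightarrow> 'a \<Rightarrow> 'a" where
  "field_norm K L \<alpha> =
     (THE d. \<exists>bs A. field_basis K L bs \<and>
        A \<in> carrier_mat (length bs) (length bs) \<and> elements_mat A \<subseteq> K \<and>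
        (\<forall>j<length bs. \<alpha> * bs ! j = (\<Sum>i<length bs. A $$ (i, j) * bs ! i)) \<and>
        d = det A)"


section \<open>Groups given by generators and relations\<close>

text \<open>Words in the generators and their formal inverses; the letter \<open>(x, False)\<close> is \<open>x\<inverse>\<close>.\<close>

type_synonym 'x word = "('x \<times> bool) list"

inductive pres_eq :: "('x word \<times> 'x word) set \<Rightarrow> 'x word \<Rightarrow> 'x word \<Rightarrow> bool"
  for R :: "('x word \<times> 'x word) set" where
  refl: "pres_eq R w w"
| sym: "pres_eq R v w \<Longrightarrow> pres_eq R w v"
| trans: "pres_eq R u v \<Longrightarrow> pres_eq R v w \<Longrightarrow> pres_eq R u w"
| cancel: "pres_eq R (u @ [(x, s), (x, \<not> s)] @ v) (u @ v)"
| relation: "(l, r) \<in> R \<Longrightarrow> pres_eq R (u @ l @ v) (u @ r @ v)"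

definition word_class :: "('x word \<times> 'x word) set \<Rightarrow> 'x word \<Rightarrow> 'x word set" where
  "word_class R w = {v. pres_eq R w v}"

definition presented_group :: "('x word \<times> 'x word) set \<Rightarrow> 'x word set monoid" where
  "presented_group R =
     \<lparr>carrier = range (word_class R),
      monoid.mult = (\<lambda>A B. \<Union>a\<in>A. \<Union>b\<in>B. word_class R (a @ b)),
      one = word_class R []\<rparr>"

lemma pres_eq_context: "pres_eq R v w \<Longrightarrow> pres_eq R (a @ v @ b) (a @ w @ b)"
proof (induction rule: pres_eq.induct)
  case (cancel u x s v)
  show ?case using pres_eq.cancel[of R "a @ u" x s "v @ b"] by simp
next
  case (relation l r u v)
  then show ?case using pres_eq.relation[of l r R "a @ u" "v @ b"] by simp
qed (use pres_eq.refl pres_eq.sym pres_eq.trans in \<open>fast+\<close>)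

lemma word_class_eq_iff: "word_class R v = word_class R w \<longleftrightarrow> pres_eq R v w"
proof
  assume "word_class R v = word_class R w"
  then have "v \<in> word_class R w" by (metis mem_Collect_eq pres_eq.refl word_class_def)
  then show "pres_eq R v w" by (simp add: word_class_def pres_eq.sym)
next
  assume "pres_eq R v w"
  then have "pres_eq R v u \<longleftrightarrow> pres_eq R w u" for u
    using pres_eq.sym pres_eq.trans by metis
  then show "word_class R v = word_class R w" by (simp add: word_class_def)
qed

lemma word_class_mult:
  "word_class R v \<otimes>\<^bsub>presented_group R\<^esub> word_class R w = word_class R (v @ w)"
proof -
  have "word_class R (a @ b) = word_class R (v @ w)"
    if "a \<in> word_class R v" "b \<in> word_class R w" for a b
  proof -
    have "pres_eq R (v @ w) (a @ w)" "pres_eq R (a @ w) (a @ b)"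
      using that pres_eq_context[of R v a "[]" w] pres_eq_context[of R w b a "[]"]
      by (auto simp: word_class_def)
    then show ?thesis
      unfolding word_class_eq_iff by (meson pres_eq.sym pres_eq.trans)
  qed
  moreover have "v \<in> word_class R v" "w \<in> word_class R w"
    by (auto simp: word_class_def intro: pres_eq.refl)
  ultimately have "(\<Union>a\<in>word_class R v. \<Union>b\<in>word_class R w. word_class R (a @ b)) =
      word_class R (v @ w)"
    by blast
  then show ?thesis by (simp add: presented_group_def)
qed

lemma word_inverse_cancel: "pres_eq R (rev (map (apsnd Not) w) @ w) []"
proof (induction w)
  case Nil
  show ?case by (simp add: pres_eq.refl)
next
  case (Cons y w)
  obtain x s where y: "y = (x, s)" by force
  have "pres_eq R (rev (map (apsnd Not) (y # w)) @ y # w) (rev (map (apsnd Not) w) @ w)"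
    using pres_eq.cancel[of R "rev (map (apsnd Not) w)" x "\<not> s" w] by (simp add: y)
  then show ?case using Cons.IH by (rule pres_eq.trans)
qed

lemma group_presented_group: "group (presented_group R)"
proof (rule groupI)
  fix A B C
  assume "A \<in> carrier (presented_group R)" "B \<in> carrier (presented_group R)"
    "C \<in> carrier (presented_group R)"
  then obtain u v w where "A = word_class R u" "B = word_class R v" "C = word_class R w"
    by (auto simp: presented_group_def)
  then show "A \<otimes>\<^bsub>presented_group R\<^esub> B \<otimes>\<^bsub>presented_group R\<^esub> C =
      A \<otimes>\<^bsub>presented_group R\<^esub> (B \<otimes>\<^bsub>presented_group R\<^esub> C)"
    by (simp add: word_class_mult)
next
  fix A assume "A \<in> carrier (presented_group R)"
  then obtain w where A: "A = word_class R w" by (auto simp: presented_group_def)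
  have one: "\<one>\<^bsub>presented_group R\<^esub> = word_class R []" by (simp add: presented_group_def)
  show "\<one>\<^bsub>presented_group R\<^esub> \<otimes>\<^bsub>presented_group R\<^esub> A = A"
    by (simp add: A one word_class_mult)
  have "word_class R (rev (map (apsnd Not) w)) \<otimes>\<^bsub>presented_group R\<^esub> A = \<one>\<^bsub>presented_group R\<^esub>"
    by (simp add: A one word_class_mult word_class_eq_iff word_inverse_cancel)
  then show "\<exists>B\<in>carrier (presented_group R). B \<otimes>\<^bsub>presented_group R\<^esub> A = \<one>\<^bsub>presented_group R\<^esub>"
    by (auto simp: presented_group_def)
next
  fix A B
  assume "A \<in> carrier (presented_group R)" "B \<in> carrier (presented_group R)"
  then obtain v w where "A = word_class R v" "B = word_class R w"
    by (auto simp: presented_group_def)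
  then have "A \<otimes>\<^bsub>presented_group R\<^esub> B = word_class R (v @ w)"
    by (simp add: word_class_mult)
  then show "A \<otimes>\<^bsub>presented_group R\<^esub> B \<in> carrier (presented_group R)"
    by (simp add: presented_group_def)
qed (simp add: presented_group_def)

datatype gens = sigma | tau

definition gen_pow :: "'x \<Rightarrow> int \<Rightarrow> 'x word" where
  "gen_pow x n = replicate (nat \<bar>n\<bar>) (x, n \<ge> 0)"

definition G_mq :: "nat \<Rightarrow> nat \<Rightarrow> int \<Rightarrow> gens word set monoid" where
  "G_mq m q t = presented_group
     {(gen_pow sigma (int m), []),
      (gen_pow tau (int q), []),
      (gen_pow tau (-1) @ gen_pow sigma 1 @ gen_pow tau 1, gen_pow sigma t)}"

end

(*
  Put x(i,j) = x(tau^i sigma^j).  A Fourier transform in j turns the variables into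
  sigma-eigenvectors Y(i,c) that tau permutes cyclically in i; write y(i) = Y(i,1).  On the ratios
  g(i) = y(i+1)/y(i), whose product over a period is 1, the sigma-invariant monomials form the ideal
  (m', zeta_q - t) of Z[zeta_q].  It has index m', so the norm condition says that alpha generates it:
  the sigma-invariant monomials are those in z(0), ..., z(q-2), where z(j) = tau^j (prod_l g(l)^(a_l)).
  The partial products of the z(j), divided by their sum, are permuted cyclically by tau and sum to 1;
  diagonalizing tau gives v(0) = 1, v(1), ..., v(q-1) with tau v(l) = omega^l v(l).  Dividing each
  tau-eigenvector of eigenvalue omega^l by v(1)^l makes it invariant, and this yields mq invariants
  generating a field F.  The field K is obtained from F by adjoining in turn v(1), g(0) and y(0), on
  which tau, sigma and sigma^m' act by primitive roots of unity whose orders match the degrees, so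
  the fixed field of K is F.  Finally K is algebraic over F, so the mq generators are independent by
  comparing transcendence degrees; the same count shows that the denominators met on the way, such as
  v(1), do not vanish.
*)
theory Submission
  imports Defs "Jordan_Normal_Form.Char_Poly" "HOL-Computational_Algebra.Polynomial_Factorial"
begin

section \<open>Subfields and finite algebras over a subfield\<close>

text \<open>The relation prod g(i) = 1 is what turns exponent vectors into elements of Z[zeta_q].
  Sigma multiplies g(i) by eps^((t-1) t^i), and eps^(t-1) has order m' = m / gcd(m, t-1). So a
  monomial is invariant when its exponent vector vanishes under zeta_q -> t modulo m', a ring map
  onto Z/m' because m' divides 1 + t + ... + t^(q-1). The equation for b puts alpha into the kernel,
  and its norm makes the lattice it generates as large as the kernel. Tau acts on the z(j) only
  multiplicatively, z(q-1) being the inverse of the product of the others; on the partial products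
  the action is linear up to one common factor, which division by the sum removes. The exponents q,
  m' and d = gcd(m, t-1) of the three adjunctions multiply to q m, the order of the group. No Galois
  correspondence is set up: each adjunction is undone by averaging over the powers of one
  automorphism, and independence and the critical nonvanishing claims are reduced to counting q m
  elements over which all x(g) are algebraic.\<close>

lemma amb_simps [simp]:
  "carrier amb = UNIV" "monoid.mult amb = (*)" "add amb = (+)" "one amb = 1" "zero amb = 0"
  by (auto simp: ring_of_type_algebra_def)

lemma amb_field: "field (amb :: 'a::field ring)" and amb_ring: "ring (amb :: 'a::field ring)"
  and amb_comm_monoid: "comm_monoid (amb :: 'a::field ring)"
  and amb_abelian_group: "abelian_group (amb :: 'a::field ring)"
  using field_from_type_algebra[where 'a = 'a]
  by (auto intro: comm_monoid.intro
      simp: field_def domain_def cring_def ring_def)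

lemma amb_uminus [simp]: "\<ominus>\<^bsub>amb\<^esub> (x :: 'a::field) = - x"
  using abelian_group.l_neg[OF amb_abelian_group, of x] by (simp add: eq_neg_iff_add_eq_0)

lemma amb_inverse: "x \<noteq> 0 \<Longrightarrow> inv\<^bsub>amb\<^esub> (x :: 'a::field) = inverse x"
  by (rule comm_monoid.comm_inv_char[OF amb_comm_monoid]) auto

lemma subfield_uminus: "subfield F amb \<Longrightarrow> x \<in> F \<Longrightarrow> - x \<in> F"
  using subringE(5)[OF subfieldE(1), of F amb x] by simp

lemma subfield_inverse: "subfield F amb \<Longrightarrow> x \<in> F \<Longrightarrow> inverse x \<in> F"
  using ring.subfield_m_inv(1)[OF amb_ring, of F x] subringE(2)[OF subfieldE(1), of F amb]
  by (cases "x = 0") (auto simp: amb_inverse)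

lemma subfield_basics:
  assumes "subfield F amb"
  shows "0 \<in> F" "1 \<in> F" "x \<in> F \<Longrightarrow> y \<in> F \<Longrightarrow> x + y \<in> F" "x \<in> F \<Longrightarrow> y \<in> F \<Longrightarrow> x * y \<in> F"
  using subringE[OF subfieldE(1)[OF assms]] by auto

lemma subfield_diff: "subfield F amb \<Longrightarrow> x \<in> F \<Longrightarrow> y \<in> F \<Longrightarrow> x - y \<in> F"
  using subfield_basics(3)[of F x "- y"] subfield_uminus[of F y] by simp

lemma subfield_divide: "subfield F amb \<Longrightarrow> x \<in> F \<Longrightarrow> y \<in> F \<Longrightarrow> x / y \<in> F"
  using subfield_basics(4)[of F x "inverse y"] subfield_inverse[of F y] by (simp add: field_simps)

lemma subfield_power: "subfield F amb \<Longrightarrow> x \<in> F \<Longrightarrow> x ^ n \<in> F"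
  by (induction n) (auto intro: subfield_basics)

lemma subfield_power_int: "subfield F amb \<Longrightarrow> x \<in> F \<Longrightarrow> x powi n \<in> F"
  by (auto simp: power_int_def intro: subfield_power subfield_inverse)

lemma subfield_sum: "subfield F amb \<Longrightarrow> (\<And>i. i \<in> A \<Longrightarrow> f i \<in> F) \<Longrightarrow> sum f A \<in> F"
  by (induction A rule: infinite_finite_induct) (auto intro: subfield_basics)

lemma subfield_prod: "subfield F amb \<Longrightarrow> (\<And>i. i \<in> A \<Longrightarrow> f i \<in> F) \<Longrightarrow> prod f A \<in> F"
  by (induction A rule: infinite_finite_induct) (auto intro: subfield_basics)

lemma subfield_of_nat: "subfield F amb \<Longrightarrow> of_nat n \<in> F"
  by (induction n) (auto intro: subfield_basics)

lemmas subfield_closed = subfield_basics subfield_uminus subfield_inverse subfield_diff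
  subfield_divide subfield_power subfield_power_int subfield_sum subfield_prod
  subfield_of_nat

lemma subfieldI_type:
  assumes "0 \<in> F" "1 \<in> F" "\<And>x y. x \<in> F \<Longrightarrow> y \<in> F \<Longrightarrow> x + y \<in> F"
    "\<And>x y. x \<in> F \<Longrightarrow> y \<in> F \<Longrightarrow> x * y \<in> F" "\<And>x. x \<in> F \<Longrightarrow> - x \<in> F"
    "\<And>x. x \<in> F \<Longrightarrow> x \<noteq> 0 \<Longrightarrow> inverse x \<in> F"
  shows "subfield F (amb :: 'a::field ring)"
proof (rule field.subfieldI'[OF amb_field])
  show "subring F (amb :: 'a ring)"
    by (rule ring.subringI[OF amb_ring]) (use assms in auto)
  show "inv\<^bsub>amb\<^esub> k \<in> F" if "k \<in> F - {\<zero>\<^bsub>amb\<^esub>}" for k :: 'a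
    using that assms(6) by (auto simp: amb_inverse)
qed

lemma subfield_adjoin [simp]: "subfield (adjoin k S) amb"
  unfolding adjoin_def by (rule field.generate_field_is_subfield[OF amb_field]) simp

lemma adjoin_base: "c \<in> k \<Longrightarrow> c \<in> adjoin k S"
  unfolding adjoin_def by (simp add: generate_field.incl)

lemma adjoin_incl: "s \<in> S \<Longrightarrow> s \<in> adjoin k S"
  unfolding adjoin_def by (simp add: generate_field.incl)

lemma adjoin_least: "subfield E amb \<Longrightarrow> k \<subseteq> E \<Longrightarrow> S \<subseteq> E \<Longrightarrow> adjoin k S \<subseteq> E"
  unfolding adjoin_def by (rule field.generate_field_min_subfield1[OF amb_field]) auto

lemma adjoin_mono: "S \<subseteq> T \<Longrightarrow> adjoin k S \<subseteq> adjoin k T"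
  by (rule adjoin_least) (auto intro: adjoin_base adjoin_incl)

lemma adjoin_adjoin: "adjoin (adjoin k A) B = adjoin k (A \<union> B)"
proof
  show "adjoin (adjoin k A) B \<subseteq> adjoin k (A \<union> B)"
    using adjoin_mono[of A "A \<union> B" k] by (intro adjoin_least) (auto intro: adjoin_incl adjoin_base)
  show "adjoin k (A \<union> B) \<subseteq> adjoin (adjoin k A) B"
    by (intro adjoin_least) (auto intro: adjoin_base adjoin_incl)
qed

text \<open>A span of an indexed family, not of a set: products \<open>b * c\<close>, powers and
  monomials then need no injectivity. \<open>E\<close> may be infinite, so a finite \<open>M\<close>
  carries the sum, while the coefficients stay total functions into \<open>F\<close>.\<close>

definition fspan :: "'a::field set \<Rightarrow> ('e \<Rightarrow> 'a) \<Rightarrow> 'e set \<Rightarrow> 'a set" where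
  "fspan F g E = {\<Sum>e\<in>M. c e * g e | M c. finite M \<and> M \<subseteq> E \<and> (\<forall>e. c e \<in> F)}"

context
  fixes F :: "'a::field set"
  assumes F: "subfield F amb"
begin

lemma fspan_base: "e \<in> E \<Longrightarrow> g e \<in> fspan F g E"
  unfolding fspan_def using subfield_closed[OF F]
  by (auto intro!: exI[of _ "{e}"] exI[of _ "\<lambda>_. 1"])

lemma fspan_0: "0 \<in> fspan F g E"
  unfolding fspan_def using subfield_closed[OF F]
  by (auto intro!: exI[of _ "{}"] exI[of _ "\<lambda>_. 1"])

lemma fspan_scale: "c \<in> F \<Longrightarrow> r \<in> fspan F g E \<Longrightarrow> c * r \<in> fspan F g E"
  unfolding fspan_def using subfield_closed[OF F]
  by (auto simp: sum_distrib_left mult.assoc[symmetric]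
      intro!: exI[of _ "\<lambda>e. c * d e" for d])

lemma fspan_cover:
  assumes "finite M'" "M \<subseteq> M'" "\<forall>e. c e \<in> F"
  obtains d where "\<forall>e. d e \<in> F" "(\<Sum>e\<in>M. c e * g e) = (\<Sum>e\<in>M'. d e * (g e::'a))"
proof
  show "\<forall>e. (if e \<in> M then c e else 0) \<in> F" using assms F subfield_closed by auto
  have "(\<Sum>e\<in>M. c e * g e) = (\<Sum>e\<in>M. (if e \<in> M then c e else 0) * g e)"
    by (rule sum.cong) auto
  also have "\<dots> = (\<Sum>e\<in>M'. (if e \<in> M then c e else 0) * g e)"
    by (rule sum.mono_neutral_left) (use assms in auto)
  finally show "(\<Sum>e\<in>M. c e * g e) = (\<Sum>e\<in>M'. (if e \<in> M then c e else 0) * g e)" .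
qed

text \<open>Needed to interchange a sum over polynomial coefficients with a sum over generators: one
  finite index set must serve all elements at once, and missing indices get the coefficient
  0.\<close>

lemma fspan_common:
  assumes "finite L" "\<And>l. l \<in> L \<Longrightarrow> r l \<in> fspan F g E"
  obtains M c where "finite M" "M \<subseteq> E" "\<And>l e. c l e \<in> F"
    "\<And>l. l \<in> L \<Longrightarrow> r l = (\<Sum>e\<in>M. c l e * g e)"
proof -
  have "\<exists>M c. finite M \<and> M \<subseteq> E \<and> (\<forall>e. c e \<in> F) \<and> (l \<in> L \<longrightarrow> r l = (\<Sum>e\<in>M. c e * g e))" for l
  proof (cases "l \<in> L")
    case True
    then show ?thesis using assms(2)[OF True] unfolding fspan_def by blast
  next
    case False
    then show ?thesis using subfield_basics(1)[OF F] by (intro exI[of _ "{}"] exI[of _ "\<lambda>_. 0"]) simp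
  qed
  then obtain M c where Mc: "\<And>l. finite (M l)" "\<And>l. M l \<subseteq> E" "\<And>l e. c l e \<in> F"
      "\<And>l. l \<in> L \<Longrightarrow> r l = (\<Sum>e\<in>M l. c l e * g e)"
    by metis
  define M' where "M' = (\<Union>l\<in>L. M l)"
  have M': "finite M'" "M' \<subseteq> E" using Mc assms(1) unfolding M'_def by auto
  define d where "d l e = (if e \<in> M l then c l e else 0)" for l e
  have "r l = (\<Sum>e\<in>M'. d l e * g e)" if "l \<in> L" for l
  proof -
    have "r l = (\<Sum>e\<in>M l. d l e * g e)"
      unfolding Mc(4)[OF that] by (rule sum.cong) (auto simp: d_def)
    also have "\<dots> = (\<Sum>e\<in>M'. d l e * g e)"
      by (rule sum.mono_neutral_left) (use M' that in \<open>auto simp: d_def M'_def\<close>)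
    finally show ?thesis .
  qed
  moreover have "d l e \<in> F" for l e using Mc(3) subfield_basics(1)[OF F] by (simp add: d_def)
  ultimately show ?thesis using M' that by blast
qed

lemma fspan_add:
  assumes "r \<in> fspan F g E" "s \<in> fspan F g E"
  shows "r + s \<in> fspan F g E"
proof -
  \<comment> \<open>\<open>bool\<close> indexes the two summands, so that both come with the same
    \<open>M\<close>.\<close>
  obtain M c where *: "finite M" "M \<subseteq> E" "\<And>l e. c l e \<in> F"
    "\<And>l. l \<in> UNIV \<Longrightarrow> (if l then r else s) = (\<Sum>e\<in>M. c l e * g e)"
    by (rule fspan_common[of UNIV "\<lambda>l. if l then r else s" g E]) (use assms in auto)
  have "r + s = (\<Sum>e\<in>M. (c True e + c False e) * g e)"
    using *(4)[of True] *(4)[of False] by (simp add: sum.distrib distrib_right)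
  then show ?thesis
    unfolding fspan_def using * subfield_closed[OF F]
    by (auto intro!: exI[of _ M] exI[of _ "\<lambda>e. c True e + c False e"])
qed

lemma fspan_sum: "(\<And>i. i \<in> A \<Longrightarrow> f i \<in> fspan F g E) \<Longrightarrow> sum f A \<in> fspan F g E"
  by (induction A rule: infinite_finite_induct) (auto intro: fspan_add fspan_0)

lemma fspan_finite:
  assumes "finite E" "r \<in> fspan F g E"
  obtains c where "\<forall>e. c e \<in> F" "r = (\<Sum>e\<in>E. c e * g e)"
proof -
  obtain M c where "finite M" "M \<subseteq> E" "\<forall>e. c e \<in> F" "r = (\<Sum>e\<in>M. c e * g e)"
    using assms(2) unfolding fspan_def by auto
  then show thesis by (intro fspan_cover[of E M c g, OF assms(1) _ _ that]) auto
qed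

lemma fspan_least:
  assumes "\<And>e. e \<in> E \<Longrightarrow> g e \<in> fspan F h D"
  shows "fspan F g E \<subseteq> fspan F h D"
  unfolding fspan_def[of F g E] using assms by (auto intro!: fspan_sum fspan_scale)

lemma fspan_mult:
  assumes "\<And>e e'. e \<in> E \<Longrightarrow> e' \<in> E' \<Longrightarrow> g e * g' e' \<in> fspan F h D"
    and "r \<in> fspan F g E" "s \<in> fspan F g' E'"
  shows "r * s \<in> fspan F h D"
proof -
  obtain M c where 1: "finite M" "M \<subseteq> E" "\<forall>e. c e \<in> F" "r = (\<Sum>e\<in>M. c e * g e)"
    using assms(2) unfolding fspan_def by auto
  obtain N d where 2: "finite N" "N \<subseteq> E'" "\<forall>e. d e \<in> F" "s = (\<Sum>e\<in>N. d e * g' e)"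
    using assms(3) unfolding fspan_def by auto
  have "(\<Sum>i\<in>M. \<Sum>j\<in>N. (c i * g i) * (d j * g' j)) = (\<Sum>i\<in>M. \<Sum>j\<in>N. (c i * d j) * (g i * g' j))"
    by (intro sum.cong) (auto simp: algebra_simps)
  moreover have "\<dots> \<in> fspan F h D"
    by (intro fspan_sum fspan_scale[of "c i * d j" for i j] assms(1))
      (use 1 2 subfield_basics(4)[OF F] in auto)
  ultimately show ?thesis unfolding 1 2 sum_product by metis
qed

end

section \<open>Algebraic elements as eigenvalues of multiplication matrices\<close>

definition algebraic_over :: "'a::field set \<Rightarrow> 'a \<Rightarrow> bool" where
  "algebraic_over F a \<longleftrightarrow> (\<exists>p. p \<noteq> 0 \<and> (\<forall>i. coeff p i \<in> F) \<and> poly p a = 0)"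

context
  fixes F :: "'a::field set"
  assumes F: "subfield F amb"
begin

lemma coeff_sum_closed: "(\<And>i n. i \<in> A \<Longrightarrow> coeff (f i) n \<in> F) \<Longrightarrow> coeff (sum f A) n \<in> F"
  by (simp add: coeff_sum subfield_sum[OF F])

lemma coeff_mult_closed:
  "(\<And>n. coeff p n \<in> F) \<Longrightarrow> (\<And>n. coeff q n \<in> F) \<Longrightarrow> coeff (p * q) n \<in> F"
  by (simp add: coeff_mult subfield_sum[OF F] subfield_basics(4)[OF F])

lemma coeff_prod_closed: "(\<And>i n. i \<in> A \<Longrightarrow> coeff (f i) n \<in> F) \<Longrightarrow> coeff (prod f A) n \<in> F"
proof (induction A arbitrary: n rule: infinite_finite_induct)
  case (insert x A)
  then show ?case by (simp add: coeff_mult_closed)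
qed (auto simp: coeff_1 subfield_basics[OF F])

text \<open>The characteristic polynomial has coefficients in \<open>F\<close>, so Cayley-Hamilton replaces
  minimal polynomials and dimension counts below.\<close>

lemma algebraic_over_eigenvalue:
  assumes A: "A \<in> carrier_mat n n" "elements_mat A \<subseteq> F"
    and v: "v \<in> carrier_vec n" "v \<noteq> 0\<^sub>v n" "A *\<^sub>v v = a \<cdot>\<^sub>v v"
  shows "algebraic_over F a"
  unfolding algebraic_over_def
proof (intro exI conjI allI)
  show "char_poly A \<noteq> 0" using degree_monic_char_poly[OF A(1)] by auto
  have "eigenvalue A a"
    unfolding eigenvalue_def eigenvector_def using A v by auto
  then show "poly (char_poly A) a = 0" using eigenvalue_root_char_poly[OF A(1)] by simp
  have el: "A $$ (i, j) \<in> F" if "i < n" "j < n" for i j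
    using A that by (force simp: elements_mat_def)
  have "coeff (char_poly_matrix A $$ (i, j)) l \<in> F" if "i < n" "j < n" for i j l
    using that A(1) el[of i j] subfield_closed[OF F]
    by (auto simp: char_poly_matrix_def coeff_pCons coeff_1 split: nat.splits)
  then show "coeff (char_poly A) l \<in> F" for l
    unfolding char_poly_def det_def'[OF char_poly_matrix_closed[OF A(1)]]
    by (intro coeff_sum_closed coeff_mult_closed coeff_prod_closed)
      (auto simp: sign_def coeff_1 subfield_closed[OF F] permutes_in_image)
qed

text \<open>Expanding each \<open>a * g e\<close> over the family gives a matrix with entries in
  \<open>F\<close> for which the vector of all \<open>g e\<close> is an eigenvector of eigenvalue
  \<open>a\<close>. That vector has only to be nonzero, so any spanning family with a nonzero member
  will do.\<close>

lemma algebraic_over_fspan: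
  assumes E: "finite E" "\<exists>e\<in>E. g e \<noteq> 0" and a: "\<And>e. e \<in> E \<Longrightarrow> a * g e \<in> fspan F g E"
  shows "algebraic_over F a"
proof -
  obtain h where h: "bij_betw h {..<card E} E"
    using ex_bij_betw_nat_finite[OF E(1)] by (auto simp: atLeast0LessThan)
  have "\<exists>c. (\<forall>e. c e \<in> F) \<and> (e \<in> E \<longrightarrow> a * g e = (\<Sum>e\<in>E. c e * g e))" for e
  proof (cases "e \<in> E")
    case True
    show ?thesis by (rule fspan_finite[OF F E(1) a[OF True]]) blast
  next
    case False
    then show ?thesis using subfield_basics(1)[OF F] by (intro exI[of _ "\<lambda>_. 0"]) simp
  qed
  then obtain c where c: "\<And>e e'. c e e' \<in> F"
    "\<And>e. e \<in> E \<Longrightarrow> a * g e = (\<Sum>e'\<in>E. c e e' * g e')" by metis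
  define n A v where "n = card E" and "A = mat n n (\<lambda>(i, j). c (h i) (h j))"
    and "v = vec n (\<lambda>i. g (h i))"
  show ?thesis
  proof (rule algebraic_over_eigenvalue)
    show "A \<in> carrier_mat n n" "v \<in> carrier_vec n" by (auto simp: A_def v_def)
    show "elements_mat A \<subseteq> F" using c(1) by (auto simp: A_def elements_mat_def)
    obtain e where "e \<in> E" "g e \<noteq> 0" using E(2) by auto
    then obtain i where "i < n" "v $ i \<noteq> 0"
      using h by (force simp: bij_betw_def v_def n_def image_iff)
    then show "v \<noteq> 0\<^sub>v n" by auto
    show "A *\<^sub>v v = a \<cdot>\<^sub>v v"
    proof (rule eq_vecI)
      fix i assume "i < dim_vec (a \<cdot>\<^sub>v v)"
      then have i: "i < n" by (simp add: v_def)
      have "(A *\<^sub>v v) $ i = (\<Sum>j<n. c (h i) (h j) * g (h j))"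
        using i by (simp add: A_def v_def scalar_prod_def atLeast0LessThan)
      also have "\<dots> = (\<Sum>e'\<in>E. c (h i) e' * g e')"
        unfolding n_def by (rule sum.reindex_bij_betw[OF h])
      also have "\<dots> = (a \<cdot>\<^sub>v v) $ i"
        using c(2)[of "h i"] i bij_betwE[OF h] by (simp add: v_def n_def)
      finally show "(A *\<^sub>v v) $ i = (a \<cdot>\<^sub>v v) $ i" .
    qed (simp add: A_def v_def)
  qed
qed

text \<open>A relation c + u p(u) = 0 with c nonzero gives the inverse of \<open>u\<close> as
  -p(u)/c; if c = 0 the factor u is cancelled, which is the induction on the polynomial.\<close>

lemma algebraic_over_inverse_mem:
  assumes V: "F \<subseteq> V" "\<And>x y. x \<in> V \<Longrightarrow> y \<in> V \<Longrightarrow> x + y \<in> V" "\<And>x y. x \<in> V \<Longrightarrow> y \<in> V \<Longrightarrow> x * y \<in> V"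
    and u: "u \<in> V" "algebraic_over F u"
  shows "inverse u \<in> V"
proof (cases "u = 0")
  case False
  obtain p where "p \<noteq> 0" "\<forall>i. coeff p i \<in> F" "poly p u = 0"
    using u unfolding algebraic_over_def by blast
  then show ?thesis
  proof (induction p rule: pCons_induct)
    case (pCons c p)
    have cF: "coeff p i \<in> F" for i using pCons.prems(2) by (metis coeff_pCons_Suc)
    show ?case
    proof (cases "c = 0")
      case True
      then show ?thesis using pCons False cF by auto
    next
      case c: False
      have "\<forall>i. coeff r i \<in> F \<Longrightarrow> poly r u \<in> V" for r
      proof (induction r rule: pCons_induct)
        case (pCons d r)
        then have "d \<in> F" "\<forall>i. coeff r i \<in> F" by (metis coeff_pCons_0, metis coeff_pCons_Suc)
        then show ?case using pCons.IH V u by auto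
      qed (use V subfield_basics[OF F] in auto)
      moreover have "inverse u = (- inverse c) * poly p u"
        using pCons.prems(3) c False by (simp add: field_simps) (metis add.commute add_eq_0_iff)
      moreover have "- inverse c \<in> F"
        using pCons.prems(2) by (metis F coeff_pCons_0 subfield_inverse subfield_uminus)
      ultimately show ?thesis using V(1,3) cF by (metis subsetD)
    qed
  qed simp
qed (use V subfield_basics[OF F] in auto)

text \<open>Stands for a finite extension of \<open>F\<close> inside the ambient field. Only a
  finite spanning set is recorded; inverses come from
  \<open>algebraic_over_inverse_mem\<close>.\<close>

definition finite_algebra :: "'a set \<Rightarrow> bool" where
  "finite_algebra V \<longleftrightarrow> (\<exists>B. finite B \<and> V = fspan F id B) \<and> 1 \<in> V \<and>
     (\<forall>x\<in>V. \<forall>y\<in>V. x * y \<in> V)"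

lemma finite_algebra_algebraic:
  assumes "finite_algebra V" "a \<in> V"
  shows "algebraic_over F a"
proof -
  obtain B where B: "finite B" "V = fspan F id B" using assms unfolding finite_algebra_def by auto
  have "\<exists>b\<in>B. b \<noteq> 0"
  proof (rule ccontr)
    assume *: "\<not> ?thesis"
    have "1 \<in> fspan F id B" using assms B unfolding finite_algebra_def by auto
    then obtain c where "1 = (\<Sum>e\<in>B. c e * id e)" using fspan_finite[OF F B(1)] by metis
    moreover have "(\<Sum>e\<in>B. c e * id e) = 0" using * by (intro sum.neutral) auto
    ultimately show False by simp
  qed
  then show ?thesis using B assms fspan_base[OF F, of _ B id]
    by (intro algebraic_over_fspan[of B id a]) (auto simp: finite_algebra_def)
qed

lemma finite_algebra_base: "finite_algebra V \<Longrightarrow> F \<subseteq> V"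
  unfolding finite_algebra_def using fspan_scale[OF F, of _ 1] by fastforce

lemma finite_algebra_subfield:
  assumes "finite_algebra V"
  shows "subfield V amb"
proof (rule subfieldI_type)
  show "1 \<in> V" "0 \<in> V" using assms finite_algebra_base subfield_basics[OF F]
    by (auto simp: finite_algebra_def)
  show add: "x + y \<in> V" and mult: "x * y \<in> V" if "x \<in> V" "y \<in> V" for x y
    using assms that by (auto simp: finite_algebra_def intro: fspan_add[OF F])
  show "- x \<in> V" if "x \<in> V" for x
    using mult[of "- 1" x] that finite_algebra_base[OF assms] subfield_closed(2,5)[OF F] by auto
  show "inverse x \<in> V" if "x \<in> V" for x
    using algebraic_over_inverse_mem[of V x] that add mult finite_algebra_base[OF assms]
      finite_algebra_algebraic[OF assms] by blast
qed

lemma fspan_image: "fspan F g E = fspan F id (g ` E)"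
  using fspan_least[OF F, of E g id "g ` E"] fspan_least[OF F, of "g ` E" id g E]
    fspan_base[OF F, of _ E g] fspan_base[OF F, of _ "g ` E" id] by fastforce

text \<open>Dividing by the leading coefficient of \<open>p\<close> rewrites
  \<open>a ^ degree p\<close> in lower powers. Any nonzero polynomial with root \<open>a\<close>
  will do, so no minimal polynomial is chosen.\<close>

lemma power_in_fspan_powers:
  assumes p: "p \<noteq> 0" "\<forall>i. coeff p i \<in> F" "poly p a = 0" and r: "r \<in> fspan F (\<lambda>j. a ^ j) {..<degree p}"
  shows "a * r \<in> fspan F (\<lambda>j. a ^ j) {..<degree p}"
proof -
  let ?V = "fspan F (\<lambda>j. a ^ j) {..<degree p}"
  have *: "a * a ^ j \<in> ?V" if "j < degree p" for j
  proof (cases "Suc j < degree p")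
    case True
    then show ?thesis using fspan_base[OF F, of "Suc j" "{..<degree p}" "\<lambda>j. a ^ j"] by simp
  next
    case False
    then have j: "Suc j = degree p" using that by simp
    have "0 = (\<Sum>i\<le>degree p. coeff p i * a ^ i)" using p(3) by (simp add: poly_altdef)
    also have "\<dots> = (\<Sum>i<degree p. coeff p i * a ^ i) + lead_coeff p * a ^ degree p"
      by (simp add: lessThan_Suc_atMost[symmetric])
    finally have "lead_coeff p * a ^ degree p = - (\<Sum>i<degree p. coeff p i * a ^ i)"
      by (simp add: eq_neg_iff_add_eq_0 add.commute)
    then have "a ^ degree p = (- inverse (lead_coeff p)) * (\<Sum>i<degree p. coeff p i * a ^ i)"
      using p(1) by (simp add: field_simps)
    moreover have "\<dots> \<in> ?V"
      using p(2) subfield_closed[OF F]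
      by (intro fspan_scale[OF F] fspan_sum[OF F] fspan_base[OF F]) auto
    ultimately show ?thesis using j by (metis power_Suc)
  qed
  have "a \<in> fspan F (\<lambda>_. a) {()}" using fspan_base[OF F] by force
  from fspan_mult[OF F _ this r, where h = "\<lambda>j. a ^ j" and D = "{..<degree p}"] show ?thesis using * by simp
qed

lemma finite_algebra_powers:
  assumes p: "p \<noteq> 0" "\<forall>i. coeff p i \<in> F" "poly p a = 0"
  shows "finite_algebra (fspan F (\<lambda>j. a ^ j) {..<degree p})" "a \<in> fspan F (\<lambda>j. a ^ j) {..<degree p}"
proof -
  let ?V = "fspan F (\<lambda>j. a ^ j) {..<degree p}"
  have "degree p \<noteq> 0"
  proof
    assume "degree p = 0"
    then obtain c where "p = [:c:]" by (rule degree_eq_zeroE)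
    then show False using p by simp
  qed
  then have one: "1 \<in> ?V" using fspan_base[OF F, of 0 "{..<degree p}" "\<lambda>j. a ^ j"] by simp
  then show "a \<in> ?V" using power_in_fspan_powers[OF p one] by simp
  have pw: "a ^ i * r \<in> ?V" if "r \<in> ?V" for i r
    by (induction i) (simp_all add: that mult.assoc power_in_fspan_powers[OF p])
  have "r * s \<in> ?V" if "r \<in> ?V" "s \<in> ?V" for r s
    by (rule fspan_mult[OF F _ that]) (intro pw fspan_base[OF F])
  then show "finite_algebra ?V"
    unfolding finite_algebra_def using one fspan_image[of "\<lambda>j. a ^ j"] by blast
qed

end

section \<open>Algebraic elements\<close>

lemma fspanE:
  assumes "r \<in> fspan F g E"
  obtains M c where "finite M" "M \<subseteq> E" "\<forall>e. c e \<in> F" "r = (\<Sum>e\<in>M. c e * g e)"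
  using assms unfolding fspan_def by blast

lemma fspan_nonzero:
  assumes "subfield F amb" "r \<in> fspan F g E" "r \<noteq> 0"
  shows "\<exists>e\<in>E. g e \<noteq> 0"
proof (rule ccontr)
  assume *: "\<not> ?thesis"
  obtain M c where "M \<subseteq> E" "r = (\<Sum>e\<in>M. c e * g e)" using assms(2) unfolding fspan_def by auto
  moreover have "(\<Sum>e\<in>M. c e * g e) = 0" using * \<open>M \<subseteq> E\<close> by (intro sum.neutral) auto
  ultimately show False using assms(3) by simp
qed

definition algebraic_closure_in :: "'a::field set \<Rightarrow> 'a set" where
  "algebraic_closure_in F = {a. algebraic_over F a}"

context
  fixes F :: "'a::field set"
  assumes F: "subfield F amb"
begin

text \<open>The compositum is spanned by the products \<open>b * c\<close> of the two spanning sets;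
  commutativity brings a product of two such products back to one element of \<open>V\<close> times
  one of \<open>W\<close>.\<close>

lemma finite_algebra_join:
  assumes "finite_algebra F V" "finite_algebra F W"
  obtains U where "finite_algebra F U" "V \<subseteq> U" "W \<subseteq> U"
proof -
  obtain B C where B: "finite B" "V = fspan F id B" and C: "finite C" "W = fspan F id C"
    using assms unfolding finite_algebra_def[OF F] by auto
  define g :: "'a \<times> 'a \<Rightarrow> 'a" where "g = (\<lambda>(b, c). b * c)"
  define U where "U = fspan F g (B \<times> C)"
  have prod: "v * w \<in> U" if "v \<in> V" "w \<in> W" for v w
    unfolding U_def using that unfolding B C
    by (rule fspan_mult[OF F, rotated]) (use fspan_base[OF F, of _ "B \<times> C" g] in \<open>auto simp: g_def\<close>)
  have 1: "1 \<in> V" "1 \<in> W" using assms unfolding finite_algebra_def[OF F] by auto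
  have "r * s \<in> U" if "r \<in> U" "s \<in> U" for r s
  proof -
    have "g p * g p' \<in> U" if "p \<in> B \<times> C" "p' \<in> B \<times> C" for p p'
    proof -
      have "fst p * fst p' \<in> V" "snd p * snd p' \<in> W"
        using assms that fspan_base[OF F, of _ B id] fspan_base[OF F, of _ C id] B C
        unfolding finite_algebra_def[OF F] by (auto simp: mem_Times_iff)
      from prod[OF this] show ?thesis by (simp add: g_def case_prod_unfold ac_simps)
    qed
    then show ?thesis using that unfolding U_def by (rule fspan_mult[OF F])
  qed
  moreover have "1 \<in> U" using prod[of 1 1] 1 by simp
  ultimately have "finite_algebra F U"
    unfolding finite_algebra_def[OF F] using B(1) C(1)
    by (auto simp: U_def fspan_image[OF F, of g] intro!: exI[of _ "g ` (B \<times> C)"])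
  moreover have "V \<subseteq> U" "W \<subseteq> U" using prod[OF _ 1(2)] prod[OF 1(1)] by auto
  ultimately show ?thesis using that by blast
qed

lemma algebraic_finite_algebra:
  assumes "algebraic_over F a"
  obtains V where "finite_algebra F V" "a \<in> V"
  using assms finite_algebra_powers[OF F] unfolding algebraic_over_def by metis

text \<open>Sums, products and inverses of algebraic elements can then be formed inside a single
  finite algebra, which is a field. Joins give the induction step, and an algebra containing 0
  starts it.\<close>

lemma algebraic_closure_in_cover:
  assumes "finite S" "S \<subseteq> algebraic_closure_in F"
  obtains V where "finite_algebra F V" "S \<subseteq> V"
  using assms
proof (induction S arbitrary: thesis)
  case empty
  have "algebraic_over F 0" unfolding algebraic_over_def
    using subfield_basics[OF F] by (intro exI[of _ "[:0, 1:]"]) (auto simp: coeff_pCons split: nat.splits)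
  then show ?case using empty algebraic_finite_algebra by blast
next
  case (insert a S)
  obtain V where "finite_algebra F V" "S \<subseteq> V" using insert by auto
  moreover obtain W where "finite_algebra F W" "a \<in> W"
    using insert.prems algebraic_finite_algebra by (auto simp: algebraic_closure_in_def)
  moreover obtain U where "finite_algebra F U" "V \<subseteq> U" "W \<subseteq> U"
    using finite_algebra_join calculation by metis
  ultimately show ?case using insert.prems by blast
qed

lemma finite_algebra_sub_closure: "finite_algebra F V \<Longrightarrow> V \<subseteq> algebraic_closure_in F"
  using finite_algebra_algebraic[OF F] by (auto simp: algebraic_closure_in_def)

lemma algebraic_closure_in_base: "F \<subseteq> algebraic_closure_in F"
  using algebraic_closure_in_cover[of "{}"] finite_algebra_base[OF F] finite_algebra_sub_closure
  by (metis empty_subsetI finite.emptyI subset_trans)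

lemma subfield_algebraic_closure_in: "subfield (algebraic_closure_in F) amb"
proof (rule subfieldI_type)
  show "0 \<in> algebraic_closure_in F" "1 \<in> algebraic_closure_in F"
    using algebraic_closure_in_base subfield_basics[OF F] by auto
next
  fix x y assume "x \<in> algebraic_closure_in F" "y \<in> algebraic_closure_in F"
  then obtain V where V: "finite_algebra F V" "{x, y} \<subseteq> V"
    using algebraic_closure_in_cover[of "{x, y}"] by blast
  have "x + y \<in> V" "x * y \<in> V" "- x \<in> V" "inverse x \<in> V"
    using V(2) subfield_closed[OF finite_algebra_subfield[OF F V(1)]] by auto
  then show "x + y \<in> algebraic_closure_in F" "x * y \<in> algebraic_closure_in F"
    using finite_algebra_sub_closure[OF V(1)] by auto
next
  fix x assume "x \<in> algebraic_closure_in F"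
  then obtain V where V: "finite_algebra F V" "{x} \<subseteq> V"
    using algebraic_closure_in_cover[of "{x}"] by blast
  have "- x \<in> V" "inverse x \<in> V"
    using V(2) subfield_closed(5,6)[OF finite_algebra_subfield[OF F V(1)]] by auto
  then show "- x \<in> algebraic_closure_in F" "inverse x \<in> algebraic_closure_in F"
    using finite_algebra_sub_closure[OF V(1)] by auto
qed

text \<open>The coefficients of the equation for \<open>a\<close> lie in one finite algebra
  \<open>V\<close>. The products of a spanning set of \<open>V\<close> with the powers of
  \<open>a\<close> below the degree span over \<open>F\<close> a space stable under multiplication
  by \<open>a\<close>, so \<open>a\<close> is again an eigenvalue.\<close>

lemma algebraic_over_trans:
  assumes "algebraic_over (algebraic_closure_in F) a"
  shows "algebraic_over F a"
proof -
  obtain p where p: "p \<noteq> 0" "\<forall>i. coeff p i \<in> algebraic_closure_in F" "poly p a = 0"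
    using assms unfolding algebraic_over_def by blast
  obtain V where V: "finite_algebra F V" "coeff p ` {..degree p} \<subseteq> V"
    using algebraic_closure_in_cover[of "coeff p ` {..degree p}"] p(2) by blast
  note sV = finite_algebra_subfield[OF F V(1)]
  obtain B where B: "finite B" "V = fspan F id B" using V unfolding finite_algebra_def[OF F] by auto
  have pV: "\<forall>i. coeff p i \<in> V"
  proof
    show "coeff p i \<in> V" for i
      using V(2) subfield_basics(1)[OF sV] by (cases "i \<le> degree p") (auto simp: coeff_eq_0)
  qed
  define n where "n = degree p"
  define g :: "'a \<times> nat \<Rightarrow> 'a" where "g = (\<lambda>(b, j). b * a ^ j)"
  have *: "v * a ^ j \<in> fspan F g (B \<times> {..<n})" if "v \<in> V" "j < n" for v j
  proof (rule fspan_mult[OF F])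
    show "v \<in> fspan F id B" using that B by simp
    show "a ^ j \<in> fspan F (\<lambda>j. a ^ j) {j}" by (rule fspan_base[OF F]) simp
  qed (use that fspan_base[OF F, of _ "B \<times> {..<n}" g] in \<open>auto simp: g_def\<close>)
  have sub: "r \<in> fspan F g (B \<times> {..<n})" if r: "r \<in> fspan V (\<lambda>j. a ^ j) {..<n}" for r
  proof -
    obtain M c where "M \<subseteq> {..<n}" "\<forall>e. c e \<in> V" "r = (\<Sum>e\<in>M. c e * a ^ e)"
      by (rule fspanE[OF r])
    then show ?thesis using * by (auto intro!: fspan_sum[OF F])
  qed
  have "a * g e \<in> fspan F g (B \<times> {..<n})" if eB: "e \<in> B \<times> {..<n}" for e
  proof -
    obtain b j where e: "e = (b, j)" "b \<in> B" "j < n" using eB by auto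
    have "a * a ^ j \<in> fspan V (\<lambda>j. a ^ j) {..<n}"
      unfolding n_def using e
      by (intro power_in_fspan_powers[OF sV p(1) pV p(3)] fspan_base[OF sV]) (auto simp: n_def)
    moreover have "b \<in> V" unfolding B using fspan_base[OF F e(2), of id] by simp
    ultimately have "b * (a * a ^ j) \<in> fspan V (\<lambda>j. a ^ j) {..<n}" by (rule fspan_scale[OF sV, rotated])
    from sub[OF this] show ?thesis by (simp add: e g_def ac_simps)
  qed
  moreover have one: "1 \<in> fspan F g (B \<times> {..<n})"
    using sub[of 1] finite_algebra_powers(1)[OF sV p(1) pV p(3)]
    unfolding finite_algebra_def[OF sV] n_def by auto
  moreover have "\<exists>e\<in>B \<times> {..<n}. g e \<noteq> 0" by (rule fspan_nonzero[OF F one]) simp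
  ultimately show ?thesis using B(1)
    by (intro algebraic_over_fspan[OF F, of "B \<times> {..<n}" g]) auto
qed

lemma algebraic_over_root:
  assumes "w ^ n \<in> F" "n > 0"
  shows "algebraic_over F w"
  unfolding algebraic_over_def
proof (intro exI conjI allI)
  have *: "coeff (monom 1 n - [:w ^ n:]) n = 1"
    using assms by (simp add: coeff_pCons split: nat.splits)
  show "monom 1 n - [:w ^ n:] \<noteq> 0"
  proof
    assume "monom 1 n - [:w ^ n:] = 0"
    with * show False by simp
  qed
  show "coeff (monom 1 n - [:w ^ n:]) i \<in> F" for i
    using assms subfield_closed(1,2,5,7)[OF F] by (auto simp: coeff_pCons split: nat.splits)
  show "poly (monom 1 n - [:w ^ n:]) w = 0" by (simp add: poly_monom)
qed

lemma adjoin_power_span: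
  assumes "w ^ n \<in> F" "n > 0"
  shows "adjoin F {w} \<subseteq> fspan F (\<lambda>j. w ^ j) {..<n}"
proof -
  define p where "p = monom 1 n - [:w ^ n:]"
  have "coeff p n = 1" using assms by (simp add: p_def coeff_pCons split: nat.splits)
  then have p0: "p \<noteq> 0" by auto
  have "degree p \<le> n" using assms by (auto simp: p_def intro!: degree_diff_le degree_monom_le)
  with \<open>coeff p n = 1\<close> have deg: "degree p = n" by (intro antisym le_degree) auto
  have "\<forall>i. coeff p i \<in> F"
    using assms subfield_closed(1,2,5,7)[OF F] by (auto simp: p_def coeff_pCons split: nat.splits)
  moreover have "poly p w = 0" by (simp add: p_def poly_monom)
  ultimately have fa: "finite_algebra F (fspan F (\<lambda>j. w ^ j) {..<n})" "w \<in> fspan F (\<lambda>j. w ^ j) {..<n}"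
    using finite_algebra_powers[OF F p0, of w] deg by auto
  then show ?thesis
    by (intro adjoin_least finite_algebra_subfield[OF F] finite_algebra_base[OF F]) auto
qed

text \<open>The quotients of elements of the ring \<open>R\<close> already form a field, and it
  contains \<open>F\<close> and \<open>S\<close>.\<close>

lemma adjoin_fraction:
  fixes g :: "'e \<Rightarrow> 'a" and E :: "'e set"
  defines "R \<equiv> fspan F g E"
  assumes one: "1 \<in> R" and mult: "\<And>e e'. e \<in> E \<Longrightarrow> e' \<in> E \<Longrightarrow> g e * g e' \<in> R" and S: "S \<subseteq> R"
  shows "r \<in> adjoin F S \<Longrightarrow> \<exists>u\<in>R. \<exists>v\<in>R. v \<noteq> 0 \<and> r = u / v"
proof -
  have m: "x * y \<in> R" if "x \<in> R" "y \<in> R" for x y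
    using mult that unfolding R_def by (rule fspan_mult[OF F])
  have a: "x + y \<in> R" if "x \<in> R" "y \<in> R" for x y
    using that unfolding R_def by (rule fspan_add[OF F])
  have c: "c * x \<in> R" if "c \<in> F" "x \<in> R" for c x
    using that unfolding R_def by (rule fspan_scale[OF F])
  let ?Q = "{r. \<exists>u\<in>R. \<exists>v\<in>R. v \<noteq> 0 \<and> r = u / v}"
  have RQ: "x \<in> ?Q" if "x \<in> R" for x using that one by (force intro: bexI[of _ 1])
  have FR: "x \<in> R" if "x \<in> F" for x using c[OF that one] by simp
  have "subfield ?Q amb"
  proof (rule subfieldI_type)
    show "0 \<in> ?Q" "1 \<in> ?Q"
      by (rule RQ[OF FR[OF subfield_basics(1)[OF F]]], rule RQ[OF one])
    fix x y assume "x \<in> ?Q" "y \<in> ?Q"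
    then obtain u v u' v' where *: "u \<in> R" "v \<in> R" "v \<noteq> 0" "x = u / v"
      "u' \<in> R" "v' \<in> R" "v' \<noteq> 0" "y = u' / v'" by auto
    have "x + y = (u * v' + u' * v) / (v * v')" "x * y = (u * u') / (v * v')"
      using * by (auto simp: field_simps)
    moreover have "v * v' \<noteq> 0" "v * v' \<in> R" "u * v' + u' * v \<in> R" "u * u' \<in> R"
      using * by (auto intro!: m a)
    ultimately show "x + y \<in> ?Q" "x * y \<in> ?Q" by blast+
  next
    fix x assume "x \<in> ?Q"
    then obtain u v where *: "u \<in> R" "v \<in> R" "v \<noteq> 0" "x = u / v" by auto
    have "- x = (- u) / v" "- u \<in> R"
      using * c[of "- 1" u] subfield_closed(2,5)[OF F] by auto
    then show "- x \<in> ?Q" using * by blast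
    show "inverse x \<in> ?Q" if "x \<noteq> 0"
      using * that by (auto simp: inverse_divide)
  qed
  then have "adjoin F S \<subseteq> ?Q" using FR RQ S by (intro adjoin_least) auto
  then show "r \<in> adjoin F S \<Longrightarrow> \<exists>u\<in>R. \<exists>v\<in>R. v \<noteq> 0 \<and> r = u / v" by auto
qed

text \<open>Turns an equation over a generated field into a polynomial relation among the
  generators; the denominators are simply multiplied together.\<close>

lemma adjoin_common_denominator:
  fixes g :: "'e \<Rightarrow> 'a" and E :: "'e set"
  defines "R \<equiv> fspan F g E"
  assumes one: "1 \<in> R" and mult: "\<And>e e'. e \<in> E \<Longrightarrow> e' \<in> E \<Longrightarrow> g e * g e' \<in> R" and S: "S \<subseteq> R"
    and L: "finite L" "\<And>l. l \<in> L \<Longrightarrow> r l \<in> adjoin F S"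
  obtains d where "d \<noteq> 0" "\<And>l. l \<in> L \<Longrightarrow> r l * d \<in> R"
proof -
  have m: "x * y \<in> R" if "x \<in> R" "y \<in> R" for x y
    using mult that unfolding R_def by (rule fspan_mult[OF F])
  have "\<exists>d. d \<in> R \<and> d \<noteq> 0 \<and> (\<forall>l\<in>L. r l * d \<in> R)"
    using L
  proof (induction L)
    case (insert l L)
    then obtain d where d: "d \<in> R" "d \<noteq> 0" "\<forall>l\<in>L. r l * d \<in> R" by auto
    obtain u v where uv: "u \<in> R" "v \<in> R" "v \<noteq> 0" "r l = u / v"
      using adjoin_fraction[of g E S "r l"] one mult S insert.prems unfolding R_def by blast
    have "r l * (d * v) = u * d" using uv by simp
    moreover have "r l' * (d * v) \<in> R" if "l' \<in> L" for l'
      using m[of "r l' * d" v] d uv that by (simp add: mult.assoc)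
    ultimately show ?case using d uv m by (intro exI[of _ "d * v"]) auto
  qed (use one in \<open>auto intro!: exI[of _ 1]\<close>)
  then show ?thesis using that by auto
qed

text \<open>After clearing denominators the equation for \<open>b\<close> over F(a) is a relation
  between powers of \<open>a\<close> and \<open>b\<close> with coefficients in \<open>F\<close>.
  Read in powers of \<open>a\<close>, its coefficients \<open>poly (R j) b\<close> lie in F(b). They
  cannot all vanish: \<open>b\<close> is transcendental over \<open>F\<close>, so every
  \<open>R j\<close> would be 0, and with them the leading coefficient of \<open>p\<close>.\<close>

lemma algebraic_exchange:
  assumes b: "algebraic_over (adjoin F {a}) b" "\<not> algebraic_over F b"
  shows "algebraic_over (adjoin F {b}) a"
proof -
  obtain p where p: "p \<noteq> 0" "\<forall>i. coeff p i \<in> adjoin F {a}" "poly p b = 0"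
    using b(1) unfolding algebraic_over_def by blast
  let ?R = "fspan F (\<lambda>j::nat. a ^ j) UNIV"
  have pw: "a ^ j \<in> ?R" for j using fspan_base[OF F, of j UNIV "\<lambda>j. a ^ j"] by simp
  obtain d where d: "d \<noteq> 0" "\<And>l. l \<in> {..degree p} \<Longrightarrow> coeff p l * d \<in> ?R"
  proof (rule adjoin_common_denominator[of "\<lambda>j. a ^ j" UNIV "{a}" "{..degree p}" "coeff p"])
    show "1 \<in> ?R" "{a} \<subseteq> ?R" using pw[of 0] pw[of 1] by auto
    show "a ^ e * a ^ e' \<in> ?R" for e e' using pw[of "e + e'"] by (simp add: power_add)
    show "coeff p l \<in> adjoin F {a}" for l using p by auto
  qed auto
  obtain M c where M: "finite M" "\<And>l e. c l e \<in> F"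
    "\<And>l. l \<in> {..degree p} \<Longrightarrow> coeff p l * d = (\<Sum>e\<in>M. c l e * a ^ e)"
    by (rule fspan_common[OF F _ d(2), of "{..degree p}" "\<lambda>l. l"]) auto
  define R where "R j = (\<Sum>l\<le>degree p. monom (c l j) l)" for j
  have R: "coeff (R j) l = (if l \<le> degree p then c l j else 0)" for j l
    by (simp add: R_def coeff_sum if_distrib cong: if_cong)
  define q where "q = (\<Sum>j\<in>M. monom (poly (R j) b) j)"
  have q: "coeff q j = (if j \<in> M then poly (R j) b else 0)" for j
    using M(1) by (simp add: q_def coeff_sum if_distrib cong: if_cong)
  have "poly q a = (\<Sum>j\<in>M. \<Sum>l\<le>degree p. c l j * b ^ l * a ^ j)"
    by (simp add: q_def R_def poly_sum poly_monom sum_distrib_right)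
  also have "\<dots> = (\<Sum>l\<le>degree p. (\<Sum>j\<in>M. c l j * a ^ j) * b ^ l)"
    by (subst sum.swap) (simp add: sum_distrib_left sum_distrib_right ac_simps)
  also have "\<dots> = (\<Sum>l\<le>degree p. coeff p l * d * b ^ l)"
    by (rule sum.cong) (auto simp: M(3))
  also have "\<dots> = d * poly p b" by (simp add: poly_altdef sum_distrib_left ac_simps)
  finally have qa: "poly q a = 0" using p by simp
  have "q \<noteq> 0"
  proof
    assume "q = 0"
    then have "poly (R j) b = 0" if "j \<in> M" for j using q[of j] that by simp
    moreover have "coeff (R j) l \<in> F" for j l using R M(2) subfield_basics(1)[OF F] by simp
    ultimately have "R j = 0" if "j \<in> M" for j using b(2) that unfolding algebraic_over_def by blast
    then have "c l j = 0" if "j \<in> M" "l \<le> degree p" for l j using R[of j l] that by simp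
    then have "coeff p (degree p) * d = 0" using M(3)[of "degree p"] by simp
    then show False using d p(1) by simp
  qed
  moreover have "coeff q j \<in> adjoin F {b}" for j
  proof -
    have "poly (R j) b \<in> adjoin F {b}" unfolding R_def poly_sum poly_monom
      using M(2) by (intro subfield_closed[OF subfield_adjoin]) (auto intro: adjoin_base adjoin_incl)
    then show ?thesis using q subfield_closed(1)[OF subfield_adjoin] by auto
  qed
  ultimately show ?thesis unfolding algebraic_over_def using qa by blast
qed

end

section \<open>Transcendence bases\<close>

text \<open>The closure operator of the algebraic matroid over \<open>k\<close>; independence and
  comparisons of transcendence degree are expressed through it.\<close>

definition dep_closure :: "'a::field set \<Rightarrow> 'a set \<Rightarrow> 'a set" where
  "dep_closure k A = algebraic_closure_in (adjoin k A)"

lemma subfield_dep_closure: "subfield (dep_closure k A) amb"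
  unfolding dep_closure_def by (rule subfield_algebraic_closure_in[OF subfield_adjoin])

lemma adjoin_dep_closure: "adjoin k A \<subseteq> dep_closure k A"
  unfolding dep_closure_def by (rule algebraic_closure_in_base[OF subfield_adjoin])

lemma dep_closure_root: "w ^ n \<in> dep_closure k A \<Longrightarrow> n > 0 \<Longrightarrow> w \<in> dep_closure k A"
  using algebraic_over_root[OF subfield_dep_closure, of w n k A]
    algebraic_over_trans[OF subfield_adjoin, of k A w]
  by (auto simp: dep_closure_def algebraic_closure_in_def)

lemma algebraic_over_mono: "F \<subseteq> F' \<Longrightarrow> algebraic_over F a \<Longrightarrow> algebraic_over F' a"
  unfolding algebraic_over_def by blast

lemma dep_closure_least:
  assumes "A \<subseteq> dep_closure k B"
  shows "dep_closure k A \<subseteq> dep_closure k B"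
proof -
  have "adjoin k A \<subseteq> dep_closure k B"
    by (rule adjoin_least[OF subfield_dep_closure _ assms])
      (use adjoin_dep_closure[of k B] in \<open>auto intro: adjoin_base\<close>)
  then show ?thesis
    using algebraic_over_trans[OF subfield_adjoin, of k B] algebraic_over_mono
    unfolding dep_closure_def algebraic_closure_in_def by blast
qed

lemma dep_closure_incl: "A \<subseteq> dep_closure k A"
  using adjoin_dep_closure[of k A] by (auto intro: adjoin_incl)

lemma dep_closure_mono: "A \<subseteq> B \<Longrightarrow> dep_closure k A \<subseteq> dep_closure k B"
  using dep_closure_incl[of B k] by (intro dep_closure_least) auto

lemma dep_closure_exchange:
  assumes "b \<in> dep_closure k (insert a A)" "b \<notin> dep_closure k A"
  shows "a \<in> dep_closure k (insert b A)"
  using algebraic_exchange[OF subfield_adjoin, of k A a b] assms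
  by (simp add: dep_closure_def algebraic_closure_in_def adjoin_adjoin)

text \<open>One element of \<open>B\<close> outside \<open>I\<close> is exchanged for one of
  \<open>I\<close> outside \<open>B\<close>. This keeps the size of \<open>B\<close>, keeps
  \<open>I\<close> in its closure, and lowers the induction measure
  \<open>card (I - B)\<close>.\<close>

lemma steinitz_card:
  assumes I: "finite I" "\<forall>a\<in>I. a \<notin> dep_closure k (I - {a})"
    and "finite B" "I \<subseteq> dep_closure k B"
  shows "card I \<le> card B"
  using assms(3,4)
proof (induction "card (I - B)" arbitrary: B rule: less_induct)
  case less
  show ?case
  proof (cases "I \<subseteq> B")
    case True
    then show ?thesis using less.prems card_mono by blast
  next
    case False
    then obtain a where a: "a \<in> I" "a \<notin> B" by auto
    \<comment> \<open>A smallest \<open>C\<close> between \<open>I \<inter> B\<close> and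
      \<open>B\<close> on which \<open>a\<close> depends. It exceeds \<open>I \<inter> B\<close>
      because \<open>I\<close> is independent, and by minimality each of its further elements can be
      exchanged with \<open>a\<close>.\<close>
    define P where "P C \<longleftrightarrow> I \<inter> B \<subseteq> C \<and> C \<subseteq> B \<and> a \<in> dep_closure k C" for C
    have "P B" using a less.prems by (auto simp: P_def)
    then obtain C where C: "P C" "\<And>D. card D < card C \<Longrightarrow> \<not> P D"
      using arg_min_nat_lemma[of P B card] by (metis not_le)
    have "a \<notin> dep_closure k (I \<inter> B)"
      using I(2) a dep_closure_mono[of "I \<inter> B" "I - {a}" k] by auto
    then have "C \<noteq> I \<inter> B" using C by (auto simp: P_def)
    then obtain b where b: "b \<in> C" "b \<notin> I \<inter> B" using C by (auto simp: P_def)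
    then have bI: "b \<in> B" "b \<notin> I" using C by (auto simp: P_def)
    have "finite C" using C less.prems by (auto simp: P_def intro: finite_subset)
    then have "\<not> P (C - {b})" using C(2) card_Diff1_less[of C b] b by blast
    then have "a \<notin> dep_closure k (C - {b})" using C(1) b by (auto simp: P_def)
    moreover have "a \<in> dep_closure k (insert b (C - {b}))" using C(1) b by (simp add: P_def insert_absorb)
    ultimately have "b \<in> dep_closure k (insert a (C - {b}))" by (rule dep_closure_exchange[rotated])
    define B' where "B' = insert a (B - {b})"
    have "b \<in> dep_closure k B'"
      using \<open>b \<in> dep_closure k (insert a (C - {b}))\<close> C(1)
        dep_closure_mono[of "insert a (C - {b})" B' k] by (auto simp: P_def B'_def)
    then have "B \<subseteq> dep_closure k B'" using dep_closure_incl[of B' k] by (auto simp: B'_def)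
    then have "I \<subseteq> dep_closure k B'" using less.prems(2) dep_closure_least by blast
    moreover have "I - B' \<subset> I - B" using a bI by (auto simp: B'_def)
    then have "card (I - B') < card (I - B)" using I(1) by (intro psubset_card_mono) auto
    moreover have "finite B'" "card B' = card B"
      using less.prems(1) a bI card_Suc_Diff1[of B b] by (auto simp: B'_def)
    ultimately show ?thesis using less.hyps[of B'] by simp
  qed
qed

text \<open>If \<open>t\<close> were redundant, \<open>T - {t}\<close> would still have
  \<open>I\<close> in its closure, with fewer elements than \<open>I\<close>. In this way the
  independence of the final generators follows from their number.\<close>

lemma generators_independent:
  assumes I: "finite I" "\<forall>a\<in>I. a \<notin> dep_closure k (I - {a})"
    and T: "finite T" "card T \<le> card I" "I \<subseteq> dep_closure k T" and t: "t \<in> T"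
  shows "t \<notin> dep_closure k (T - {t})"
proof
  assume "t \<in> dep_closure k (T - {t})"
  then have "T \<subseteq> dep_closure k (T - {t})" using dep_closure_incl[of "T - {t}" k] by auto
  then have "I \<subseteq> dep_closure k (T - {t})" using T(3) dep_closure_least by blast
  then have "card I \<le> card (T - {t})" using steinitz_card[OF I] T(1) by auto
  then show False using T t card_Diff1_less[of T t] by simp
qed

section \<open>Monomials and algebraic independence\<close>

definition monomial_eval :: "('i \<Rightarrow> 'a::field) \<Rightarrow> ('i \<Rightarrow>\<^sub>0 nat) \<Rightarrow> 'a" where
  "monomial_eval x e = (\<Prod>i\<in>Poly_Mapping.keys e. x i ^ Poly_Mapping.lookup e i)"

lemma monomial_eval_superset:
  assumes "finite S" "Poly_Mapping.keys e \<subseteq> S"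
  shows "monomial_eval x e = (\<Prod>i\<in>S. x i ^ Poly_Mapping.lookup e i)"
  unfolding monomial_eval_def
  by (rule prod.mono_neutral_left) (use assms in \<open>auto simp: in_keys_iff\<close>)

lemma monomial_eval_add: "monomial_eval x (e + e') = monomial_eval x e * monomial_eval x e'"
proof -
  let ?S = "Poly_Mapping.keys e \<union> Poly_Mapping.keys e'"
  have "monomial_eval x (e + e') = (\<Prod>i\<in>?S. x i ^ Poly_Mapping.lookup (e + e') i)"
    by (rule monomial_eval_superset) (use Poly_Mapping.keys_add[of e e'] in auto)
  also have "\<dots> = (\<Prod>i\<in>?S. x i ^ Poly_Mapping.lookup e i) * (\<Prod>i\<in>?S. x i ^ Poly_Mapping.lookup e' i)"
    by (simp add: lookup_add power_add prod.distrib)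
  also have "\<dots> = monomial_eval x e * monomial_eval x e'"
    by (simp add: monomial_eval_superset[symmetric])
  finally show ?thesis .
qed

lemma monomial_eval_single: "monomial_eval x (Poly_Mapping.single i l) = x i ^ l"
  by (simp add: monomial_eval_superset[of "{i}"] keys_single)

lemma monomial_eval_0: "monomial_eval x 0 = 1"
  by (simp add: monomial_eval_def)

definition exponents :: "'i set \<Rightarrow> ('i \<Rightarrow>\<^sub>0 nat) set" where
  "exponents J = {e. Poly_Mapping.keys e \<subseteq> J}"

lemma exponents_add: "e \<in> exponents J \<Longrightarrow> e' \<in> exponents J \<Longrightarrow> e + e' \<in> exponents J"
  using Poly_Mapping.keys_add[of e e'] by (auto simp: exponents_def)

text \<open>Finite sums over a set of exponents have the shape of \<open>fspan\<close>, so relations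
  can be assembled and regrouped without building polynomial mappings.\<close>

lemma alg_independent_iff:
  assumes k: "0 \<in> k"
  shows "alg_independent k x I \<longleftrightarrow> (\<forall>M c. finite M \<and> M \<subseteq> exponents I \<and> (\<forall>e. c e \<in> k) \<and>
      (\<Sum>e\<in>M. c e * monomial_eval x e) = 0 \<longrightarrow> (\<forall>e\<in>M. c e = 0))"
    (is "_ \<longleftrightarrow> ?R")
proof
  assume ind: "alg_independent k x I"
  show ?R
  proof (intro allI impI, elim conjE)
    fix M c assume *: "finite M" "M \<subseteq> exponents I" "\<forall>e. c e \<in> k"
      "(\<Sum>e\<in>M. c e * monomial_eval x e) = 0"
    define p where "p = Abs_poly_mapping (\<lambda>e. if e \<in> M then c e else 0)"
    have lp: "Poly_Mapping.lookup p = (\<lambda>e. if e \<in> M then c e else 0)"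
      unfolding p_def by (rule lookup_Abs_poly_mapping) (rule finite_subset[OF _ *(1)], auto)
    have kp: "Poly_Mapping.keys p \<subseteq> M" by (auto simp: in_keys_iff lp split: if_splits)
    have "mpoly_eval x p = (\<Sum>e\<in>M. Poly_Mapping.lookup p e * monomial_eval x e)"
      unfolding mpoly_eval_def monomial_eval_def[symmetric]
      by (rule sum.mono_neutral_left) (use * kp in \<open>auto simp: in_keys_iff\<close>)
    also have "\<dots> = 0" using *(4) by (simp add: lp)
    finally have "p = 0"
      using ind k * kp unfolding alg_independent_def
      by (auto simp: lp exponents_def dest!: spec[of _ p] split: if_splits)
    then show "\<forall>e\<in>M. c e = 0" using lp by (metis lookup_zero)
  qed
next
  assume R: ?R
  show "alg_independent k x I"
    unfolding alg_independent_def
  proof (intro allI impI, elim conjE)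
    fix p assume *: "\<forall>m. Poly_Mapping.lookup p m \<in> k" "\<forall>m\<in>Poly_Mapping.keys p. Poly_Mapping.keys m \<subseteq> I"
      "mpoly_eval x p = 0"
    have "\<forall>e\<in>Poly_Mapping.keys p. Poly_Mapping.lookup p e = 0"
      using R[rule_format, of "Poly_Mapping.keys p" "Poly_Mapping.lookup p"] *
      unfolding mpoly_eval_def monomial_eval_def[symmetric] by (auto simp: exponents_def)
    then show "p = 0" by (auto simp: in_keys_iff intro!: poly_mapping_eqI)
  qed
qed

lemma exponents_insert_inj:
  assumes "i \<notin> J" "e \<in> exponents J" "e' \<in> exponents J"
    "e + Poly_Mapping.single i l = e' + Poly_Mapping.single i l'"
  shows "e = e' \<and> l = l'"
proof -
  have 0: "Poly_Mapping.lookup e i = 0" "Poly_Mapping.lookup e' i = 0"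
    using assms by (auto simp: exponents_def in_keys_iff)
  have "Poly_Mapping.lookup (e + Poly_Mapping.single i l) i = Poly_Mapping.lookup (e' + Poly_Mapping.single i l') i"
    using assms(4) by simp
  then have "l = l'" using 0 by (simp add: lookup_add)
  then show ?thesis using assms(4) by simp
qed

lemma exponents_insert_inj_on:
  assumes "i \<notin> J" "M \<subseteq> exponents J"
  shows "inj_on (\<lambda>(e, l). e + Poly_Mapping.single i l) (M \<times> L)"
proof (rule inj_onI, clarify)
  fix e l e' l' assume "e \<in> M" "e' \<in> M" "e + Poly_Mapping.single i l = e' + Poly_Mapping.single i l'"
  then show "e = e' \<and> l = l'" using exponents_insert_inj[OF assms(1), of e e' l l'] assms(2) by blast
qed

text \<open>Clearing denominators in an equation for \<open>x i\<close> over the field of the other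
  variables gives a polynomial relation among all of them, in which the leading coefficient of
  \<open>p\<close> survives up to the factor \<open>d\<close>.\<close>

lemma alg_independent_transcendental:
  assumes k: "subfield k amb" and ind: "alg_independent k x (insert i J)" and i: "i \<notin> J"
  shows "x i \<notin> dep_closure k (x ` J)"
proof
  assume "x i \<in> dep_closure k (x ` J)"
  then obtain p where p: "p \<noteq> 0" "\<forall>l. coeff p l \<in> adjoin k (x ` J)" "poly p (x i) = 0"
    unfolding dep_closure_def algebraic_closure_in_def algebraic_over_def by blast
  let ?R = "fspan k (monomial_eval x) (exponents J)"
  have me: "monomial_eval x e \<in> ?R" if "e \<in> exponents J" for e
    by (rule fspan_base[OF k that])
  obtain d where d: "d \<noteq> 0" "\<And>l. l \<in> {..degree p} \<Longrightarrow> coeff p l * d \<in> ?R"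
  proof (rule adjoin_common_denominator[OF k, of "monomial_eval x" "exponents J" "x ` J" "{..degree p}" "coeff p"])
    show "1 \<in> ?R" using me[of 0] by (simp add: monomial_eval_0 exponents_def)
    show "x ` J \<subseteq> ?R" using me[of "Poly_Mapping.single j 1" for j]
      by (auto simp: monomial_eval_single exponents_def)
    show "monomial_eval x e * monomial_eval x e' \<in> ?R" if "e \<in> exponents J" "e' \<in> exponents J" for e e'
      using me[OF exponents_add[OF that]] by (simp add: monomial_eval_add)
    show "coeff p l \<in> adjoin k (x ` J)" for l using p by auto
  qed auto
  obtain M c where M: "finite M" "M \<subseteq> exponents J" "\<And>l e. c l e \<in> k"
    "\<And>l. l \<in> {..degree p} \<Longrightarrow> coeff p l * d = (\<Sum>e\<in>M. c l e * monomial_eval x e)"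
    using fspan_common[OF k _ d(2), of "{..degree p}" "\<lambda>l. l"] by auto
  define \<phi> where "\<phi> = (\<lambda>(e, l :: nat). e + Poly_Mapping.single i l)"
  have inj: "inj_on \<phi> (M \<times> {..degree p})"
    unfolding \<phi>_def by (rule exponents_insert_inj_on[OF i M(2)])
  \<comment> \<open>\<open>\<phi>\<close> is injective because \<open>i \<notin> J\<close>, so
    \<open>c'\<close> carries the coefficients over to the combined exponents. Off \<open>N\<close>
    it returns some arbitrary \<open>c l e\<close>, which still lies in \<open>k\<close>.\<close>
  define N c' where "N = \<phi> ` (M \<times> {..degree p})"
    and "c' m = (let (e, l) = inv_into (M \<times> {..degree p}) \<phi> m in c l e)" for m
  have c': "c' (\<phi> (e, l)) = c l e" if "e \<in> M" "l \<le> degree p" for e l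
    using that inj by (simp add: c'_def)
  have "(\<Sum>m\<in>N. c' m * monomial_eval x m) =
      (\<Sum>el\<in>M \<times> {..degree p}. c' (\<phi> el) * monomial_eval x (\<phi> el))"
    unfolding N_def by (simp add: sum.reindex[OF inj])
  also have "\<dots> = (\<Sum>(e, l)\<in>M \<times> {..degree p}. c l e * (monomial_eval x e * x i ^ l))"
    by (rule sum.cong) (auto simp: c' \<phi>_def monomial_eval_add monomial_eval_single simp flip: c')
  also have "\<dots> = (\<Sum>l\<le>degree p. (\<Sum>e\<in>M. c l e * monomial_eval x e) * x i ^ l)"
    by (subst sum.cartesian_product[symmetric], subst sum.swap) (simp add: sum_distrib_right mult.assoc)
  also have "\<dots> = (\<Sum>l\<le>degree p. coeff p l * d * x i ^ l)"
    by (rule sum.cong) (auto simp: M(4))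
  also have "\<dots> = d * poly p (x i)" by (simp add: poly_altdef sum_distrib_left ac_simps)
  finally have "(\<Sum>m\<in>N. c' m * monomial_eval x m) = 0" using p by simp
  moreover have "finite N" using M(1) by (simp add: N_def)
  moreover have "N \<subseteq> exponents (insert i J)"
  proof -
    have "e + Poly_Mapping.single i l \<in> exponents (insert i J)" if "e \<in> M" for e l
      by (rule exponents_add) (use that M(2) in \<open>auto simp: exponents_def\<close>)
    then show ?thesis by (auto simp: N_def \<phi>_def)
  qed
  moreover have "\<forall>m. c' m \<in> k" using M(3) by (auto simp: c'_def split: prod.splits)
  ultimately have "\<forall>m\<in>N. c' m = 0"
    using ind unfolding alg_independent_iff[OF subfield_basics(1)[OF k]] by blast
  then have "c (degree p) e = 0" if "e \<in> M" for e using c'[OF that, of "degree p"] that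
    by (auto simp: N_def)
  then have "coeff p (degree p) * d = 0" using M(4)[of "degree p"] by simp
  then show False using d p(1) by simp
qed

lemma alg_independent_family:
  assumes k: "subfield k amb" and ind: "alg_independent k x I"
  shows "inj_on x I" "\<forall>a\<in>x ` I. a \<notin> dep_closure k (x ` I - {a})"
proof -
  have *: "x i \<notin> dep_closure k (x ` (I - {i}))" if "i \<in> I" for i
    using ind that by (intro alg_independent_transcendental[OF k]) (simp_all add: insert_absorb)
  show "inj_on x I"
  proof (rule inj_onI, rule ccontr)
    fix i j assume ij: "i \<in> I" "j \<in> I" "x i = x j" "i \<noteq> j"
    then have "x i \<in> x ` (I - {i})" by auto
    then show False using *[OF ij(1)] subsetD[OF dep_closure_incl] by metis
  qed
  then have "x ` (I - {i}) = x ` I - {x i}" if "i \<in> I" for i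
    using inj_on_image_set_diff[of x I I "{i}"] that by simp
  then show "\<forall>a\<in>x ` I. a \<notin> dep_closure k (x ` I - {a})" using * by simp
qed

text \<open>By induction: grouped by powers of the new element \<open>s\<close>, a relation is a
  polynomial over k(S) with root \<open>s\<close>. Its coefficients therefore vanish, and they are
  relations among the old elements.\<close>

lemma alg_independentI:
  assumes k: "subfield k amb" and S: "finite S" "\<forall>s\<in>S. s \<notin> dep_closure k (S - {s})"
  shows "alg_independent k (\<lambda>s. s) S"
  using S
proof (induction S)
  case empty
  have E: "exponents {} = {0 :: 'a \<Rightarrow>\<^sub>0 nat}" by (auto simp: exponents_def)
  show ?case
    unfolding alg_independent_iff[OF subfield_basics(1)[OF k]] E
  proof (intro allI impI, elim conjE)
    fix M :: "('a \<Rightarrow>\<^sub>0 nat) set" and c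
    assume "M \<subseteq> {0}" "(\<Sum>e\<in>M. c e * monomial_eval (\<lambda>s. s) e) = 0"
    then have "M = {} \<or> M = {0} \<and> c 0 = 0" by (auto simp: subset_singleton_iff monomial_eval_0)
    then show "\<forall>e\<in>M. c e = 0" by auto
  qed
next
  case (insert s S)
  have "t \<notin> dep_closure k (S - {t})" if "t \<in> S" for t
    using insert.prems that dep_closure_mono[of "S - {t}" "insert s S - {t}" k] by auto
  then have IH: "alg_independent k (\<lambda>s. s) S" using insert.IH by blast
  have s: "s \<notin> dep_closure k S" using insert.prems insert.hyps by auto
  show ?case
    unfolding alg_independent_iff[OF subfield_basics(1)[OF k]]
  proof (intro allI impI ballI, elim conjE)
    let ?mon = "monomial_eval (\<lambda>s. s :: 'a)"
    fix M c e0 assume M: "finite M" "M \<subseteq> exponents (insert s S)" "\<forall>e. c e \<in> k"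
      "(\<Sum>e\<in>M. c e * ?mon e) = 0" "e0 \<in> M"
    \<comment> \<open>\<open>\<psi>\<close> strips the power of \<open>s\<close> off a monomial, and
      \<open>\<phi>\<close> puts one back.\<close>
    define \<psi> where "\<psi> e = e - Poly_Mapping.single s (Poly_Mapping.lookup e s)" for e :: "'a \<Rightarrow>\<^sub>0 nat"
    define \<phi> where "\<phi> = (\<lambda>(e, l :: nat). e + Poly_Mapping.single s l)"
    have \<psi>: "\<psi> e + Poly_Mapping.single s (Poly_Mapping.lookup e s) = e" for e
      by (rule poly_mapping_eqI) (auto simp: \<psi>_def lookup_add lookup_minus lookup_single when_def)
    have \<psi>E: "\<psi> e \<in> exponents S" if "e \<in> M" for e
    proof -
      have "Poly_Mapping.keys e \<subseteq> insert s S" using M(2) that by (auto simp: exponents_def)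
      moreover have "Poly_Mapping.keys (\<psi> e) \<subseteq> Poly_Mapping.keys e - {s}"
        by (auto simp: in_keys_iff \<psi>_def lookup_minus lookup_single when_def split: if_splits)
      ultimately show ?thesis by (auto simp: exponents_def)
    qed
    define M' n where "M' = \<psi> ` M" and "n = Max ((\<lambda>e. Poly_Mapping.lookup e s) ` M)"
    have n: "Poly_Mapping.lookup e s \<le> n" if "e \<in> M" for e using M(1) that by (simp add: n_def)
    define c' where "c' l e = (if \<phi> (e, l) \<in> M then c (\<phi> (e, l)) else 0)" for l e
    have M': "finite M'" "M' \<subseteq> exponents S" using M(1) \<psi>E by (auto simp: M'_def)
    have inj: "inj_on \<phi> (M' \<times> {..n})"
      unfolding \<phi>_def by (rule exponents_insert_inj_on[OF insert.hyps(2) M'(2)])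
    have sub: "M \<subseteq> \<phi> ` (M' \<times> {..n})"
    proof
      fix e assume e: "e \<in> M"
      have "e = \<phi> (\<psi> e, Poly_Mapping.lookup e s)" using \<psi> by (simp add: \<phi>_def)
      then show "e \<in> \<phi> ` (M' \<times> {..n})" using n[OF e] e by (force simp: M'_def)
    qed
    have "0 = (\<Sum>e\<in>M. c e * ?mon e)" using M(4) by simp
    also have "\<dots> = (\<Sum>e\<in>\<phi> ` (M' \<times> {..n}). (if e \<in> M then c e else 0) * ?mon e)"
      by (rule sum.mono_neutral_cong_left) (use sub M'(1) in auto)
    also have "\<dots> = (\<Sum>el\<in>M' \<times> {..n}. c' (snd el) (fst el) * ?mon (\<phi> el))"
      unfolding sum.reindex[OF inj] by (rule sum.cong) (auto simp: c'_def)
    also have "\<dots> = (\<Sum>(e, l)\<in>M' \<times> {..n}. c' l e * ?mon e * s ^ l)"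
      by (rule sum.cong) (auto simp: \<phi>_def monomial_eval_add monomial_eval_single)
    also have "\<dots> = (\<Sum>l\<le>n. (\<Sum>e\<in>M'. c' l e * ?mon e) * s ^ l)"
      by (subst sum.cartesian_product[symmetric], subst sum.swap) (simp add: sum_distrib_right)
    also have "\<dots> = poly (\<Sum>l\<le>n. monom (\<Sum>e\<in>M'. c' l e * ?mon e) l) s"
      by (simp add: poly_sum poly_monom)
    finally have root: "poly (\<Sum>l\<le>n. monom (\<Sum>e\<in>M'. c' l e * ?mon e) l) s = 0" ..
    have c'k: "c' l e \<in> k" for l e using M(3) subfield_basics(1)[OF k] by (simp add: c'_def)
    have monS: "?mon e \<in> adjoin k S" if "e \<in> M'" for e
      unfolding monomial_eval_def using M'(2) that
      by (intro subfield_prod[OF subfield_adjoin] subfield_power[OF subfield_adjoin] adjoin_incl)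
        (auto simp: exponents_def)
    have cf: "coeff (\<Sum>l\<le>n. monom (\<Sum>e\<in>M'. c' l e * ?mon e) l) l =
        (if l \<le> n then \<Sum>e\<in>M'. c' l e * ?mon e else 0)" for l
      by (simp add: coeff_sum if_distrib cong: if_cong)
    have "coeff (\<Sum>l\<le>n. monom (\<Sum>e\<in>M'. c' l e * ?mon e) l) l \<in> adjoin k S" for l
    proof -
      have "(\<Sum>e\<in>M'. c' l e * ?mon e) \<in> adjoin k S"
        using c'k monS
        by (intro subfield_sum[OF subfield_adjoin] subfield_basics(4)[OF subfield_adjoin])
          (auto intro: adjoin_base)
      then show ?thesis unfolding cf by (simp add: subfield_basics(1)[OF subfield_adjoin])
    qed
    then have "(\<Sum>l\<le>n. monom (\<Sum>e\<in>M'. c' l e * ?mon e) l) = 0"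
      using s root unfolding dep_closure_def algebraic_closure_in_def algebraic_over_def by blast
    then have "(\<Sum>e\<in>M'. c' l e * ?mon e) = 0" if "l \<le> n" for l using cf[of l] that by simp
    then have zero: "c' l e = 0" if "l \<le> n" "e \<in> M'" for l e
      using IH M' c'k that unfolding alg_independent_iff[OF subfield_basics(1)[OF k]] by blast
    have "c' (Poly_Mapping.lookup e0 s) (\<psi> e0) = c e0"
      using \<psi>[of e0] M(5) by (simp add: c'_def \<phi>_def)
    then show "c e0 = 0" using zero[OF n[OF M(5)], of "\<psi> e0"] M(5) by (simp add: M'_def)
  qed
qed

section \<open>Prime cyclotomic fields\<close>

text \<open>Exactly one of the two constant coefficients is divisible by \<open>q\<close>. In that
  factor \<open>u\<close> the first coefficient prime to \<open>q\<close> occurs at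
  \<open>degree u\<close> at the latest, hence below \<open>degree E\<close>, and makes the
  coefficient of \<open>E\<close> at this place prime to \<open>q\<close> as well.\<close>

lemma eisenstein:
  fixes E g h :: "int poly"
  assumes q: "prime q" and E: "E = g * h" "lead_coeff E = 1"
    and dvd: "\<And>i. i < degree E \<Longrightarrow> q dvd coeff E i" and sq: "\<not> q * q dvd coeff E 0"
  shows "degree g = 0 \<or> degree h = 0"
proof (rule ccontr)
  assume "\<not> ?thesis"
  then have pos: "degree g > 0" "degree h > 0" by auto
  have *: False if "u * v = E" "q dvd coeff u 0" "degree v > 0" for u v :: "int poly"
  proof -
    have "u \<noteq> 0" "v \<noteq> 0" using that(1) E(2) by auto
    then have uv: "degree E = degree u + degree v" using that(1) by (simp add: degree_mult_eq[symmetric])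
    have "coeff E 0 = coeff u 0 * coeff v 0" by (simp add: that(1)[symmetric] coeff_mult)
    then have v0: "\<not> q dvd coeff v 0" using sq that(2) mult_dvd_mono by metis
    have "lead_coeff u * lead_coeff v = 1" using that(1) E(2) by (metis lead_coeff_mult)
    then have "\<not> q dvd lead_coeff u" using q by (metis dvd_mult2 not_prime_unit)
    then have ex: "\<exists>i. \<not> q dvd coeff u i" by auto
    define i where "i = (LEAST i. \<not> q dvd coeff u i)"
    have i: "\<not> q dvd coeff u i" using LeastI_ex[OF ex] by (simp add: i_def)
    have less: "q dvd coeff u j" if "j < i" for j using not_less_Least[of j "\<lambda>i. \<not> q dvd coeff u i"] that by (auto simp: i_def)
    have "i \<le> degree u" using i by (metis coeff_eq_0 dvd_0_right not_le)
    then have "q dvd coeff E i" using dvd[of i] uv that(3) by simp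
    also have "coeff E i = (\<Sum>j\<le>i. coeff u j * coeff v (i - j))" by (simp add: that(1)[symmetric] coeff_mult)
    also have "\<dots> = (\<Sum>j<i. coeff u j * coeff v (i - j)) + coeff u i * coeff v 0"
      by (simp add: lessThan_Suc_atMost[symmetric])
    finally have "q dvd coeff u i * coeff v 0"
      using less by (subst (asm) dvd_add_right_iff) (auto intro!: dvd_sum)
    then show False using i v0 q prime_dvd_mult_iff by blast
  qed
  have "coeff E 0 = coeff g 0 * coeff h 0" by (simp add: E coeff_mult)
  moreover have "degree E > 0" using pos by (cases "g = 0 \<or> h = 0") (auto simp: E degree_mult_eq)
  then have "q dvd coeff E 0" by (rule dvd)
  ultimately have "q dvd coeff g 0 \<or> q dvd coeff h 0" using q prime_dvd_mult_iff by metis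
  then show False using *[of g h] *[of h g] E(1) pos by (auto simp: mult.commute)
qed

text \<open>Pseudo-division of \<open>E\<close> by a primitive polynomial of least degree vanishing at \<open>r\<close> leaves no
  remainder, so that polynomial divides \<open>E\<close> over the integers by Gauss.\<close>

lemma eisenstein_root_degree:
  fixes E g :: "int poly" and r :: complex
  assumes q: "prime q" and E: "lead_coeff E = 1" "degree E > 0"
    and dvd: "\<And>i. i < degree E \<Longrightarrow> q dvd coeff E i" and sq: "\<not> q * q dvd coeff E 0"
    and r: "poly (of_int_poly E) r = 0"
    and g: "g \<noteq> 0" "poly (of_int_poly g) r = 0"
  shows "degree E \<le> degree g"
proof -
  define P where "P n \<longleftrightarrow> (\<exists>g :: int poly. g \<noteq> 0 \<and> poly (of_int_poly g) r = 0 \<and> degree g = n)" for n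
  have "P (degree g)" using g by (auto simp: P_def)
  define n where "n = (LEAST n. P n)"
  have "P n" using \<open>P (degree g)\<close> unfolding n_def by (rule LeastI)
  then obtain g0 :: "int poly" where g0: "g0 \<noteq> 0" "poly (of_int_poly g0) r = 0" "degree g0 = n"
    by (auto simp: P_def)
  define f where "f = primitive_part g0"
  have g0f: "g0 = smult (content g0) f" by (simp add: f_def)
  have f: "f \<noteq> 0" "degree f = n" "content f = 1" using g0 by (auto simp: f_def)
  have "of_int (content g0) * poly (of_int_poly f) r = 0"
    using g0(2) by (subst (asm) g0f) (simp add: hom_distribs)
  then have fr: "poly (of_int_poly f) r = 0" using g0(1) by simp
  obtain h s where hs: "pseudo_divmod E f = (h, s)" by force
  define c where "c = lead_coeff f ^ (Suc (degree E) - degree f)"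
  have div: "smult c E = f * h + s" "s = 0 \<or> degree s < degree f"
    using pseudo_divmod[OF f(1) hs] by (auto simp: c_def)
  have c: "c \<noteq> 0" using f(1) by (simp add: c_def)
  have "poly (of_int_poly (smult c E)) r = 0" using r by (simp add: hom_distribs)
  then have "poly (of_int_poly s) r = 0" using fr by (simp add: div(1) hom_distribs)
  have "s = 0"
  proof (rule ccontr)
    assume "s \<noteq> 0"
    then have "P (degree s)" using \<open>poly (of_int_poly s) r = 0\<close> by (auto simp: P_def)
    then have "n \<le> degree s" unfolding n_def by (rule Least_le)
    then show False using \<open>s \<noteq> 0\<close> div(2) f(2) by simp
  qed
  then have cE: "smult c E = f * h" using div by simp
  have "content E dvd 1" using E(1) content_dvd_coeff[of E "degree E"] by simp
  then have "content E = 1" by (simp only: is_unit_content_iff)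
  then have "content h = normalize c" using arg_cong[OF cE, of content] f(3) by (simp add: content_mult)
  then have "[:c:] dvd h" by (simp add: const_poly_dvd_iff_dvd_content)
  then obtain h' where h': "h = smult c h'" by (auto simp: dvd_def)
  have "smult c E = smult c (f * h')" using cE h' by simp
  then have Efh: "E = f * h'" using c by (metis smult_cancel)
  then have "h' \<noteq> 0" using E by auto
  have "degree f = 0 \<or> degree h' = 0" by (rule eisenstein[OF q Efh E(1) dvd sq])
  moreover have "degree f \<noteq> 0"
  proof
    assume "degree f = 0"
    then obtain d where "f = [:d:]" by (rule degree_eq_zeroE)
    then show False using fr f by simp
  qed
  ultimately have "degree E = n" using Efh \<open>h' \<noteq> 0\<close> f by (simp add: degree_mult_eq)
  moreover have "n \<le> degree g" using \<open>P (degree g)\<close> unfolding n_def by (rule Least_le)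
  ultimately show ?thesis by simp
qed

section \<open>Roots of unity and independence of the powers of zeta_q\<close>

lemma power_mod_exponent: "(z :: 'a::monoid_mult) ^ n = 1 \<Longrightarrow> z ^ j = z ^ (j mod n)"
  by (subst mod_mult_div_eq[of j n, symmetric], subst power_add) (simp add: power_mult)

lemma cong_power_mod_exponent:
  fixes t :: "'a::unique_euclidean_semiring"
  assumes "[t ^ q = 1] (mod m)"
  shows "[t ^ n = t ^ (n mod q)] (mod m)"
proof -
  have "[(t ^ q) ^ (n div q) * t ^ (n mod q) = 1 ^ (n div q) * t ^ (n mod q)] (mod m)"
    using assms by (intro cong_mult cong_pow) auto
  then show ?thesis by (simp add: power_mult[symmetric] power_add[symmetric])
qed

lemma primitive_root_power_eq_1_iff:
  assumes "primitive_root_of_unity n (z :: 'a::field)"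
  shows "z ^ j = 1 \<longleftrightarrow> n dvd j"
proof -
  have n: "n > 0" "z ^ n = 1" "\<And>j. 0 < j \<Longrightarrow> j < n \<Longrightarrow> z ^ j \<noteq> 1"
    using assms by (auto simp: primitive_root_of_unity_def)
  have "z ^ j = z ^ (j mod n)" by (rule power_mod_exponent[OF n(2)])
  moreover have "z ^ (j mod n) \<noteq> 1" if "j mod n \<noteq> 0" using n that by simp
  ultimately show ?thesis by (cases "j mod n = 0") (auto simp: dvd_eq_mod_eq_0)
qed

text \<open>Orthogonality of the characters of Z/n: for \<open>z ^ j \<noteq> 1\<close> the product
  of \<open>1 - z ^ j\<close> with the geometric sum is 0.\<close>

lemma sum_roots_of_unity:
  assumes "primitive_root_of_unity n z"
  shows "(\<Sum>i<n. z ^ (i * j)) = (if n dvd j then of_nat n else 0)"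
proof (cases "n dvd j")
  case True
  then obtain k where "j = n * k" by (auto simp: dvd_def)
  then have "z ^ (i * j) = (z ^ n) ^ (i * k)" for i by (simp add: power_mult[symmetric] ac_simps)
  then have "z ^ (i * j) = 1" for i using assms by (simp add: primitive_root_of_unity_def)
  then show ?thesis using True by simp
next
  case False
  then have "z ^ j \<noteq> 1" using primitive_root_power_eq_1_iff[OF assms] by simp
  moreover have "(1 - z ^ j) * (\<Sum>i<n. (z ^ j) ^ i) = 1 - (z ^ j) ^ n" by (rule one_diff_power_eq[symmetric])
  moreover have "(z ^ j) ^ n = 1"
    using primitive_root_power_eq_1_iff[OF assms, of "j * n"] by (simp add: power_mult)
  ultimately have "(\<Sum>i<n. (z ^ j) ^ i) = 0" by simp
  then show ?thesis using False by (simp add: power_mult[symmetric] mult.commute)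
qed

text \<open>\<open>E\<close> is ((1 + X)^q - 1) / X, the cyclotomic polynomial shifted by 1: it is
  Eisenstein at \<open>q\<close> and has the root \<open>z - 1\<close>. A nonzero \<open>f\<close>,
  shifted likewise, would have this root and too small a degree.\<close>

lemma prime_root_of_unity_independent_int:
  fixes z :: complex and f :: "int poly"
  assumes q: "prime q" and z: "primitive_root_of_unity q z"
    and f: "degree f < q - 1" "poly (of_int_poly f) z = 0"
  shows "f = 0"
proof (rule ccontr)
  assume "f \<noteq> 0"
  define E :: "int poly" where "E = (\<Sum>k<q. monom (int (q choose Suc k)) k)"
  have q1: "q > 1" using q prime_gt_1_nat by blast
  have cE: "coeff E i = (if i < q then int (q choose Suc i) else 0)" for i
    by (simp add: E_def coeff_sum if_distrib cong: if_cong)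
  have dE: "degree E = q - 1"
  proof (rule antisym)
    show "degree E \<le> q - 1" by (rule degree_le) (auto simp: cE)
    show "q - 1 \<le> degree E" by (rule le_degree) (use q1 in \<open>auto simp: cE\<close>)
  qed
  define r where "r = z - 1"
  have "r \<noteq> 0" using z q1 by (auto simp: r_def primitive_root_of_unity_def dest: spec[of _ 1])
  have "z ^ q = (\<Sum>k\<le>q. of_nat (q choose k) * r ^ k)"
    using binomial_ring[of r 1 q] by (simp add: r_def)
  also have "\<dots> = 1 + (\<Sum>k<q. of_nat (q choose Suc k) * r ^ Suc k)"
    by (simp add: sum.atMost_shift)
  also have "\<dots> = 1 + r * poly (of_int_poly E) r"
    by (simp add: E_def hom_distribs poly_sum poly_monom sum_distrib_left ac_simps)
  finally have root: "poly (of_int_poly E) r = 0"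
    using z \<open>r \<noteq> 0\<close> by (simp add: primitive_root_of_unity_def)
  have "degree E \<le> degree (f \<circ>\<^sub>p [:1, 1:])"
  proof (rule eisenstein_root_degree[OF _ _ _ _ _ root])
    show "prime (int q)" using q by simp
    show "lead_coeff E = 1" "degree E > 0" using q1 by (auto simp: dE cE)
    show "int q dvd coeff E i" if "i < degree E" for i
      using that q by (auto simp: dE cE int_dvd_int_iff intro!: dvd_choose_prime)
    show "\<not> int q * int q dvd coeff E 0"
      using q1 by (auto simp: cE dest: zdvd_imp_le)
    show "f \<circ>\<^sub>p [:1, 1:] \<noteq> 0" using \<open>f \<noteq> 0\<close> by (simp add: pcompose_eq_0_iff)
    show "poly (of_int_poly (f \<circ>\<^sub>p [:1, 1:])) r = 0"
      using f(2) by (simp add: of_int_hom.map_poly_pcompose poly_pcompose r_def)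
  qed
  then show False using f(1) by (simp add: dE)
qed

text \<open>The product \<open>D\<close> of the denominators makes the coefficients
  integral.\<close>

lemma prime_root_of_unity_independent:
  fixes z :: complex and c :: "nat \<Rightarrow> complex"
  assumes q: "prime q" and z: "primitive_root_of_unity q z"
    and c: "\<And>i. i < q - 1 \<Longrightarrow> c i \<in> \<rat>" and 0: "(\<Sum>i<q - 1. c i * z ^ i) = 0" and i: "i < q - 1"
  shows "c i = 0"
proof -
  have "\<exists>n d. d \<noteq> 0 \<and> (i < q - 1 \<longrightarrow> c i = of_int n / of_int d)" for i
    using c[of i] Rats_cases'[of "c i"] by (metis less_irrefl one_neq_zero)
  then obtain n d where nd: "\<And>i. d i \<noteq> (0 :: int)" "\<And>i. i < q - 1 \<Longrightarrow> c i = of_int (n i) / of_int (d i)"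
    by metis
  define D where "D = (\<Prod>i<q - 1. d i)"
  define e where "e i = n i * (\<Prod>j\<in>{..<q - 1} - {i}. d j)" for i
  have D0: "D \<noteq> 0" using nd(1) by (simp add: D_def)
  have e: "of_int (e i) = of_int D * c i" if "i < q - 1" for i
  proof -
    have "D = d i * (\<Prod>j\<in>{..<q - 1} - {i}. d j)" unfolding D_def using that by (intro prod.remove) auto
    then show ?thesis using nd that by (simp add: e_def)
  qed
  define f where "f = (\<Sum>i<q - 1. monom (e i) i)"
  have cf: "coeff f i = (if i < q - 1 then e i else 0)" for i
    by (simp add: f_def coeff_sum if_distrib cong: if_cong)
  have "f = 0"
  proof (rule prime_root_of_unity_independent_int[OF q z])
    have "degree f \<le> q - 2" by (rule degree_le) (auto simp: cf)
    then show "degree f < q - 1" using i by simp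
    have "poly (of_int_poly f) z = (\<Sum>i<q - 1. of_int (e i) * z ^ i)"
      by (simp add: f_def hom_distribs poly_sum poly_monom)
    also have "\<dots> = (\<Sum>i<q - 1. of_int D * (c i * z ^ i))"
      by (rule sum.cong) (auto simp: e)
    also have "\<dots> = 0" using 0 by (simp add: sum_distrib_left[symmetric])
    finally show "poly (of_int_poly f) z = 0" .
  qed
  then have "e i = 0" using cf[of i] i by simp
  then show ?thesis using e[OF i] D0 by simp
qed

section \<open>Norms and sublattices of the integer lattice\<close>

lemma combine_amb:
  "length ks = length us \<Longrightarrow> ring.combine amb ks us = (\<Sum>i<length us. ks ! i * us ! i)"
proof (induction ks us rule: list_induct2)
  case Nil
  show ?case by (simp add: ring.combine.simps[OF amb_ring])
next
  case (Cons k ks u us)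
  then show ?case
    by (simp add: ring.combine.simps[OF amb_ring] sum.lessThan_Suc_shift del: sum.lessThan_Suc)
qed

lemma field_basis_iff:
  assumes K: "subfield K amb"
  shows "field_basis K L bs \<longleftrightarrow>
    (\<forall>c. (\<forall>i<length bs. c i \<in> K) \<and> (\<Sum>i<length bs. c i * bs ! i) = 0 \<longrightarrow> (\<forall>i<length bs. c i = 0)) \<and>
    L = {\<Sum>i<length bs. c i * bs ! i | c. \<forall>i<length bs. c i \<in> K}"
    (is "_ \<longleftrightarrow> ?ind \<and> _ = ?S")
proof -
  have "ring.Span amb K bs = {ring.combine amb ks bs | ks. length ks = length bs \<and> set ks \<subseteq> K}"
    by (rule ring.Span_eq_combine_set_length_version[OF amb_ring K]) simp
  also have "\<dots> = ?S"
  proof (intro Set.equalityI subsetI)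
    fix s assume "s \<in> {ring.combine amb ks bs | ks. length ks = length bs \<and> set ks \<subseteq> K}"
    then obtain ks where "s = ring.combine amb ks bs" "length ks = length bs" "set ks \<subseteq> K" by auto
    then show "s \<in> ?S" by (auto simp: combine_amb intro!: exI[of _ "\<lambda>i. ks ! i"])
  next
    fix s assume "s \<in> ?S"
    then obtain c where "s = (\<Sum>i<length bs. c i * bs ! i)" "\<forall>i<length bs. c i \<in> K" by auto
    then show "s \<in> {ring.combine amb ks bs | ks. length ks = length bs \<and> set ks \<subseteq> K}"
      by (auto simp: combine_amb intro!: exI[of _ "map c [0..<length bs]"])
  qed
  finally have span: "ring.Span amb K bs = ?S" .
  have "ring.independent amb K bs \<longleftrightarrow> ?ind"
  proof
    assume ind: "ring.independent amb K bs"
    show ?ind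
    proof (intro allI impI, elim conjE)
      fix c i assume c: "\<forall>i<length bs. c i \<in> K" "(\<Sum>i<length bs. c i * bs ! i) = 0" and i: "i < length bs"
      have "set (take (length bs) (map c [0..<length bs])) \<subseteq> {\<zero>\<^bsub>amb\<^esub>}"
        by (rule ring.independent_imp_trivial_combine[OF amb_ring K ind])
          (use c in \<open>auto simp: combine_amb\<close>)
      then show "c i = 0" using i by (force simp: image_subset_iff)
    qed
  next
    assume ind: ?ind
    show "ring.independent amb K bs"
    proof (rule ring.trivial_combine_imp_independent[OF amb_ring K])
      fix ks assume ks: "set ks \<subseteq> K" "ring.combine amb ks bs = \<zero>\<^bsub>amb\<^esub>"
      \<comment> \<open>A sum formed by \<open>combine\<close> ends with the shorter list, so a
        coefficient list of arbitrary length is first cut, or padded with zeros, to the length of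
        \<open>bs\<close>.\<close>
      define js where "js = take (length bs) (ks @ replicate (length bs) 0)"
      have js: "length js = length bs" by (simp add: js_def)
      have sub: "set js \<subseteq> K" using ks(1) subfield_basics(1)[OF K]
        by (auto simp: js_def dest!: in_set_takeD)
      have "ring.combine amb js bs = 0"
      proof -
        have "ring.combine amb (take (length bs) (as @ replicate (length bs) 0)) bs = ring.combine amb as bs" for as :: "'a list"
        proof (induction bs arbitrary: as)
          case Nil
          then show ?case by (simp add: ring.combine.simps[OF amb_ring])
        next
          case (Cons b bs)
          have z: "ring.combine amb (replicate (length bs) 0) bs = 0" for bs :: "'a list"
            by (simp add: combine_amb)
          show ?case
          proof (cases as)
            case Nil
            then show ?thesis using z[of bs] by (simp add: ring.combine.simps[OF amb_ring])
          next
            case (Cons a as')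
            have *: "take (length bs) (as' @ 0 # replicate (length bs) 0) = take (length bs) (as' @ replicate (length bs) 0)"
              by (simp add: min_def flip: replicate_Suc del: replicate_Suc)
            then have "take (length (b # bs)) ((a # as') @ replicate (length (b # bs)) 0) =
                a # take (length bs) (as' @ replicate (length bs) 0)" by simp
            then show ?thesis by (simp only: Cons ring.combine.simps[OF amb_ring] Cons.IH)
          qed
        qed
        then show ?thesis using ks(2) by (simp add: js_def)
      qed
      moreover have "\<forall>i<length bs. js ! i \<in> K" using js by (auto intro!: subsetD[OF sub])
      ultimately have js0: "js ! i = 0" if "i < length bs" for i
        using ind[rule_format, of "\<lambda>i. js ! i" i] that js by (simp add: combine_amb)
      then have "ks ! i = 0" if "i < length bs" "i < length ks" for i
        using js0[OF that(1)] that by (simp add: js_def nth_append)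
      then show "set (take (length bs) ks) \<subseteq> {\<zero>\<^bsub>amb\<^esub>}"
        by (auto simp: in_set_conv_nth)
    qed simp
  qed
  then show ?thesis unfolding field_basis_def span by auto
qed

lemma elements_mat_mem:
  "A \<in> carrier_mat n m \<Longrightarrow> elements_mat A \<subseteq> K \<Longrightarrow> i < n \<Longrightarrow> j < m \<Longrightarrow> A $$ (i, j) \<in> K"
  by (force simp: elements_mat_def)

lemma field_basis_length:
  assumes "subfield K amb" "field_basis K L bs" "field_basis K L cs"
  shows "length bs = length cs"
  using ring.dimension_is_inj[OF amb_ring assms(1), of "length bs" L "length cs"]
    ring.dimension_independent[OF amb_ring, of K bs] ring.dimension_independent[OF amb_ring, of K cs] assms(2,3)
  unfolding field_basis_def by auto

text \<open>The definite description in \<open>field_norm\<close> picks out a value because the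
  multiplication matrices in two bases are conjugate: \<open>A * P = P * C\<close> with an
  invertible base change \<open>P\<close>.\<close>

lemma field_norm_eq_det:
  fixes \<alpha> :: "'a::field"
  assumes K: "subfield K amb" and bs: "field_basis K L bs"
    and A: "A \<in> carrier_mat (length bs) (length bs)" "elements_mat A \<subseteq> K"
      "\<And>j. j < length bs \<Longrightarrow> \<alpha> * bs ! j = (\<Sum>i<length bs. A $$ (i, j) * bs ! i)"
  shows "field_norm K L \<alpha> = det A"
  unfolding field_norm_def
proof (rule the_equality)
  show "\<exists>bs B. field_basis K L bs \<and> B \<in> carrier_mat (length bs) (length bs) \<and> elements_mat B \<subseteq> K \<and>
      (\<forall>j<length bs. \<alpha> * bs ! j = (\<Sum>i<length bs. B $$ (i, j) * bs ! i)) \<and> det A = det B"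
    by (intro exI[of _ bs] exI[of _ A] conjI allI impI bs A HOL.refl)
next
  fix d
  assume "\<exists>bs A. field_basis K L bs \<and> A \<in> carrier_mat (length bs) (length bs) \<and> elements_mat A \<subseteq> K \<and>
      (\<forall>j<length bs. \<alpha> * bs ! j = (\<Sum>i<length bs. A $$ (i, j) * bs ! i)) \<and> d = det A"
  then obtain cs C where cs: "field_basis K L cs" and C: "C \<in> carrier_mat (length cs) (length cs)"
    "elements_mat C \<subseteq> K" "\<And>j. j < length cs \<Longrightarrow> \<alpha> * cs ! j = (\<Sum>i<length cs. C $$ (i, j) * cs ! i)"
    "d = det C" by blast
  define n where "n = length bs"
  have n: "length bs = n" "length cs = n"
    using field_basis_length[OF K bs cs] by (auto simp: n_def)
  note A = A[unfolded n] and C = C[unfolded n]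
  have bs_ind: "M = N" if MN: "M \<in> carrier_mat n n" "N \<in> carrier_mat n n" "elements_mat M \<subseteq> K" "elements_mat N \<subseteq> K"
    "\<And>j. j < n \<Longrightarrow> (\<Sum>i<n. M $$ (i, j) * bs ! i) = (\<Sum>i<n. N $$ (i, j) * bs ! i)" for M N
  proof (rule eq_matI)
    fix i j assume "i < dim_row N" "j < dim_col N"
    then have ij: "i < n" "j < n" using MN by auto
    have "(\<Sum>i<n. (M $$ (i, j) - N $$ (i, j)) * bs ! i) = 0"
      using MN(5)[OF ij(2)] by (simp add: left_diff_distrib sum_subtractf)
    moreover have "M $$ (i, j) - N $$ (i, j) \<in> K" if "i < n" for i
      by (intro subfield_diff[OF K] elements_mat_mem[OF MN(1,3)] elements_mat_mem[OF MN(2,4)] that ij)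
    ultimately have "M $$ (i, j) - N $$ (i, j) = 0"
      using bs[unfolded field_basis_iff[OF K] n, THEN conjunct1, rule_format, of "\<lambda>i. M $$ (i, j) - N $$ (i, j)" i] ij(1)
      by simp
    then show "M $$ (i, j) = N $$ (i, j)" by simp
  qed (use MN in auto)
  have expand: "\<exists>P. P \<in> carrier_mat n n \<and> elements_mat P \<subseteq> K \<and> (\<forall>j<n. us ! j = (\<Sum>i<n. P $$ (i, j) * vs ! i))"
    if us: "field_basis K L us" "length us = n" and vs: "field_basis K L vs" "length vs = n" for us vs
  proof -
    have "us ! j \<in> L" if "j < n" for j
    proof -
      have "us ! j = (\<Sum>i<n. (if i = j then 1 else 0) * us ! i)"
        using that by (simp add: if_distrib[of "\<lambda>x. x * _"] cong: if_cong)
      moreover have "\<forall>i<n. (if i = j then 1 else 0) \<in> K" using subfield_basics(1,2)[OF K] by simp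
      ultimately show ?thesis
        unfolding us(1)[unfolded field_basis_iff[OF K] us(2), THEN conjunct2] mem_Collect_eq
        by (intro exI[of _ "\<lambda>i. if i = j then 1 else 0"] conjI)
    qed
    then have "\<exists>c. j < n \<longrightarrow> (\<forall>i<n. c i \<in> K) \<and> us ! j = (\<Sum>i<n. c i * vs ! i)" for j
      unfolding vs(1)[unfolded field_basis_iff[OF K] vs(2), THEN conjunct2] mem_Collect_eq by metis
    then obtain c where "\<And>j. j < n \<Longrightarrow> (\<forall>i<n. c j i \<in> K) \<and> us ! j = (\<Sum>i<n. c j i * vs ! i)" by metis
    then show ?thesis
      by (intro exI[of _ "mat n n (\<lambda>(i, j). c j i)"]) (auto simp: elements_mat_def)
  qed
  obtain P where P: "P \<in> carrier_mat n n" "elements_mat P \<subseteq> K" "\<And>j. j < n \<Longrightarrow> cs ! j = (\<Sum>i<n. P $$ (i, j) * bs ! i)"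
    using expand[OF cs n(2) bs n(1)] by blast
  obtain Q where Q: "Q \<in> carrier_mat n n" "elements_mat Q \<subseteq> K" "\<And>j. j < n \<Longrightarrow> bs ! j = (\<Sum>i<n. Q $$ (i, j) * cs ! i)"
    using expand[OF bs n(1) cs n(2)] by blast
  have mult: "(M * N) $$ (i, j) = (\<Sum>l<n. M $$ (i, l) * N $$ (l, j))"
    if "M \<in> carrier_mat n n" "N \<in> carrier_mat n n" "i < n" "j < n" for M N :: "'a mat" and i j
    using that by (simp add: times_mat_def scalar_prod_def atLeast0LessThan)
  have el: "elements_mat (M * N) \<subseteq> K"
    if MN: "M \<in> carrier_mat n n" "N \<in> carrier_mat n n" "elements_mat M \<subseteq> K" "elements_mat N \<subseteq> K" for M N
  proof -
    have "(M * N) $$ (i, j) \<in> K" if ij: "i < n" "j < n" for i j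
      unfolding mult[OF MN(1,2) ij]
      by (intro subfield_sum[OF K] subfield_basics(4)[OF K] elements_mat_mem[OF MN(1,3)]
          elements_mat_mem[OF MN(2,4)] ij) (use ij in auto)
    then show ?thesis using MN(1,2) by (auto simp: elements_mat_def)
  qed
  have lin: "(\<Sum>i<n. N $$ (i, j) * (\<Sum>l<n. M $$ (l, i) * bs ! l)) = (\<Sum>l<n. (M * N) $$ (l, j) * bs ! l)"
    if MN: "M \<in> carrier_mat n n" "N \<in> carrier_mat n n" "j < n" for M N j
  proof -
    have "(\<Sum>i<n. N $$ (i, j) * (\<Sum>l<n. M $$ (l, i) * bs ! l)) =
        (\<Sum>l<n. (\<Sum>i<n. M $$ (l, i) * N $$ (i, j)) * bs ! l)"
      unfolding sum_distrib_left sum_distrib_right by (subst sum.swap) (simp add: ac_simps)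
    also have "\<dots> = (\<Sum>l<n. (M * N) $$ (l, j) * bs ! l)"
      by (intro sum.cong) (use MN in \<open>simp_all add: mult del: index_mult_mat\<close>)
    finally show ?thesis .
  qed
  have "P * Q = 1\<^sub>m n"
  proof (rule bs_ind)
    show "elements_mat (1\<^sub>m n :: 'a mat) \<subseteq> K" using subfield_basics(1,2)[OF K] by (auto simp: elements_mat_def)
    fix j assume j: "j < n"
    have "(\<Sum>i<n. (P * Q) $$ (i, j) * bs ! i) = bs ! j"
      using lin[OF P(1) Q(1) j] Q(3)[OF j] P(3) by simp
    also have "\<dots> = (\<Sum>i<n. 1\<^sub>m n $$ (i, j) * bs ! i)"
      using j by (simp add: if_distrib[of "\<lambda>x. x * _"] cong: if_cong)
    finally show "(\<Sum>i<n. (P * Q) $$ (i, j) * bs ! i) = (\<Sum>i<n. 1\<^sub>m n $$ (i, j) * bs ! i)" .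
  qed (use P Q el in auto)
  then have PQ: "det P * det Q = 1" using det_mult[OF P(1) Q(1)] by simp
  have "A * P = P * C"
  proof (rule bs_ind)
    fix j assume j: "j < n"
    have "(\<Sum>i<n. (A * P) $$ (i, j) * bs ! i) = (\<Sum>i<n. P $$ (i, j) * (\<alpha> * bs ! i))"
      using lin[OF A(1) P(1) j] A(3) by simp
    also have "\<dots> = \<alpha> * cs ! j" using P(3)[OF j] by (simp add: sum_distrib_left ac_simps)
    also have "\<dots> = (\<Sum>i<n. (P * C) $$ (i, j) * bs ! i)"
      using lin[OF P(1) C(1) j] C(3)[OF j] P(3) by simp
    finally show "(\<Sum>i<n. (A * P) $$ (i, j) * bs ! i) = (\<Sum>i<n. (P * C) $$ (i, j) * bs ! i)" .
  qed (use A P C el in auto)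
  then have "det A * det P = det P * det C" using det_mult[OF A(1) P(1)] det_mult[OF P(1) C(1)] by metis
  moreover have "det P \<noteq> 0" using PQ by auto
  ultimately show "d = det A" using C(4) by (metis mult.commute mult_cancel_left)
qed

text \<open>The vectors whose value at \<open>t\<close> is divisible by \<open>M\<close> form a
  lattice of index \<open>M\<close>. The columns of \<open>A\<close> lie in it and span a sublattice
  of Z^n of the same index, hence the whole lattice.\<close>

lemma lattice_of_congruence:
  fixes A :: "int mat" and t M :: int
  assumes A: "A \<in> carrier_mat n n" and det: "det A = M \<or> det A = - M" and M: "M > 0" and n: "n > 0"
    and col: "\<And>j. j < n \<Longrightarrow> M dvd (\<Sum>i<n. A $$ (i, j) * t ^ i)"
    and e: "M dvd (\<Sum>i<n. e i * t ^ i)"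
  shows "\<exists>u. \<forall>i<n. e i = (\<Sum>j<n. A $$ (i, j) * u j)"
proof -
  define S where "S v = (\<Sum>i<n. v i * t ^ i)" for v :: "nat \<Rightarrow> int"
  \<comment> \<open>The unimodular \<open>T\<close> replaces coordinate 0 of a vector by its value
    at \<open>t\<close>. On the lattice this value is divisible by \<open>M\<close>, and dividing it
    out gives \<open>T * A = D * B\<close> with \<open>B\<close> integral and \<open>D\<close> the
    diagonal matrix with entries M, 1, ..., 1.\<close>
  define B where "B = mat n n (\<lambda>(i, j). if i = 0 then S (\<lambda>i. A $$ (i, j)) div M else A $$ (i, j))"
  define T where "T = mat n n (\<lambda>(i, j). if i = 0 then t ^ j else if i = j then 1 else 0 :: int)"
  define D where "D = mat n n (\<lambda>(i, j). if i = j then if i = 0 then M else 1 else 0)"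
  have car: "B \<in> carrier_mat n n" "T \<in> carrier_mat n n" "D \<in> carrier_mat n n"
    by (auto simp: B_def T_def D_def)
  have "T * A = D * B"
  proof (rule eq_matI)
    fix i j assume "i < dim_row (D * B)" "j < dim_col (D * B)"
    then have ij: "i < n" "j < n" using car by auto
    have "(T * A) $$ (i, j) = (\<Sum>l<n. T $$ (i, l) * A $$ (l, j))"
      using ij car A by (simp add: times_mat_def scalar_prod_def atLeast0LessThan)
    also have "\<dots> = (if i = 0 then S (\<lambda>i. A $$ (i, j)) else A $$ (i, j))"
    proof (cases "i = 0")
      case True
      then show ?thesis using ij by (simp add: T_def S_def mult.commute)
    next
      case False
      then show ?thesis using ij by (simp add: T_def if_distrib[of "\<lambda>x. x * _"] cong: if_cong)
    qed
    also have "\<dots> = (if i = 0 then M else 1) * B $$ (i, j)"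
      using ij col[OF ij(2)] by (auto simp: B_def S_def)
    also have "\<dots> = (\<Sum>l<n. D $$ (i, l) * B $$ (l, j))"
      using ij by (simp add: D_def if_distrib[of "\<lambda>x. x * _"] cong: if_cong)
    also have "\<dots> = (D * B) $$ (i, j)"
      using ij car by (simp add: times_mat_def scalar_prod_def atLeast0LessThan)
    finally show "(T * A) $$ (i, j) = (D * B) $$ (i, j)" .
  qed (use A car in auto)
  moreover have "det T = 1"
    by (subst det_upper_triangular[OF _ car(2)])
      (auto simp: T_def prod_list_diag_prod intro!: prod.neutral)
  moreover have "det D = M"
  proof -
    have "det D = (\<Prod>i<n. if i = 0 then M else 1)"
      by (subst det_upper_triangular[OF _ car(3)])
        (auto simp: D_def prod_list_diag_prod atLeast0LessThan intro!: prod.cong)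
    then show ?thesis using n by simp
  qed
  ultimately have "det A = M * det B" using det_mult[OF car(2) A] det_mult[OF car(3,1)] by simp
  then have "M * det B = M * 1 \<or> M * det B = M * (- 1)" using det by auto
  then have detB: "det B = 1 \<or> det B = - 1" using M by (metis mult_cancel_left order_less_irrefl)
  \<comment> \<open>\<open>e'\<close> is \<open>e\<close> in the new coordinates. Since
    \<open>det B\<close> is its own inverse, \<open>det B\<close> times the adjugate inverts
    \<open>B\<close> over the integers.\<close>
  define e' where "e' i = (if i = 0 then S e div M else e i)" for i
  define u where "u j = (\<Sum>l<n. det B * adj_mat B $$ (j, l) * e' l)" for j
  have Bu: "(\<Sum>j<n. B $$ (i, j) * u j) = e' i" if i: "i < n" for i
  proof -
    have "(\<Sum>j<n. B $$ (i, j) * u j) = det B * (\<Sum>l<n. (\<Sum>j<n. B $$ (i, j) * adj_mat B $$ (j, l)) * e' l)"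
      unfolding u_def sum_distrib_left sum_distrib_right by (subst sum.swap) (simp add: ac_simps)
    also have "\<dots> = det B * (\<Sum>l<n. (B * adj_mat B) $$ (i, l) * e' l)"
      using i car(1) adj_mat(1)[OF car(1)] by (simp add: times_mat_def scalar_prod_def atLeast0LessThan)
    also have "\<dots> = det B * (det B * e' i)"
      unfolding adj_mat(2)[OF car(1)] using i by (simp add: if_distrib[of "\<lambda>x. _ * x * _"] cong: if_cong)
    finally show ?thesis using detB by auto
  qed
  have rest: "(\<Sum>j<n. A $$ (i, j) * u j) = e i" if "i < n" "i \<noteq> 0" for i
    using Bu[OF that(1)] that by (simp add: B_def e'_def)
  have "S (\<lambda>i. \<Sum>j<n. A $$ (i, j) * u j) = (\<Sum>j<n. S (\<lambda>i. A $$ (i, j)) * u j)"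
    unfolding S_def sum_distrib_right by (subst sum.swap) (simp add: ac_simps)
  also have "\<dots> = (\<Sum>j<n. M * B $$ (0, j) * u j)"
    using n col by (intro sum.cong) (auto simp: B_def S_def)
  also have "\<dots> = M * e' 0" using Bu[OF n] by (simp add: sum_distrib_left[symmetric] mult.assoc)
  also have "\<dots> = S e" using e by (simp add: e'_def S_def)
  finally have *: "S (\<lambda>i. \<Sum>j<n. A $$ (i, j) * u j) = S e" .
  have split: "S v = v 0 + (\<Sum>i\<in>{..<n} - {0}. v i * t ^ i)" for v
    unfolding S_def using n by (subst sum.remove[of _ 0]) auto
  have "(\<Sum>j<n. A $$ (0, j) * u j) = e 0"
    using *[unfolded split] rest by simp
  then have "\<forall>i<n. e i = (\<Sum>j<n. A $$ (i, j) * u j)" using rest by metis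
  then show ?thesis by blast
qed

section \<open>Exponent vectors as elements of Z[zeta_q]\<close>

lemma power_int_sum: "x \<noteq> 0 \<Longrightarrow> (x :: 'a::field) powi (sum f A) = (\<Prod>i\<in>A. x powi f i)"
  by (induction A rule: infinite_finite_induct) (auto simp: power_int_add)

lemma power_int_prod: "(prod f A :: 'a::field) powi n = (\<Prod>i\<in>A. f i powi n)"
  by (induction A rule: infinite_finite_induct) (auto simp: power_int_mult_distrib)

text \<open>The coordinates of \<open>\<zeta>\<^sub>q ^ n\<close> in the basis \<open>1, \<dots>, \<zeta>\<^sub>q ^ (q - 2)\<close>.\<close>

definition cyclotomic_coord :: "nat \<Rightarrow> nat \<Rightarrow> nat \<Rightarrow> int" where
  "cyclotomic_coord q n i = (if n mod q = q - 1 then - 1 else if i = n mod q then 1 else 0)"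

text \<open>With product 1 over a period, \<open>g (q - 1)\<close> is the inverse of the product of
  the others, just as zeta^(q-1) is minus the sum of the lower powers. Multiplicatively the
  \<open>g i\<close> thus obey the relation of the powers of zeta.\<close>

lemma cyclotomic_coord_prod:
  fixes g :: "nat \<Rightarrow> 'a::field"
  assumes q: "q > 1" and g: "(\<Prod>i<q. g i) = 1"
  shows "(\<Prod>i<q - 1. g i powi cyclotomic_coord q n i) = g (n mod q)"
proof (cases "n mod q = q - 1")
  case True
  have "(\<Prod>i<q. g i) = (\<Prod>i<q - 1. g i) * g (q - 1)"
    using q prod.lessThan_Suc[of g "q - 1"] by simp
  then have "inverse (\<Prod>i<q - 1. g i) = g (q - 1)" using g by (metis inverse_unique)
  moreover have "(\<Prod>i<q - 1. g i powi (- 1)) = inverse (\<Prod>i<q - 1. g i)"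
    using power_int_prod[of g "{..<q - 1}" "- 1"] by (simp add: power_int_minus)
  ultimately show ?thesis using True by (simp add: cyclotomic_coord_def)
next
  case False
  have "n mod q < q - 1" using False q mod_less_divisor[of q n] by linarith
  moreover have "g i powi cyclotomic_coord q n i = (if i = n mod q then g (n mod q) else 1)" for i
    using False by (simp add: cyclotomic_coord_def)
  ultimately show ?thesis by simp
qed

text \<open>The error is kept as a multiple of the geometric sum because two evaluations are needed:
  at zeta that sum is 0, at the integer \<open>t\<close> it is divisible by
  \<open>m'\<close>.\<close>

lemma cyclotomic_coord_sum:
  fixes t :: "'a::comm_ring_1"
  assumes q: "q > 1"
  shows "\<exists>c. (\<Sum>i<q - 1. of_int (cyclotomic_coord q n i) * t ^ i) = t ^ (n mod q) + c * (\<Sum>i<q. t ^ i)"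
proof (cases "n mod q = q - 1")
  case True
  have "(\<Sum>i<q. t ^ i) = (\<Sum>i<q - 1. t ^ i) + t ^ (q - 1)"
    using q sum.lessThan_Suc[of "\<lambda>i. t ^ i" "q - 1"] by simp
  then show ?thesis using True
    by (intro exI[of _ "- 1"]) (simp add: cyclotomic_coord_def sum_negf)
next
  case False
  have "n mod q < q - 1" using False q mod_less_divisor[of q n] by linarith
  moreover have "of_int (cyclotomic_coord q n i) * t ^ i = (if i = n mod q then t ^ (n mod q) else 0)" for i
    using False by (simp add: cyclotomic_coord_def)
  ultimately show ?thesis by (intro exI[of _ 0]) simp
qed

lemma cyclotomic_coord_root:
  assumes q: "q > 1" and z: "primitive_root_of_unity q (z :: 'a::field)"
  shows "(\<Sum>i<q - 1. of_int (cyclotomic_coord q n i) * z ^ i) = z ^ n"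
proof -
  have "\<not> q dvd 1" using q by simp
  then have "(\<Sum>i<q. z ^ i) = 0" using sum_roots_of_unity[OF z, of 1] by simp
  moreover have "z ^ n = z ^ (n mod q)"
    using z by (intro power_mod_exponent) (simp add: primitive_root_of_unity_def)
  ultimately show ?thesis using cyclotomic_coord_sum[OF q, of n z] by auto
qed

lemma field_basis_prime_root_of_unity:
  assumes q: "prime q" and z: "primitive_root_of_unity q (z :: complex)"
  shows "field_basis \<rat> (adjoin \<rat> {z}) (map (\<lambda>i. z ^ i) [0..<q - 1])"
proof -
  have q1: "q > 1" using q prime_gt_1_nat by blast
  have Q: "subfield \<rat> (amb :: complex ring)" by (rule subfieldI_type) auto
  define E :: "complex poly" where "E = (\<Sum>i<q. monom 1 i)"
  have cE: "coeff E i = (if i < q then 1 else 0)" for i by (simp add: E_def coeff_sum)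
  have dE: "degree E = q - 1"
  proof (rule antisym)
    show "degree E \<le> q - 1" by (rule degree_le) (auto simp: cE)
    show "q - 1 \<le> degree E" by (rule le_degree) (use q1 in \<open>auto simp: cE\<close>)
  qed
  have E0: "E \<noteq> 0" using dE q1 by auto
  have "poly E z = (\<Sum>i<q. z ^ (i * 1))" by (simp add: E_def poly_sum poly_monom)
  also have "\<dots> = 0" using sum_roots_of_unity[OF z, of 1] q1 by simp
  finally have Ez: "poly E z = 0" .
  have "\<forall>i. coeff E i \<in> \<rat>" by (simp add: cE)
  from finite_algebra_powers[OF Q E0 this Ez]
  have fa: "finite_algebra \<rat> (fspan \<rat> (\<lambda>j. z ^ j) {..<q - 1})" "z \<in> fspan \<rat> (\<lambda>j. z ^ j) {..<q - 1}"
    by (simp_all add: dE)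
  have "adjoin \<rat> {z} \<subseteq> fspan \<rat> (\<lambda>j. z ^ j) {..<q - 1}"
    using fa by (intro adjoin_least finite_algebra_subfield[OF Q] finite_algebra_base[OF Q]) auto
  moreover have "fspan \<rat> (\<lambda>j. z ^ j) {..<q - 1} \<subseteq> {\<Sum>i<q - 1. c i * z ^ i | c. \<forall>i<q - 1. c i \<in> \<rat>}"
  proof
    fix r assume r: "r \<in> fspan \<rat> (\<lambda>j. z ^ j) {..<q - 1}"
    obtain c where "\<forall>e. c e \<in> \<rat>" "r = (\<Sum>i<q - 1. c i * z ^ i)" by (rule fspan_finite[OF Q _ r]) simp
    then show "r \<in> {\<Sum>i<q - 1. c i * z ^ i | c. \<forall>i<q - 1. c i \<in> \<rat>}" by blast
  qed
  moreover have "{\<Sum>i<q - 1. c i * z ^ i | c. \<forall>i<q - 1. c i \<in> \<rat>} \<subseteq> adjoin \<rat> {z}"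
  proof clarify
    fix c :: "nat \<Rightarrow> complex" assume "\<forall>i<q - 1. c i \<in> \<rat>"
    then show "(\<Sum>i<q - 1. c i * z ^ i) \<in> adjoin \<rat> {z}"
      by (intro subfield_sum[OF subfield_adjoin] subfield_basics(4)[OF subfield_adjoin]
          subfield_power[OF subfield_adjoin]) (auto intro: adjoin_base adjoin_incl)
  qed
  ultimately have "adjoin \<rat> {z} = {\<Sum>i<q - 1. c i * z ^ i | c. \<forall>i<q - 1. c i \<in> \<rat>}" by blast
  then show ?thesis
    unfolding field_basis_iff[OF Q] using prime_root_of_unity_independent[OF q z] by simp
qed

text \<open>\<open>A\<close> is the matrix of multiplication by alpha on Z[zeta_q], so its
  determinant is the norm, plus or minus \<open>m'\<close>. Column \<open>j\<close> is the exponent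
  vector of the \<open>j\<close>-th product on the right; its value at \<open>t\<close> is b m' t^j
  modulo \<open>m'\<close>, hence 0. So \<open>lattice_of_congruence\<close> writes \<open>e\<close>
  as an integer combination of the columns.\<close>

lemma invariant_monomials:
  fixes g :: "nat \<Rightarrow> 'a::field" and a e :: "nat \<Rightarrow> int" and \<zeta> :: complex
  assumes q: "prime q" and m': "m' > 0" and geo: "m' dvd (\<Sum>i<q. t ^ i)"
    and b: "b * m' = (\<Sum>i\<le>q - 2. a i * t ^ i)"
    and \<zeta>: "primitive_root_of_unity q \<zeta>"
    and norm: "field_norm \<rat> (adjoin \<rat> {\<zeta>}) (\<Sum>i\<le>q - 2. of_int (a i) * \<zeta> ^ i)
           \<in> {of_int m', - of_int m'}"
    and g: "\<And>i. g i \<noteq> 0" "(\<Prod>i<q. g i) = 1"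
    and e: "m' dvd (\<Sum>i<q - 1. e i * t ^ i)"
  shows "\<exists>u. (\<Prod>i<q - 1. g i powi e i) =
    (\<Prod>j<q - 1. (\<Prod>l\<le>q - 2. g ((l + j) mod q) powi a l) powi u j)"
proof -
  have q1: "q > 1" using q prime_gt_1_nat by blast
  have Q: "subfield \<rat> (amb :: complex ring)" by (rule subfieldI_type) auto
  define A where "A = mat (q - 1) (q - 1) (\<lambda>(i, j). \<Sum>l\<le>q - 2. a l * cyclotomic_coord q (l + j) i)"
  have A: "A \<in> carrier_mat (q - 1) (q - 1)" by (simp add: A_def)
  have "field_norm \<rat> (adjoin \<rat> {\<zeta>}) (\<Sum>i\<le>q - 2. of_int (a i) * \<zeta> ^ i) = det (map_mat of_int A)"
  proof (rule field_norm_eq_det[OF Q field_basis_prime_root_of_unity[OF q \<zeta>]])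
    show "map_mat of_int A \<in> carrier_mat (length (map (\<lambda>i. \<zeta> ^ i) [0..<q - 1])) (length (map (\<lambda>i. \<zeta> ^ i) [0..<q - 1]))"
      using A by simp
    show "elements_mat (map_mat of_int A) \<subseteq> (\<rat> :: complex set)" by (auto simp: elements_mat_def)
    fix j assume "j < length (map (\<lambda>i. \<zeta> ^ i) [0..<q - 1])"
    then have j: "j < q - 1" by simp
    have "(\<Sum>i<q - 1. of_int (A $$ (i, j)) * \<zeta> ^ i) =
        (\<Sum>i<q - 1. \<Sum>l\<le>q - 2. of_int (a l) * (of_int (cyclotomic_coord q (l + j) i) * \<zeta> ^ i))"
      using j by (simp add: A_def sum_distrib_right mult.assoc)
    also have "\<dots> = (\<Sum>l\<le>q - 2. of_int (a l) * (\<Sum>i<q - 1. of_int (cyclotomic_coord q (l + j) i) * \<zeta> ^ i))"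
      unfolding sum_distrib_left by (rule sum.swap)
    also have "\<dots> = (\<Sum>i\<le>q - 2. of_int (a i) * \<zeta> ^ i) * \<zeta> ^ j"
      unfolding cyclotomic_coord_root[OF q1 \<zeta>] by (simp add: sum_distrib_right power_add mult.assoc)
    finally show "(\<Sum>i\<le>q - 2. of_int (a i) * \<zeta> ^ i) * map (\<lambda>i. \<zeta> ^ i) [0..<q - 1] ! j =
        (\<Sum>i<length (map (\<lambda>i. \<zeta> ^ i) [0..<q - 1]). map_mat of_int A $$ (i, j) * map (\<lambda>i. \<zeta> ^ i) [0..<q - 1] ! i)"
      using j A by simp
  qed
  also have "\<dots> = of_int (det A)" by simp
  finally have "of_int (det A) \<in> {of_int m', - of_int m' :: complex}" using norm by simp
  then have "(of_int (det A) :: complex) = of_int m' \<or> (of_int (det A) :: complex) = of_int (- m')" by auto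
  then have det: "det A = m' \<or> det A = - m'" by (simp only: of_int_eq_iff)
  have col: "m' dvd (\<Sum>i<q - 1. A $$ (i, j) * t ^ i)" if j: "j < q - 1" for j
  proof -
    have "t ^ q - 1 = (t - 1) * (\<Sum>i<q. t ^ i)" by (rule power_diff_1_eq)
    then have "[t ^ q = 1] (mod m')" using geo by (simp add: cong_iff_dvd_diff)
    note tq = cong_power_mod_exponent[OF this]
    have cc: "[(\<Sum>i<q - 1. cyclotomic_coord q n i * t ^ i) = t ^ n] (mod m')" for n
    proof -
      obtain c where "(\<Sum>i<q - 1. cyclotomic_coord q n i * t ^ i) = t ^ (n mod q) + c * (\<Sum>i<q. t ^ i)"
        using cyclotomic_coord_sum[OF q1, of n t] by auto
      then have "[(\<Sum>i<q - 1. cyclotomic_coord q n i * t ^ i) = t ^ (n mod q)] (mod m')"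
        using geo by (simp add: cong_iff_dvd_diff)
      then show ?thesis using tq[of n] cong_sym cong_trans by blast
    qed
    have "(\<Sum>i<q - 1. A $$ (i, j) * t ^ i) =
        (\<Sum>i<q - 1. \<Sum>l\<le>q - 2. a l * (cyclotomic_coord q (l + j) i * t ^ i))"
      using j by (simp add: A_def sum_distrib_right mult.assoc)
    also have "\<dots> = (\<Sum>l\<le>q - 2. a l * (\<Sum>i<q - 1. cyclotomic_coord q (l + j) i * t ^ i))"
      unfolding sum_distrib_left by (rule sum.swap)
    finally have "(\<Sum>i<q - 1. A $$ (i, j) * t ^ i) =
      (\<Sum>l\<le>q - 2. a l * (\<Sum>i<q - 1. cyclotomic_coord q (l + j) i * t ^ i))" .
    moreover have "[\<dots> = (\<Sum>l\<le>q - 2. a l * t ^ (l + j))] (mod m')"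
      by (intro cong_sum cong_mult cc) auto
    moreover have "(\<Sum>l\<le>q - 2. a l * t ^ (l + j)) = b * m' * t ^ j"
      unfolding b by (simp add: sum_distrib_right power_add mult.assoc)
    ultimately show ?thesis by (metis cong_dvd_iff dvd_mult2 dvd_triv_right)
  qed
  obtain u where u: "\<And>i. i < q - 1 \<Longrightarrow> e i = (\<Sum>j<q - 1. A $$ (i, j) * u j)"
    using lattice_of_congruence[OF A det m' _ col e] q1 by auto
  have z: "(\<Prod>i<q - 1. g i powi A $$ (i, j)) = (\<Prod>l\<le>q - 2. g ((l + j) mod q) powi a l)" if j: "j < q - 1" for j
  proof -
    have "(\<Prod>i<q - 1. g i powi A $$ (i, j)) =
        (\<Prod>i<q - 1. \<Prod>l\<le>q - 2. (g i powi cyclotomic_coord q (l + j) i) powi a l)"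
      using j g(1) by (intro prod.cong) (auto simp: A_def power_int_sum power_int_mult[symmetric] mult.commute)
    also have "\<dots> = (\<Prod>l\<le>q - 2. (\<Prod>i<q - 1. g i powi cyclotomic_coord q (l + j) i) powi a l)"
      unfolding power_int_prod by (rule prod.swap)
    finally show ?thesis unfolding cyclotomic_coord_prod[OF q1 g(2)] .
  qed
  have "(\<Prod>i<q - 1. g i powi e i) = (\<Prod>i<q - 1. \<Prod>j<q - 1. (g i powi A $$ (i, j)) powi u j)"
    using g(1) by (intro prod.cong) (auto simp: u power_int_sum power_int_mult)
  also have "\<dots> = (\<Prod>j<q - 1. (\<Prod>i<q - 1. g i powi A $$ (i, j)) powi u j)"
    unfolding power_int_prod by (rule prod.swap)
  finally show ?thesis using z by auto
qed

section \<open>The presented group\<close>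

text \<open>Left multiplication of the letters on the pairs \<open>(i, j)\<close> standing for \<open>\<tau>\<^sup>i \<sigma>\<^sup>j\<close>. This model of the
  presentation shows that the \<open>m q\<close> elements \<open>\<tau>\<^sup>i \<sigma>\<^sup>j\<close> are distinct.\<close>

definition model_letter :: "nat \<Rightarrow> nat \<Rightarrow> int \<Rightarrow> gens \<times> bool \<Rightarrow> nat \<times> int \<Rightarrow> nat \<times> int" where
  "model_letter m q t l p = (case l of
      (sigma, s) \<Rightarrow> (fst p, (snd p + (if s then 1 else - 1) * t ^ fst p) mod int m)
    | (tau, s) \<Rightarrow> ((fst p + (if s then 1 else q - 1)) mod q, snd p))"

definition model_word :: "nat \<Rightarrow> nat \<Rightarrow> int \<Rightarrow> gens word \<Rightarrow> nat \<times> int \<Rightarrow> nat \<times> int" where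
  "model_word m q t w p = foldr (model_letter m q t) w p"

lemma model_word_simps [simp]:
  "model_word m q t [] p = p"
  "model_word m q t (l # w) p = model_letter m q t l (model_word m q t w p)"
  "model_word m q t (v @ w) p = model_word m q t v (model_word m q t w p)"
  by (simp_all add: model_word_def)

context
  fixes m q :: nat and t :: int
  assumes m: "m > 0" and q: "q > 0" and tq: "[t ^ q = 1] (mod int m)"
begin

abbreviation "model_dom \<equiv> {..<q} \<times> {0..<int m}"

lemma model_letter_dom: "p \<in> model_dom \<Longrightarrow> model_letter m q t l p \<in> model_dom"
  using m q by (auto simp: model_letter_def split: prod.splits gens.splits)

lemma model_word_dom: "p \<in> model_dom \<Longrightarrow> model_word m q t w p \<in> model_dom"
  by (induction w) (simp_all add: model_letter_dom del: mem_Times_iff)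

lemma model_word_sigma:
  assumes "p \<in> model_dom"
  shows "model_word m q t (replicate n (sigma, s)) p =
    (fst p, (snd p + (if s then 1 else - 1) * int n * t ^ fst p) mod int m)"
proof (induction n)
  case 0
  show ?case using assms by (auto simp: prod_eq_iff)
next
  case (Suc n)
  then show ?case by (simp add: model_letter_def mod_simps algebra_simps)
qed

lemma model_word_tau:
  assumes "p \<in> model_dom"
  shows "model_word m q t (replicate n (tau, True)) p = ((fst p + n) mod q, snd p)"
proof (induction n)
  case 0
  show ?case using assms by (auto simp: prod_eq_iff)
next
  case (Suc n)
  then show ?case by (simp add: model_letter_def mod_simps)
qed

lemma model_letter_cancel:
  assumes "p \<in> model_dom"
  shows "model_letter m q t (y, s) (model_letter m q t (y, \<not> s) p) = p"
proof (cases y)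
  case sigma
  then show ?thesis using assms by (auto simp: model_letter_def mod_simps)
next
  case tau
  have "(i + (q - 1) + 1) mod q = i" "(i + 1 + (q - 1)) mod q = i" if "i < q" for i
    using that q by auto
  then show ?thesis using tau assms by (auto simp: model_letter_def mod_simps)
qed

definition G_mq_relations :: "(gens word \<times> gens word) set" where
  "G_mq_relations = {(gen_pow sigma (int m), []), (gen_pow tau (int q), []),
      (gen_pow tau (-1) @ gen_pow sigma 1 @ gen_pow tau 1, gen_pow sigma t)}"

lemma G_mq_eq: "G_mq m q t = presented_group G_mq_relations"
  by (simp add: G_mq_def G_mq_relations_def)

lemma G_mq_relations_mem:
  "(gen_pow sigma (int m), []) \<in> G_mq_relations" "(gen_pow tau (int q), []) \<in> G_mq_relations"
  "(gen_pow tau (-1) @ gen_pow sigma 1 @ gen_pow tau 1, gen_pow sigma t) \<in> G_mq_relations"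
  by (simp_all add: G_mq_relations_def)

lemma model_relation:
  assumes "(l, r) \<in> G_mq_relations" and p: "p \<in> model_dom"
  shows "model_word m q t l p = model_word m q t r p"
proof -
  obtain i j where ij: "p = (i, j)" "i < q" "0 \<le> j" "j < int m" using p by auto
  consider "l = gen_pow sigma (int m)" "r = []" | "l = gen_pow tau (int q)" "r = []" |
    "l = gen_pow tau (-1) @ gen_pow sigma 1 @ gen_pow tau 1" "r = gen_pow sigma t"
    using assms(1) by (auto simp: G_mq_relations_def)
  then show ?thesis
  proof cases
    case 1
    then show ?thesis using ij model_word_sigma[OF p, of m True] by (simp add: gen_pow_def)
  next
    case 2
    then show ?thesis using ij model_word_tau[OF p, of q] by (simp add: gen_pow_def)
  next
    case 3
    have bk: "((i + 1) mod q + (q - 1)) mod q = i" 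
    proof (cases "i + 1 < q")
      case False
      then have "i + 1 = q" using ij(2) by simp
      then show ?thesis using q by auto
    qed simp
    \<comment> \<open>At \<open>i = q - 1\<close> the first coordinate wraps round to 0, and
      \<open>t ^ 0\<close> has to agree with \<open>t ^ q\<close>: here the congruence for
      \<open>t ^ q\<close> enters.\<close>
    have "[t ^ ((i + 1) mod q) = t ^ (i + 1)] (mod int m)" 
      by (rule cong_sym[OF cong_power_mod_exponent[OF tq]])
    then have "(j + t ^ ((i + 1) mod q)) mod int m = (j + t * t ^ i) mod int m"
      by (metis cong_add_lcancel cong_def power_add power_one_right mult.commute)
    moreover have "(if t \<ge> 0 then 1 else - 1) * int (nat \<bar>t\<bar>) = t" by simp
    ultimately show ?thesis
      using 3 bk model_word_sigma[OF p, of "nat \<bar>t\<bar>" "t \<ge> 0"] ij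
      by (simp add: gen_pow_def model_letter_def mult.assoc[symmetric] del: int_nat_eq)
  qed
qed

lemma model_pres_eq: "pres_eq G_mq_relations v w \<Longrightarrow> p \<in> model_dom \<Longrightarrow> model_word m q t v p = model_word m q t w p"
proof (induction arbitrary: p rule: pres_eq.induct)
  case (cancel u y s v)
  then show ?case using model_letter_cancel[OF model_word_dom[OF cancel.prems]] by simp
next
  case (relation l r u v)
  then show ?case using model_relation[OF relation.hyps model_word_dom[OF relation.prems]] by simp
qed auto

section \<open>Normal form of the group elements\<close>

definition G_sigma :: "gens word set" where "G_sigma = word_class G_mq_relations [(sigma, True)]"
definition G_tau :: "gens word set" where "G_tau = word_class G_mq_relations [(tau, True)]"
definition G_elem :: "nat \<Rightarrow> nat \<Rightarrow> gens word set" where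
  "G_elem i j = word_class G_mq_relations (replicate i (tau, True) @ replicate j (sigma, True))"

text \<open>Applied to the base point (0, 0) of the model, the word for tau^i sigma^j ends at (i,
  j), and equal classes act equally.\<close>

lemma G_elem_inj:
  assumes "G_elem i j = G_elem i' j'" "i < q" "j < m" "i' < q" "j' < m"
  shows "i = i' \<and> j = j'"
proof -
  have 0: "(0, 0) \<in> model_dom" using m q by auto
  have *: "model_word m q t (replicate i (tau, True) @ replicate j (sigma, True)) (0, 0) = (i, int j)"
    if "i < q" "j < m" for i j
    using that model_word_sigma[OF 0, of j True] model_word_tau[of "(0, int j)" i] by simp
  have "(i, int j) = (i', int j')"
    using model_pres_eq[OF assms(1)[unfolded G_elem_def word_class_eq_iff] 0] * assms(2-) by simp
  then show ?thesis by simp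
qed

interpretation G: group "G_mq m q t"
  unfolding G_mq_eq by (rule group_presented_group)

lemma G_class_mult: "word_class G_mq_relations v \<otimes>\<^bsub>G_mq m q t\<^esub> word_class G_mq_relations w = word_class G_mq_relations (v @ w)"
  unfolding G_mq_eq by (rule word_class_mult)

lemma G_class_carrier: "word_class G_mq_relations v \<in> carrier (G_mq m q t)"
  by (auto simp: G_mq_eq presented_group_def)

lemma G_class_one: "\<one>\<^bsub>G_mq m q t\<^esub> = word_class G_mq_relations []"
  by (simp add: G_mq_eq presented_group_def)

lemma G_class_relation: "(l, r) \<in> G_mq_relations \<Longrightarrow> word_class G_mq_relations l = word_class G_mq_relations r"
  unfolding word_class_eq_iff using pres_eq.relation[of l r G_mq_relations "[]" "[]"] by simp

lemma G_gens_carrier [simp]: "G_sigma \<in> carrier (G_mq m q t)" "G_tau \<in> carrier (G_mq m q t)"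
  by (simp_all add: G_sigma_def G_tau_def G_class_carrier)

lemma G_class_replicate:
  "word_class G_mq_relations (replicate n l) = word_class G_mq_relations [l] [^]\<^bsub>G_mq m q t\<^esub> n"
proof (induction n)
  case 0
  show ?case by (simp add: G_class_one)
next
  case (Suc n)
  then show ?case by (simp add: replicate_append_same[symmetric] G_class_mult[symmetric])
qed

lemma G_class_inverse: "word_class G_mq_relations [(y, False)] = inv\<^bsub>G_mq m q t\<^esub> word_class G_mq_relations [(y, True)]"
proof (rule G.inv_equality[symmetric])
  have "pres_eq G_mq_relations [(y, False), (y, True)] []"
    using pres_eq.cancel[of G_mq_relations "[]" y False "[]"] by simp
  then show "word_class G_mq_relations [(y, False)] \<otimes>\<^bsub>G_mq m q t\<^esub> word_class G_mq_relations [(y, True)] = \<one>\<^bsub>G_mq m q t\<^esub>"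
    by (simp add: G_class_mult G_class_one word_class_eq_iff)
qed (auto simp: G_class_carrier)

lemma G_class_gen_pow: "word_class G_mq_relations (gen_pow y n) = word_class G_mq_relations [(y, True)] [^]\<^bsub>G_mq m q t\<^esub> n"
proof (cases n)
  case (nonneg k)
  then show ?thesis by (simp add: gen_pow_def G_class_replicate int_pow_int)
next
  case (neg k)
  have "word_class G_mq_relations (gen_pow y n) = word_class G_mq_relations [(y, False)] [^]\<^bsub>G_mq m q t\<^esub> Suc k"
    unfolding neg G_class_replicate[symmetric] by (simp add: gen_pow_def nat_add_distrib)
  also have "\<dots> = inv\<^bsub>G_mq m q t\<^esub> (word_class G_mq_relations [(y, True)] [^]\<^bsub>G_mq m q t\<^esub> Suc k)"
    unfolding G_class_inverse by (rule G.nat_pow_inv[OF G_class_carrier])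
  also have "\<dots> = word_class G_mq_relations [(y, True)] [^]\<^bsub>G_mq m q t\<^esub> n"
    unfolding neg by (rule G.int_pow_neg_int[OF G_class_carrier, symmetric])
  finally show ?thesis .
qed

lemma G_elem_eq: "G_elem i j = G_tau [^]\<^bsub>G_mq m q t\<^esub> i \<otimes>\<^bsub>G_mq m q t\<^esub> G_sigma [^]\<^bsub>G_mq m q t\<^esub> j"
  by (simp add: G_elem_def G_tau_def G_sigma_def G_class_mult[symmetric] G_class_replicate)

lemma G_sigma_order: "G_sigma [^]\<^bsub>G_mq m q t\<^esub> m = \<one>\<^bsub>G_mq m q t\<^esub>"
  using G_class_relation[OF G_mq_relations_mem(1)]
  by (simp add: G_class_gen_pow G_class_one G_sigma_def int_pow_int)

lemma G_tau_order: "G_tau [^]\<^bsub>G_mq m q t\<^esub> q = \<one>\<^bsub>G_mq m q t\<^esub>"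
  using G_class_relation[OF G_mq_relations_mem(2)]
  by (simp add: G_class_gen_pow G_class_one G_tau_def int_pow_int)

text \<open>A nonnegative residue keeps the exponents of \<open>G_sigma\<close> natural numbers,
  matching the index \<open>j\<close> of \<open>G_elem i j\<close>.\<close>

definition "t_nat = nat (t mod int m)"

lemma t_nat: "[int t_nat = t] (mod int m)"
  using m by (simp add: t_nat_def cong_def)

lemma G_sigma_pow_mod: "G_sigma [^]\<^bsub>G_mq m q t\<^esub> n = G_sigma [^]\<^bsub>G_mq m q t\<^esub> (n mod m)"
proof -
  have "G_sigma [^]\<^bsub>G_mq m q t\<^esub> (m * (n div m) + n mod m) = G_sigma [^]\<^bsub>G_mq m q t\<^esub> (n mod m)"
    by (simp only: G.nat_pow_mult[symmetric] G.nat_pow_pow[symmetric] G_gens_carrier G_sigma_order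
        G.nat_pow_one G.l_one G.nat_pow_closed)
  then show ?thesis by simp
qed

lemma G_tau_pow_mod: "G_tau [^]\<^bsub>G_mq m q t\<^esub> n = G_tau [^]\<^bsub>G_mq m q t\<^esub> (n mod q)"
proof -
  have "G_tau [^]\<^bsub>G_mq m q t\<^esub> (q * (n div q) + n mod q) = G_tau [^]\<^bsub>G_mq m q t\<^esub> (n mod q)"
    by (simp only: G.nat_pow_mult[symmetric] G.nat_pow_pow[symmetric] G_gens_carrier G_tau_order
        G.nat_pow_one G.l_one G.nat_pow_closed)
  then show ?thesis by simp
qed

lemma G_sigma_int_pow: "G_sigma [^]\<^bsub>G_mq m q t\<^esub> t = G_sigma [^]\<^bsub>G_mq m q t\<^esub> t_nat"
proof -
  obtain c where c: "t = int t_nat + int m * c"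
    using t_nat by (metis cong_iff_lin cong_sym)
  have "G_sigma [^]\<^bsub>G_mq m q t\<^esub> (int m * c) = (G_sigma [^]\<^bsub>G_mq m q t\<^esub> int m) [^]\<^bsub>G_mq m q t\<^esub> c"
    by (simp add: G.int_pow_pow)
  then have "G_sigma [^]\<^bsub>G_mq m q t\<^esub> (int m * c) = \<one>\<^bsub>G_mq m q t\<^esub>" by (simp add: int_pow_int G_sigma_order)
  then have "G_sigma [^]\<^bsub>G_mq m q t\<^esub> (int t_nat + int m * c) = G_sigma [^]\<^bsub>G_mq m q t\<^esub> t_nat"
    by (simp add: G.int_pow_mult int_pow_int)
  then show ?thesis using c by simp
qed

lemma G_commute: "G_sigma \<otimes>\<^bsub>G_mq m q t\<^esub> G_tau = G_tau \<otimes>\<^bsub>G_mq m q t\<^esub> G_sigma [^]\<^bsub>G_mq m q t\<^esub> t_nat"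
proof -
  have "inv\<^bsub>G_mq m q t\<^esub> G_tau \<otimes>\<^bsub>G_mq m q t\<^esub> (G_sigma \<otimes>\<^bsub>G_mq m q t\<^esub> G_tau) = G_sigma [^]\<^bsub>G_mq m q t\<^esub> t_nat"
    using G_class_relation[OF G_mq_relations_mem(3)]
    by (simp add: G_class_mult[symmetric] G_class_gen_pow G_sigma_def[symmetric] G_tau_def[symmetric]
        G.int_pow_neg G_sigma_int_pow)
  then show ?thesis by (metis G.inv_solve_left G.nat_pow_closed G.m_closed G_gens_carrier)
qed

lemma G_commute_pow: "G_sigma [^]\<^bsub>G_mq m q t\<^esub> n \<otimes>\<^bsub>G_mq m q t\<^esub> G_tau = G_tau \<otimes>\<^bsub>G_mq m q t\<^esub> G_sigma [^]\<^bsub>G_mq m q t\<^esub> (t_nat * n)" for n :: nat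
proof (induction n)
  case (Suc n)
  have "G_sigma [^]\<^bsub>G_mq m q t\<^esub> Suc n \<otimes>\<^bsub>G_mq m q t\<^esub> G_tau = G_sigma [^]\<^bsub>G_mq m q t\<^esub> n \<otimes>\<^bsub>G_mq m q t\<^esub> (G_sigma \<otimes>\<^bsub>G_mq m q t\<^esub> G_tau)"
    by (simp add: G.m_assoc)
  also have "\<dots> = (G_sigma [^]\<^bsub>G_mq m q t\<^esub> n \<otimes>\<^bsub>G_mq m q t\<^esub> G_tau) \<otimes>\<^bsub>G_mq m q t\<^esub> G_sigma [^]\<^bsub>G_mq m q t\<^esub> t_nat"
    by (simp add: G_commute G.m_assoc)
  also have "\<dots> = G_tau \<otimes>\<^bsub>G_mq m q t\<^esub> (G_sigma [^]\<^bsub>G_mq m q t\<^esub> (t_nat * n) \<otimes>\<^bsub>G_mq m q t\<^esub> G_sigma [^]\<^bsub>G_mq m q t\<^esub> t_nat)"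
    by (simp add: Suc.IH G.m_assoc)
  also have "\<dots> = G_tau \<otimes>\<^bsub>G_mq m q t\<^esub> G_sigma [^]\<^bsub>G_mq m q t\<^esub> (t_nat * Suc n)"
    by (simp add: G.nat_pow_mult add.commute)
  finally show ?case .
qed simp

lemma G_commute_pow_pow: "G_sigma [^]\<^bsub>G_mq m q t\<^esub> n \<otimes>\<^bsub>G_mq m q t\<^esub> G_tau [^]\<^bsub>G_mq m q t\<^esub> i = G_tau [^]\<^bsub>G_mq m q t\<^esub> i \<otimes>\<^bsub>G_mq m q t\<^esub> G_sigma [^]\<^bsub>G_mq m q t\<^esub> (t_nat ^ i * n)"
  for n i :: nat
proof (induction i)
  case (Suc i)
  have "G_sigma [^]\<^bsub>G_mq m q t\<^esub> n \<otimes>\<^bsub>G_mq m q t\<^esub> G_tau [^]\<^bsub>G_mq m q t\<^esub> Suc i = (G_sigma [^]\<^bsub>G_mq m q t\<^esub> n \<otimes>\<^bsub>G_mq m q t\<^esub> G_tau [^]\<^bsub>G_mq m q t\<^esub> i) \<otimes>\<^bsub>G_mq m q t\<^esub> G_tau"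
    by (simp add: G.m_assoc)
  also have "\<dots> = G_tau [^]\<^bsub>G_mq m q t\<^esub> i \<otimes>\<^bsub>G_mq m q t\<^esub> (G_sigma [^]\<^bsub>G_mq m q t\<^esub> (t_nat ^ i * n) \<otimes>\<^bsub>G_mq m q t\<^esub> G_tau)"
    by (simp add: Suc.IH G.m_assoc)
  also have "\<dots> = G_tau [^]\<^bsub>G_mq m q t\<^esub> Suc i \<otimes>\<^bsub>G_mq m q t\<^esub> G_sigma [^]\<^bsub>G_mq m q t\<^esub> (t_nat ^ Suc i * n)"
    by (simp add: G_commute_pow G.m_assoc mult.assoc)
  finally show ?case .
qed simp

lemma G_elem_mod: "G_elem i j = G_elem (i mod q) (j mod m)"
  unfolding G_elem_eq using G_sigma_pow_mod[of j] G_tau_pow_mod[of i] by simp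

lemma G_sigma_elem: "G_sigma \<otimes>\<^bsub>G_mq m q t\<^esub> G_elem i j = G_elem i ((j + t_nat ^ i) mod m)"
proof -
  have "G_sigma \<otimes>\<^bsub>G_mq m q t\<^esub> G_elem i j = (G_sigma [^]\<^bsub>G_mq m q t\<^esub> (1::nat) \<otimes>\<^bsub>G_mq m q t\<^esub> G_tau [^]\<^bsub>G_mq m q t\<^esub> i) \<otimes>\<^bsub>G_mq m q t\<^esub> G_sigma [^]\<^bsub>G_mq m q t\<^esub> j"
    by (simp add: G_elem_eq G.m_assoc)
  also have "\<dots> = G_tau [^]\<^bsub>G_mq m q t\<^esub> i \<otimes>\<^bsub>G_mq m q t\<^esub> G_sigma [^]\<^bsub>G_mq m q t\<^esub> (j + t_nat ^ i)"
    unfolding G_commute_pow_pow by (simp add: G.m_assoc G.nat_pow_mult add.commute)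
  also have "\<dots> = G_elem i ((j + t_nat ^ i) mod m)"
    unfolding G_elem_eq by (simp only: G_sigma_pow_mod[of "j + t_nat ^ i"])
  finally show ?thesis .
qed

lemma G_tau_elem: "G_tau \<otimes>\<^bsub>G_mq m q t\<^esub> G_elem i j = G_elem ((i + 1) mod q) j"
proof -
  have "G_tau \<otimes>\<^bsub>G_mq m q t\<^esub> G_elem i j = G_tau [^]\<^bsub>G_mq m q t\<^esub> (i + 1) \<otimes>\<^bsub>G_mq m q t\<^esub> G_sigma [^]\<^bsub>G_mq m q t\<^esub> j"
    by (simp add: G_elem_eq G.m_assoc[symmetric] G.nat_pow_Suc2[symmetric] del: G.nat_pow_Suc)
  then show ?thesis unfolding G_elem_eq using G_tau_pow_mod[of "i + 1"] by simp
qed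

text \<open>Both generators have finite order, so their inverses are nonnegative powers, and left
  multiplication by the generators themselves reaches the class of every word.\<close>

lemma G_induct:
  assumes h: "h \<in> carrier (G_mq m q t)" and one: "P \<one>\<^bsub>G_mq m q t\<^esub>"
    and sig: "\<And>h. h \<in> carrier (G_mq m q t) \<Longrightarrow> P h \<Longrightarrow> P (G_sigma \<otimes>\<^bsub>G_mq m q t\<^esub> h)"
    and tau: "\<And>h. h \<in> carrier (G_mq m q t) \<Longrightarrow> P h \<Longrightarrow> P (G_tau \<otimes>\<^bsub>G_mq m q t\<^esub> h)"
  shows "P h"
proof -
  have pow: "P (y [^]\<^bsub>G_mq m q t\<^esub> n \<otimes>\<^bsub>G_mq m q t\<^esub> h)"
    if "y \<in> carrier (G_mq m q t)" "\<And>h. h \<in> carrier (G_mq m q t) \<Longrightarrow> P h \<Longrightarrow> P (y \<otimes>\<^bsub>G_mq m q t\<^esub> h)"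
      "h \<in> carrier (G_mq m q t)" "P h" for y h and n :: nat
  proof (induction n)
    case (Suc n)
    then show ?case using that unfolding G.nat_pow_Suc2[OF that(1)] by (simp add: G.m_assoc)
  qed (use that in simp)
  have inv: "inv\<^bsub>G_mq m q t\<^esub> y = y [^]\<^bsub>G_mq m q t\<^esub> (n - 1)" if "y \<in> carrier (G_mq m q t)" "y [^]\<^bsub>G_mq m q t\<^esub> n = \<one>\<^bsub>G_mq m q t\<^esub>" "n > 0" for y and n :: nat
    using that by (intro G.inv_equality) (simp_all add: G.nat_pow_Suc[symmetric] del: G.nat_pow_Suc)
  obtain w where "h = word_class G_mq_relations w"
    using h by (auto simp: G_mq_eq presented_group_def)
  moreover have "P (word_class G_mq_relations w)"
  proof (induction w)
    case Nil
    then show ?case using one by (simp add: G_class_one)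
  next
    case (Cons l w)
    obtain y s where l: "l = (y, s)" by force
    have "word_class G_mq_relations [(y, s)] \<in> {G_sigma, G_sigma [^]\<^bsub>G_mq m q t\<^esub> (m - 1), G_tau, G_tau [^]\<^bsub>G_mq m q t\<^esub> (q - 1)}"
      using inv[OF _ G_sigma_order m] inv[OF _ G_tau_order q]
      by (cases y; cases s) (simp_all add: G_class_inverse G_sigma_def[symmetric] G_tau_def[symmetric])
    then have "P (word_class G_mq_relations [(y, s)] \<otimes>\<^bsub>G_mq m q t\<^esub> word_class G_mq_relations w)"
      using sig tau pow Cons.IH by (auto simp: G_class_carrier)
    then show ?case by (simp add: G_class_mult l)
  qed
  ultimately show ?thesis by simp
qed

lemma G_elem_bij: "bij_betw (\<lambda>(i, j). G_elem i j) ({..<q} \<times> {..<m}) (carrier (G_mq m q t))"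
  unfolding bij_betw_def
proof
  show "inj_on (\<lambda>(i, j). G_elem i j) ({..<q} \<times> {..<m})"
    using G_elem_inj by (fastforce simp: inj_on_def)
  let ?E = "(\<lambda>(i, j). G_elem i j) ` ({..<q} \<times> {..<m})"
  have E: "G_elem i j \<in> ?E" for i j
    using G_elem_mod[of i j] m q by (force simp: image_iff)
  have "h \<in> ?E" if "h \<in> carrier (G_mq m q t)" for h
  proof (rule G_induct[OF that])
    show "\<one>\<^bsub>G_mq m q t\<^esub> \<in> ?E" using E[of 0 0] by (simp add: G_elem_eq)
  next
    fix h assume "h \<in> ?E"
    then obtain i j where "h = G_elem i j" by auto
    then show "G_sigma \<otimes>\<^bsub>G_mq m q t\<^esub> h \<in> ?E" "G_tau \<otimes>\<^bsub>G_mq m q t\<^esub> h \<in> ?E"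
      using E by (simp_all add: G_sigma_elem G_tau_elem)
  qed
  moreover have "G_elem i j \<in> carrier (G_mq m q t)" for i j by (simp add: G_elem_def G_class_carrier)
  ultimately show "?E = carrier (G_mq m q t)" by auto
qed

end

section \<open>Fixed fields of cyclic automorphism groups\<close>

text \<open>\<open>f\<close> is total on the ambient type but controlled only on \<open>K\<close>,
  hence the membership premises throughout. The locale also covers the powers \<open>f ^^ n\<close>,
  which the descent needs for a power of sigma.\<close>

locale field_endo =
  fixes k K :: "'a::field set" and f :: "'a \<Rightarrow> 'a"
  assumes k: "subfield k amb" and K: "subfield K amb" and kK: "k \<subseteq> K"
    and closed: "a \<in> K \<Longrightarrow> f a \<in> K"
    and add: "a \<in> K \<Longrightarrow> b \<in> K \<Longrightarrow> f (a + b) = f a + f b"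
    and mult: "a \<in> K \<Longrightarrow> b \<in> K \<Longrightarrow> f (a * b) = f a * f b"
    and base: "c \<in> k \<Longrightarrow> f c = c"
begin

lemma zero [simp]: "f 0 = 0" and one [simp]: "f 1 = 1"
  using base subfield_basics[OF k] by auto

lemma uminus: "a \<in> K \<Longrightarrow> f (- a) = - f a"
  using add[of "- a" a] subfield_uminus[OF K, of a] by (simp add: eq_neg_iff_add_eq_0)

lemma inverse: "a \<in> K \<Longrightarrow> f (inverse a) = inverse (f a)"
  using mult[of a "inverse a"] subfield_inverse[OF K, of a] by (cases "a = 0") (auto simp: inverse_unique)

lemma divide: "a \<in> K \<Longrightarrow> b \<in> K \<Longrightarrow> f (a / b) = f a / f b"
  using subfield_inverse[OF K] by (simp add: divide_inverse mult inverse)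

lemma power: "a \<in> K \<Longrightarrow> f (a ^ n) = f a ^ n"
  by (induction n) (auto simp: mult subfield_power[OF K])

lemma power_int: "a \<in> K \<Longrightarrow> f (a powi n) = f a powi n"
  by (simp add: power_int_def power inverse subfield_inverse[OF K])

lemma sum: "(\<And>i. i \<in> A \<Longrightarrow> g i \<in> K) \<Longrightarrow> f (sum g A) = (\<Sum>i\<in>A. f (g i))"
  by (induction A rule: infinite_finite_induct) (auto simp: add subfield_sum[OF K])

lemma prod: "(\<And>i. i \<in> A \<Longrightarrow> g i \<in> K) \<Longrightarrow> f (prod g A) = (\<Prod>i\<in>A. f (g i))"
  by (induction A rule: infinite_finite_induct) (auto simp: mult subfield_prod[OF K])

text \<open>Identities between endomorphisms then need checking on generators only.\<close>

lemma equalizer_subfield: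
  assumes "field_endo k K g"
  shows "subfield {a \<in> K. f a = g a} amb"
proof -
  interpret g: field_endo k K g by fact
  show ?thesis
    by (rule subfieldI_type)
      (auto simp: subfield_closed[OF K] add mult uminus inverse g.add g.mult g.uminus g.inverse)
qed

lemma id_endo: "field_endo k K (\<lambda>a. a)"
  by (rule field_endo.intro) (use k K kK in auto)

lemma comp_endo: "field_endo k K g \<Longrightarrow> field_endo k K (\<lambda>a. f (g a))"
  unfolding field_endo_def using add mult closed base by auto

lemma adjoin_eqI:
  assumes g: "field_endo k K g" and S: "S \<subseteq> K" "\<And>s. s \<in> S \<Longrightarrow> f s = g s" and r: "r \<in> adjoin k S"
  shows "f r = g r"
proof -
  have "adjoin k S \<subseteq> {a \<in> K. f a = g a}"
    using S kK base field_endo.base[OF g] by (intro adjoin_least equalizer_subfield[OF g]) auto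
  then show ?thesis using r by auto
qed

lemma adjoin_fixed:
  assumes E: "E \<subseteq> K" "\<And>a. a \<in> E \<Longrightarrow> f a = a" and S: "S \<subseteq> K" "\<And>s. s \<in> S \<Longrightarrow> f s = s"
    and r: "r \<in> adjoin E S"
  shows "f r = r"
proof -
  have "adjoin E S \<subseteq> {a \<in> K. f a = a}"
    using E S by (intro adjoin_least equalizer_subfield[OF id_endo]) auto
  then show ?thesis using r by auto
qed

lemma funpow_endo: "field_endo k K (f ^^ n)"
proof (induction n)
  case 0
  show ?case using id_endo by (simp add: id_def)
next
  case (Suc n)
  show ?case using comp_endo[OF Suc] by (simp add: comp_def)
qed

lemma funpow_eigen:
  assumes "w \<in> K" "f w = c * w" "c \<in> k"
  shows "(f ^^ n) w = c ^ n * w"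
proof (induction n)
  case (Suc n)
  have "f (c ^ n * w) = c ^ n * f w"
    using assms base[of "c ^ n"] subfield_power[OF k, of c n] kK by (subst mult) auto
  then show ?case using Suc assms by (simp add: ac_simps)
qed simp

end

text \<open>Supplies two of the orders in the descent: later \<open>eps ^ (T - 1)\<close> has order
  \<open>m'\<close>, and \<open>eps ^ m'\<close> has order \<open>d\<close>.\<close>

lemma primitive_root_power:
  assumes z: "primitive_root_of_unity n (z :: 'a::field)"
  shows "primitive_root_of_unity (n div gcd n l) (z ^ l)"
proof -
  have n: "n > 0" using z by (simp add: primitive_root_of_unity_def)
  have *: "(z ^ l) ^ j = 1 \<longleftrightarrow> n div gcd n l dvd j" for j
  proof -
    have "(z ^ l) ^ j = 1 \<longleftrightarrow> n dvd l * j"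
      using primitive_root_power_eq_1_iff[OF z] by (simp add: power_mult[symmetric])
    also have "\<dots> \<longleftrightarrow> (n div gcd n l) * gcd n l dvd (l div gcd n l * j) * gcd n l"
      by (simp add: mult.commute mult.left_commute)
    also have "\<dots> \<longleftrightarrow> n div gcd n l dvd l div gcd n l * j"
      using n by (simp only: mult.commute[of _ "gcd n l"] nat_mult_dvd_cancel_disj) simp
    also have "\<dots> \<longleftrightarrow> n div gcd n l dvd j"
      using n by (intro coprime_dvd_mult_right_iff div_gcd_coprime) auto
    finally show ?thesis .
  qed
  have "n div gcd n l > 0" using n by (simp add: div_greater_zero_iff dvd_imp_le)
  then show ?thesis unfolding primitive_root_of_unity_def * by (auto dest: dvd_imp_le)
qed

text \<open>The mean of the conjugates of \<open>r = \<Sum>j<n. h j * w ^ j\<close> is both \<open>r\<close> and \<open>h 0\<close>.\<close>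

lemma (in field_endo) cyclic_descent:
  assumes E: "subfield E amb" "E \<subseteq> K" "\<And>a. a \<in> E \<Longrightarrow> f a = a"
    and w: "w \<in> K" "f w = c * w" and c: "c \<in> E" "primitive_root_of_unity n c" "of_nat n \<noteq> (0 :: 'a)"
    and wn: "w ^ n \<in> E" and r: "r \<in> adjoin E {w}" "f r = r"
  shows "r \<in> E"
proof -
  have n: "n > 0" using c(2) by (simp add: primitive_root_of_unity_def)
  have "r \<in> fspan E (\<lambda>j. w ^ j) {..<n}" using adjoin_power_span[OF E(1) wn n] r(1) by auto
  then obtain h where h: "\<forall>j. h j \<in> E" "r = (\<Sum>j<n. h j * w ^ j)"
    by (rule fspan_finite[OF E(1), rotated]) simp_all
  define R where "R i = (\<Sum>j<n. h j * c ^ (i * j) * w ^ j)" for i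
  have hK: "h j * c ^ i \<in> E" for i j
    using h c(1) by (auto intro: subfield_closed[OF E(1)])
  have "f (R i) = R (Suc i)" for i
  proof -
    have "f (R i) = (\<Sum>j<n. f (h j * c ^ (i * j) * w ^ j))"
      unfolding R_def
    proof (rule sum)
      fix j
      show "h j * c ^ (i * j) * w ^ j \<in> K"
        using hK[of j "i * j"] E(2) by (intro subfield_basics(4)[OF K _ subfield_power[OF K w(1)]]) auto
    qed
    also have "\<dots> = R (Suc i)"
      unfolding R_def
    proof (rule sum.cong)
      fix j
      have "f (h j * c ^ (i * j) * w ^ j) = (h j * c ^ (i * j)) * (c * w) ^ j"
        using hK[of j "i * j"] E(2,3) w by (subst mult) (auto simp: power subfield_power[OF K])
      then show "f (h j * c ^ (i * j) * w ^ j) = h j * c ^ (Suc i * j) * w ^ j"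
        by (simp add: power_mult_distrib power_add ac_simps)
    qed simp
    finally show ?thesis .
  qed
  moreover have "R 0 = r" by (simp add: R_def h)
  ultimately have R: "R i = r" for i by (induction i) (auto simp: r(2), metis r(2))
  have "of_nat n * r = (\<Sum>i<n. R i)" by (simp add: R)
  also have "\<dots> = (\<Sum>j<n. h j * w ^ j * (\<Sum>i<n. c ^ (i * j)))"
    unfolding R_def sum_distrib_left by (subst sum.swap) (simp add: ac_simps)
  also have "\<dots> = (\<Sum>j<n. if j = 0 then h 0 * of_nat n else 0)"
    by (rule sum.cong) (auto simp: sum_roots_of_unity[OF c(2)] dest: dvd_imp_le)
  also have "\<dots> = of_nat n * h 0" using n by simp
  finally show ?thesis using c(3) h(1) by simp
qed

text \<open>The exponent \<open>(n - 1) l j\<close> replaces \<open>- l j\<close>, as \<open>z ^ n = 1\<close>.\<close>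

definition dft :: "nat \<Rightarrow> 'a::field \<Rightarrow> (nat \<Rightarrow> 'a) \<Rightarrow> nat \<Rightarrow> 'a" where
  "dft n z g l = (\<Sum>j<n. z ^ ((n - 1) * l * j) * g j)"

lemma dft_inverse:
  fixes z :: "'a::field"
  assumes z: "primitive_root_of_unity n z" and n0: "of_nat n \<noteq> (0 :: 'a)" and j: "j < n"
  shows "g j = (\<Sum>l<n. z ^ (l * j) * dft n z g l) / of_nat n"
proof -
  have n: "n > 0" using z by (simp add: primitive_root_of_unity_def)
  have "(\<Sum>l<n. z ^ (l * j) * dft n z g l) = (\<Sum>i<n. (\<Sum>l<n. z ^ (l * (j + (n - 1) * i))) * g i)"
    unfolding dft_def sum_distrib_left sum_distrib_right
    by (subst sum.swap) (simp add: power_add[symmetric] algebra_simps)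
  also have "\<dots> = (\<Sum>i<n. if i = j then of_nat n * g j else 0)"
  proof (rule sum.cong)
    fix i assume "i \<in> {..<n}"
    \<comment> \<open>Modulo \<open>n\<close> the exponent \<open>j + (n - 1) * i\<close> is the
      difference of \<open>j\<close> and \<open>i\<close>.\<close>
    have "n dvd j + (n - 1) * i \<longleftrightarrow> i = j"
    proof -
      have "int n dvd int (j + (n - 1) * i) \<longleftrightarrow> int n dvd (int j - int i) + int n * int i"
        using n by (cases n) (simp_all add: algebra_simps)
      also have "\<dots> \<longleftrightarrow> int n dvd int j - int i" by (rule dvd_add_left_iff) simp
      also have "\<dots> \<longleftrightarrow> i = j"
        using j \<open>i \<in> _\<close> by (auto simp: mod_eq_dvd_iff[symmetric])
      finally show ?thesis by (simp only: int_dvd_int_iff)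
    qed
    then show "(\<Sum>l<n. z ^ (l * (j + (n - 1) * i))) * g i = (if i = j then of_nat n * g j else 0)"
      by (auto simp: sum_roots_of_unity[OF z])
  qed simp
  also have "\<dots> = of_nat n * g j" using j by simp
  finally have "g j * of_nat n = (\<Sum>l<n. z ^ (l * j) * dft n z g l)" by (simp only: mult.commute)
  then show ?thesis by (rule nonzero_eq_divide_eq[OF n0, THEN iffD2])
qed

lemma dft_inverse_mem:
  fixes z :: "'a::field"
  assumes "subfield L amb" "primitive_root_of_unity n z" "of_nat n \<noteq> (0 :: 'a)" "z \<in> L"
    and "\<And>l. l < n \<Longrightarrow> dft n z g l \<in> L" "j < n"
  shows "g j \<in> L"
  unfolding dft_inverse[OF assms(2,3,6), of g] using assms(4,5)
  by (intro subfield_divide[OF assms(1)] subfield_sum[OF assms(1)] subfield_basics(4)[OF assms(1)]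
      subfield_power[OF assms(1)] subfield_of_nat[OF assms(1)]) auto

text \<open>A cyclic shift of the sequence becomes multiplication by a root of unity, because
  reindexing the sum only moves the character. This is the source of the eigenvectors of both sigma
  and tau.\<close>

lemma dft_shift:
  assumes z: "z ^ n = (1 :: 'a::field)" and n: "n > 0"
  shows "dft n z (\<lambda>j. g ((j + r) mod n)) l = z ^ (l * r) * dft n z g l"
proof -
  have inj: "inj_on (\<lambda>j. (j + r) mod n) {..<n}"
  proof (rule inj_onI)
    fix i j assume "i \<in> {..<n}" "j \<in> {..<n}" "(i + r) mod n = (j + r) mod n"
    then have "[i + r = j + r] (mod n)" by (simp add: cong_def)
    then have "[i = j] (mod n)" by (simp only: cong_add_rcancel_nat)
    then show "i = j" using \<open>i \<in> _\<close> \<open>j \<in> _\<close> by (simp add: cong_def)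
  qed
  have "(\<lambda>j. (j + r) mod n) ` {..<n} = {..<n}"
    by (rule endo_inj_surj[OF _ _ inj]) (use n in auto)
  then have bij: "bij_betw (\<lambda>j. (j + r) mod n) {..<n} {..<n}" using inj by (simp add: bij_betw_def)
  have pw: "z ^ ((n - 1) * l * j) = z ^ (l * r) * z ^ ((n - 1) * l * ((j + r) mod n))" for j
  proof -
    have "z ^ ((n - 1) * l * ((j + r) mod n)) = z ^ (((n - 1) * l * ((j + r) mod n)) mod n)"
      by (rule power_mod_exponent[OF z])
    also have "\<dots> = z ^ (((n - 1) * l * (j + r)) mod n)" by (simp add: mod_simps)
    also have "\<dots> = z ^ ((n - 1) * l * (j + r))" by (rule power_mod_exponent[OF z, symmetric])
    finally have "z ^ (l * r) * z ^ ((n - 1) * l * ((j + r) mod n)) = z ^ (l * r + (n - 1) * l * (j + r))"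
      by (simp add: power_add)
    also have "l * r + (n - 1) * l * (j + r) = (n - 1) * l * j + n * (l * r)"
      using n by (cases n) (auto simp: algebra_simps)
    also have "z ^ ((n - 1) * l * j + n * (l * r)) = z ^ ((n - 1) * l * j)"
      by (simp add: power_add power_mult z)
    finally show ?thesis ..
  qed
  have "dft n z (\<lambda>j. g ((j + r) mod n)) l =
      (\<Sum>j<n. z ^ (l * r) * (z ^ ((n - 1) * l * ((j + r) mod n)) * g ((j + r) mod n)))"
    unfolding dft_def by (subst pw) (simp add: mult.assoc)
  also have "\<dots> = (\<Sum>j<n. z ^ (l * r) * (z ^ ((n - 1) * l * j) * g j))"
    by (rule sum.reindex_bij_betw[OF bij])
  finally show ?thesis by (simp add: dft_def sum_distrib_left)
qed

lemma (in field_endo) dft: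
  assumes "z \<in> k" "\<And>j. j < n \<Longrightarrow> g j \<in> K"
  shows "f (dft n z g l) = dft n z (\<lambda>j. f (g j)) l" "dft n z g l \<in> K"
proof -
  have z: "z ^ i \<in> K" "f (z ^ i) = z ^ i" for i
    using subfield_power[OF k assms(1)] kK base by auto
  then show "f (dft n z g l) = dft n z (\<lambda>j. f (g j)) l"
    unfolding dft_def using assms(2) by (subst sum) (auto simp: mult subfield_basics[OF K])
  show "dft n z g l \<in> K" unfolding dft_def
    using z assms(2) by (intro subfield_sum[OF K] subfield_basics(4)[OF K]) auto
qed

text \<open>The exchange bound first forces \<open>f\<close> to be injective on \<open>J\<close>,
  since its image needs at least \<open>card I\<close> elements; then the version for sets
  applies.\<close>

lemma generators_independent_family:
  assumes I: "finite I" "\<forall>a\<in>I. a \<notin> dep_closure k (I - {a})"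
    and J: "finite J" "card J \<le> card I" "I \<subseteq> dep_closure k (f ` J)" and j: "j \<in> J"
  shows "f j \<notin> dep_closure k (f ` (J - {j}))"
proof -
  have "card I \<le> card (f ` J)" by (rule steinitz_card[OF I _ J(3)]) (use J(1) in simp)
  then have "card (f ` J) = card J" using card_image_le[OF J(1), of f] J(2) by simp
  then have inj: "inj_on f J" by (rule eq_card_imp_inj_on[OF J(1)])
  then have "f ` (J - {j}) = f ` J - {f j}" using inj_on_image_set_diff[OF inj, of J "{j}"] j by simp
  then show ?thesis
    using generators_independent[OF I, of "f ` J" "f j"] J j card_image_le[OF J(1), of f] by simp
qed

section \<open>Semi-invariant coordinates\<close>

text \<open>Here \<open>xx i j\<close> is \<open>x(\<tau>\<^sup>i \<sigma>\<^sup>j)\<close>, and \<open>T\<close> is the residue of \<open>t\<close> modulo \<open>m\<close>.\<close>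

locale metacyclic_action =
  sg: field_endo k K sg + tu: field_endo k K tu
  for k K :: "'a::field set" and sg tu :: "'a \<Rightarrow> 'a" +
  fixes m q T :: nat and xx :: "nat \<Rightarrow> nat \<Rightarrow> 'a" and eps omega :: 'a
    and a :: "nat \<Rightarrow> int" and zeta :: complex
  assumes q: "prime q" and m1: "m > 1" and T1: "T > 1" and Tq: "[T ^ q = 1] (mod m)"
    and eps: "primitive_root_of_unity m eps" "eps \<in> k" and m0: "of_nat m \<noteq> (0 :: 'a)"
    and omega: "primitive_root_of_unity q omega" "omega \<in> k" and q0: "of_nat q \<noteq> (0 :: 'a)"
    and K_gen: "K = adjoin k ((\<lambda>(i, j). xx i j) ` ({..<q} \<times> {..<m}))"
    and ind: "card ((\<lambda>(i, j). xx i j) ` ({..<q} \<times> {..<m})) = q * m"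
      "\<forall>s\<in>(\<lambda>(i, j). xx i j) ` ({..<q} \<times> {..<m}). s \<notin> dep_closure k ((\<lambda>(i, j). xx i j) ` ({..<q} \<times> {..<m}) - {s})"
    and sg_xx: "i < q \<Longrightarrow> j < m \<Longrightarrow> sg (xx i j) = xx i ((j + T ^ i) mod m)"
    and tu_xx: "i < q \<Longrightarrow> j < m \<Longrightarrow> tu (xx i j) = xx ((i + 1) mod q) j"
    and zeta: "primitive_root_of_unity q zeta"
    and a_dvd: "int (m div gcd m (T - 1)) dvd (\<Sum>i\<le>q - 2. a i * int T ^ i)"
    and a_norm: "field_norm \<rat> (adjoin \<rat> {zeta}) (\<Sum>i\<le>q - 2. of_int (a i) * zeta ^ i)
           \<in> {of_int (int (m div gcd m (T - 1))), - of_int (int (m div gcd m (T - 1)))}"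
begin

text \<open>\<open>m'\<close> and \<open>d\<close> are the powers by which \<open>g 0\<close> and
  \<open>y 0\<close> will fall into the next lower field of the tower; their product is
  \<open>m\<close>.\<close>

definition "d = gcd m (T - 1)"
definition "m' = m div d"

lemma d_m': "m = m' * d" "d > 0" "m' > 0"
  using m1 by (auto simp: d_def m'_def div_greater_zero_iff dvd_imp_le)

lemma m_dvd: "m dvd m' * (T - 1)"
proof -
  have "m' * d dvd m' * (T - 1)" by (intro mult_dvd_mono) (simp_all add: d_def)
  then show ?thesis by (simp add: d_m'(1)[symmetric])
qed

lemma q1: "q > 1" using q prime_gt_1_nat by blast

text \<open>\<open>m\<close> divides T^q - 1 = (T - 1)(1 + T + ... + T^(q-1)). Cancel
  \<open>d\<close>; the remaining factor (T - 1)/d is prime to \<open>m'\<close>. This makes zeta ->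
  T a ring map from Z[zeta_q] to Z/m'.\<close>

lemma geo_dvd: "int m' dvd (\<Sum>i<q. int T ^ i)"
proof -
  define e where "e = (T - 1) div d"
  have e: "T - 1 = d * e" by (simp add: e_def d_def)
  have "coprime m' e" unfolding m'_def e_def d_def using m1 by (intro div_gcd_coprime) auto
  have "int T ^ q - 1 = (int T - 1) * (\<Sum>i<q. int T ^ i)" by (rule power_diff_1_eq)
  moreover have "int m dvd int T ^ q - 1"
    using Tq unfolding cong_int_iff[symmetric] by (simp add: cong_iff_dvd_diff)
  moreover have "int T - 1 = int d * int e" using e T1 by (simp add: of_nat_diff flip: of_nat_mult)
  moreover have "int m = int d * int m'"
    using arg_cong[OF d_m'(1), of int] by (simp only: of_nat_mult mult.commute)
  ultimately have "int d * int m' dvd int d * (int e * (\<Sum>i<q. int T ^ i))"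
    by (simp only: mult.assoc)
  then have "int m' dvd int e * (\<Sum>i<q. int T ^ i)" using d_m'(2) by simp
  moreover have "coprime (int m') (int e)" using \<open>coprime m' e\<close> by simp
  ultimately show ?thesis by (simp only: coprime_dvd_mult_right_iff)
qed

section \<open>Nonvanishing by counting generators\<close>

lemma xx_K: "i < q \<Longrightarrow> j < m \<Longrightarrow> xx i j \<in> K"
  unfolding K_gen by (rule adjoin_incl) auto

lemma counting:
  assumes "\<And>i j. i < q \<Longrightarrow> j < m \<Longrightarrow> xx i j \<in> dep_closure k (h ` ({..<q} \<times> {..<m}))"
    and "p \<in> {..<q} \<times> {..<m}"
  shows "h p \<notin> dep_closure k (h ` ({..<q} \<times> {..<m} - {p}))"
  by (rule generators_independent_family[OF _ ind(2)]) (use assms ind(1) in auto)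

text \<open>Zero lies in every \<open>dep_closure\<close>, so it cannot belong to a family indexed
  by \<open>q * m\<close> places over which all variables are algebraic.\<close>

lemma counting_nonzero:
  assumes "\<And>i j. i < q \<Longrightarrow> j < m \<Longrightarrow> xx i j \<in> dep_closure k (h ` ({..<q} \<times> {..<m}))"
    and "p \<in> {..<q} \<times> {..<m}"
  shows "h p \<noteq> 0"
  using counting[OF assms] subfield_basics(1)[OF subfield_dep_closure] by metis

lemma k_dep_closure: "k \<subseteq> dep_closure k S"
  using adjoin_dep_closure[of k S] by (auto intro: adjoin_base)

section \<open>Eigenvectors of sigma and their ratios\<close>

lemma eps_pow: "eps ^ m = 1" "omega ^ q = 1"
  using eps omega by (auto simp: primitive_root_of_unity_def)

lemma eps_pow_eq: "[i = j] (mod m) \<Longrightarrow> eps ^ i = eps ^ j"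
  using power_mod_exponent[OF eps_pow(1), of i] power_mod_exponent[OF eps_pow(1), of j]
  by (simp add: cong_def)

lemma T_mod: "[T ^ (i mod q) = T ^ i] (mod m)"
  by (rule cong_sym[OF cong_power_mod_exponent[OF Tq]])

text \<open>The index \<open>i\<close> is read modulo \<open>q\<close>, so that tau is the plain
  shift \<open>i \<mapsto> i + 1\<close>.\<close>

definition Y :: "nat \<Rightarrow> nat \<Rightarrow> 'a" where "Y i l = dft m eps (xx (i mod q)) l"

lemma Y_K: "Y i l \<in> K"
  unfolding Y_def by (rule sg.dft(2)[OF eps(2)]) (use q1 xx_K in auto)

lemma Y_periodic: "Y (i mod q) l = Y i l" by (simp add: Y_def)

lemma sg_Y: "sg (Y i l) = eps ^ (l * T ^ i) * Y i l"
proof -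
  have "sg (Y i l) = dft m eps (\<lambda>j. sg (xx (i mod q) j)) l"
    unfolding Y_def by (rule sg.dft(1)[OF eps(2)]) (use q1 xx_K in auto)
  also have "\<dots> = dft m eps (\<lambda>j. xx (i mod q) ((j + T ^ (i mod q)) mod m)) l"
    unfolding dft_def using q1 by (intro sum.cong) (auto simp: sg_xx)
  also have "\<dots> = eps ^ (l * T ^ (i mod q)) * Y i l"
    unfolding Y_def by (rule dft_shift[OF eps_pow(1)]) (use m1 in simp)
  also have "eps ^ (l * T ^ (i mod q)) = eps ^ (l * T ^ i)"
    by (intro eps_pow_eq cong_mult T_mod) simp
  finally show ?thesis .
qed

lemma tu_Y: "tu (Y i l) = Y (i + 1) l"
proof -
  have "tu (Y i l) = dft m eps (\<lambda>j. tu (xx (i mod q) j)) l"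
    unfolding Y_def by (rule tu.dft(1)[OF eps(2)]) (use q1 xx_K in auto)
  also have "\<dots> = Y (i + 1) l"
    unfolding Y_def dft_def using q1 by (intro sum.cong) (auto simp: tu_xx mod_simps)
  finally show ?thesis .
qed

lemma xx_mem:
  assumes L: "subfield L amb" "k \<subseteq> L" "\<And>l. l < m \<Longrightarrow> Y i l \<in> L" and ij: "i < q" "j < m"
  shows "xx i j \<in> L"
  by (rule dft_inverse_mem[OF L(1) eps(1) m0 _ _ ij(2)]) (use L eps(2) ij(1) in \<open>auto simp: Y_def\<close>)

text \<open>Fourier inversion recovers the variables from the \<open>q * m\<close> elements
  \<open>Y i l\<close>, so counting applies.\<close>

lemma Y_nonzero: "l < m \<Longrightarrow> Y i l \<noteq> 0"
proof -
  assume l: "l < m"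
  have "(\<lambda>(i, l). Y i l) (i mod q, l) \<noteq> 0"
  proof (rule counting_nonzero)
    fix i j assume "i < q" "j < m"
    then show "xx i j \<in> dep_closure k ((\<lambda>(i, l). Y i l) ` ({..<q} \<times> {..<m}))"
      by (intro xx_mem[OF subfield_dep_closure k_dep_closure])
        (auto intro!: subsetD[OF dep_closure_incl])
  qed (use l q1 in auto)
  then show "Y i l \<noteq> 0" by (simp add: Y_periodic)
qed

definition "y i = Y i 1"

lemma y: "y i \<in> K" "y i \<noteq> 0" "sg (y i) = eps ^ (T ^ i) * y i" "tu (y i) = y (i + 1)" "y (i mod q) = y i"
  using m1 by (simp_all add: y_def Y_K Y_nonzero sg_Y tu_Y Y_periodic)

definition "g i = y (i + 1) / y i"

lemma g: "g i \<in> K" "g i \<noteq> 0" "tu (g i) = g (i + 1)" "g (i mod q) = g i"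
proof -
  show "g i \<in> K" "g i \<noteq> 0" by (auto simp: g_def y intro: subfield_divide[OF sg.K])
  show "tu (g i) = g (i + 1)" by (simp add: g_def y tu.divide)
  have "y (i mod q + 1) = y (i + 1)" by (metis mod_add_left_eq y(5))
  then show "g (i mod q) = g i" by (simp add: g_def y(5))
qed

lemma eps_nonzero: "eps \<noteq> 0"
  using eps_pow(1) m1 by (auto simp: power_0_left)

lemma sg_g: "sg (g i) = eps ^ ((T - 1) * T ^ i) * g i"
proof -
  have "T ^ (i + 1) = (T - 1) * T ^ i + T ^ i" using T1 by (cases T) auto
  then have "eps ^ (T ^ (i + 1)) = eps ^ ((T - 1) * T ^ i) * eps ^ (T ^ i)" by (simp add: power_add)
  then show ?thesis using eps_nonzero by (simp add: g_def sg.divide y)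
qed

lemma prod_g: "(\<Prod>i<n. g (l + i)) = y (l + n) / y l"
  using prod_lessThan_telescope[of n "\<lambda>i. y (l + i)"] y(2) by (simp add: g_def)

lemma prod_g_period: "(\<Prod>i<q. g (l + i)) = 1"
proof -
  have "y (l + q) = y l" using y(5)[of "l + q"] y(5)[of l] by simp
  then show ?thesis using y(2) by (simp add: prod_g)
qed

text \<open>Reduced by the relation among the \<open>g i\<close>, the exponents are the coordinates
  of alpha * zeta^j in Z[zeta_q].\<close>

definition "z j = (\<Prod>l\<le>q - 2. g (l + j) powi a l)"

lemma z: "z j \<in> K" "z j \<noteq> 0" "tu (z j) = z (j + 1)"
  using g by (auto simp: z_def tu.prod tu.power_int subfield_power_int[OF sg.K] intro!: subfield_prod[OF sg.K])

lemma eps_powi_eq_1: "int m dvd n \<Longrightarrow> eps powi n = 1"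
  by (auto simp: dvd_def power_int_mult eps_pow)

text \<open>Sigma contributes the power of \<open>eps\<close> with exponent (T - 1) T^j alpha(T),
  where alpha(T) is the sum of the \<open>a l\<close> times T^l. Here \<open>m'\<close> divides
  alpha(T), and \<open>m\<close> divides m'(T - 1).\<close>

lemma sg_z: "sg (z j) = z j"
proof -
  have "sg (z j) = (\<Prod>l\<le>q - 2. (eps ^ ((T - 1) * T ^ (l + j)) * g (l + j)) powi a l)"
    unfolding z_def using g(1) by (simp add: sg.prod sg.power_int subfield_power_int[OF sg.K] sg_g)
  also have "\<dots> = (\<Prod>l\<le>q - 2. eps powi (int (T - 1) * int T ^ j * (a l * int T ^ l)) * g (l + j) powi a l)"
    by (simp add: power_int_mult_distrib power_add ac_simps flip: power_int_mult power_int_of_nat)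
  also have "\<dots> = eps powi (int (T - 1) * int T ^ j * (\<Sum>l\<le>q - 2. a l * int T ^ l)) * z j"
    unfolding prod.distrib z_def power_int_sum[OF eps_nonzero, symmetric] sum_distrib_left[symmetric] ..
  finally have *: "sg (z j) = eps powi (int (T - 1) * int T ^ j * (\<Sum>l\<le>q - 2. a l * int T ^ l)) * z j" .
  have "int m dvd int (T - 1) * int T ^ j * (\<Sum>l\<le>q - 2. a l * int T ^ l)"
  proof -
    have "int m dvd int m' * int (T - 1)" using m_dvd by (simp flip: of_nat_mult)
    moreover have "int m' dvd (\<Sum>l\<le>q - 2. a l * int T ^ l)" using a_dvd by (simp add: m'_def d_def)
    then have "int m' * int (T - 1) dvd (\<Sum>l\<le>q - 2. a l * int T ^ l) * int (T - 1)" by (rule mult_dvd_mono) simp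
    ultimately have "int m dvd (\<Sum>l\<le>q - 2. a l * int T ^ l) * int (T - 1)" by (rule dvd_trans)
    then have "int m dvd (\<Sum>l\<le>q - 2. a l * int T ^ l) * int (T - 1) * int T ^ j" by (rule dvd_mult2)
    then show ?thesis by (simp only: ac_simps)
  qed
  then show ?thesis unfolding * by (simp only: eps_powi_eq_1 mult_1_left)
qed

lemma prod_z: "(\<Prod>j<q. z j) = 1"
proof -
  have "(\<Prod>j<q. z j) = (\<Prod>l\<le>q - 2. (\<Prod>j<q. g (l + j)) powi a l)"
    unfolding z_def power_int_prod by (rule prod.swap)
  then show ?thesis by (simp add: prod_g_period)
qed

text \<open>The congruence on \<open>e\<close> expresses that sigma fixes the monomial: up to the
  factor T - 1 its left side is the exponent of \<open>eps\<close> that sigma contributes.\<close>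

lemma monomial_mem:
  assumes L: "subfield L amb" "\<And>j. j < q - 1 \<Longrightarrow> z j \<in> L"
    and e: "int m' dvd (\<Sum>i<q - 1. e i * int T ^ i)"
  shows "(\<Prod>i<q - 1. g i powi e i) \<in> L"
proof -
  have "int m' dvd (\<Sum>i\<le>q - 2. a i * int T ^ i)" using a_dvd by (simp add: m'_def d_def)
  then obtain b where b: "b * int m' = (\<Sum>i\<le>q - 2. a i * int T ^ i)" by (metis dvdE mult.commute)
  have n: "field_norm \<rat> (adjoin \<rat> {zeta}) (\<Sum>i\<le>q - 2. of_int (a i) * zeta ^ i)
      \<in> {of_int (int m'), - of_int (int m')}" using a_norm by (simp add: m'_def d_def)
  obtain u where "(\<Prod>i<q - 1. g i powi e i) =
      (\<Prod>j<q - 1. (\<Prod>l\<le>q - 2. g ((l + j) mod q) powi a l) powi u j)"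
    using invariant_monomials[where g = g, OF q _ geo_dvd b zeta n g(2) _ e] prod_g_period[of 0] d_m'(3)
    by (auto simp only: of_nat_0_less_iff add_0)
  also have "\<dots> = (\<Prod>j<q - 1. z j powi u j)" by (simp add: z_def g(4))
  also have "\<dots> \<in> L" using L by (intro subfield_prod subfield_power_int) auto
  finally show ?thesis .
qed

text \<open>The exponent vector with \<open>m'\<close> at place \<open>i\<close> and 0 elsewhere
  satisfies the congruence. So each \<open>g i\<close> is algebraic over the field of the
  \<open>z j\<close>.\<close>

lemma g_power_mem:
  assumes L: "subfield L amb" "\<And>j. j < q - 1 \<Longrightarrow> z j \<in> L" and i: "i < q - 1"
  shows "g i ^ m' \<in> L"
proof -
  define e where "e j = (if j = i then int m' else 0)" for j
  have "(\<Prod>j<q - 1. g j powi e j) \<in> L"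
  proof (rule monomial_mem[OF L])
    have "e j * int T ^ j = (if j = i then int m' * int T ^ i else 0)" for j by (simp add: e_def)
    then show "int m' dvd (\<Sum>i<q - 1. e i * int T ^ i)" by simp
  qed
  moreover have "g j powi e j = (if j = i then g i ^ m' else 1)" for j by (simp add: e_def)
  ultimately show ?thesis using i by simp
qed

lemma y_mem:
  assumes L: "subfield L amb" "\<And>i. i < q - 1 \<Longrightarrow> g i \<in> L" "y 0 \<in> L"
  shows "y i \<in> L"
proof -
  have "y i \<in> L" if "i < q" for i
    using that
  proof (induction i)
    case (Suc i)
    have "y (Suc i) = g i * y i" using y(2)[of i] by (simp add: g_def)
    then show ?case using Suc L by (auto intro: subfield_basics(4))
  qed (rule L(3))
  then have "y (i mod q) \<in> L" using q1 by simp
  then show ?thesis by (simp only: y(5))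
qed

lemma generate:
  assumes L: "subfield L amb" "k \<subseteq> L" "\<And>i. i < q - 1 \<Longrightarrow> g i \<in> L" "y 0 \<in> L"
    and Y: "\<And>i l. i < q \<Longrightarrow> l < m \<Longrightarrow> l \<noteq> 1 \<Longrightarrow> Y i l \<in> L" and ij: "i < q" "j < m"
  shows "xx i j \<in> L"
proof (rule xx_mem[OF L(1,2) _ ij])
  fix l assume "l < m"
  then show "Y i l \<in> L" using y_mem[OF L(1,3,4), of i] Y[OF ij(1), of l] by (cases "l = 1") (auto simp: y_def)
qed

text \<open>For counting it is enough to be algebraic: each \<open>g i\<close> is an
  \<open>m'\<close>-th root of an element generated by the \<open>z j\<close>.\<close>

lemma generate_dep_closure:
  assumes L: "L = dep_closure k S" and z: "\<And>i. i < q - 1 \<Longrightarrow> z i \<in> L" and y0: "y 0 \<in> L"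
    and Y: "\<And>i l. i < q \<Longrightarrow> l < m \<Longrightarrow> l \<noteq> 1 \<Longrightarrow> Y i l \<in> L" and ij: "i < q" "j < m"
  shows "xx i j \<in> L"
proof (rule generate[OF _ _ _ y0 Y ij])
  show "subfield L amb" "k \<subseteq> L" unfolding L by (rule subfield_dep_closure, rule k_dep_closure)
  then show "g i \<in> L" if "i < q - 1" for i
    using g_power_mem[OF _ z that] d_m'(3) unfolding L by (metis dep_closure_root)
qed

section \<open>Linearizing the action of tau\<close>

definition "P i = (\<Prod>j<i. z j)"
definition "s = (\<Sum>i<q. P i)"

text \<open>Tau shifts the partial products up to the factor \<open>1 / z 0\<close>. This factor
  does not depend on \<open>i\<close>, so it cancels in the quotients by their sum.\<close>

lemma P: "P i \<in> K" "P i \<noteq> 0" "sg (P i) = P i" "tu (P i) = P (i + 1) / z 0" "P (Suc i) = P i * z i"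
proof -
  show "P i \<in> K" "P i \<noteq> 0" "sg (P i) = P i" "P (Suc i) = P i * z i"
    using z by (auto simp: P_def sg.prod sg_z intro!: subfield_prod[OF sg.K])
  have "tu (P i) = (\<Prod>j<i. z (Suc j))" using z by (simp add: P_def tu.prod)
  also have "\<dots> = P (i + 1) / z 0"
    using z(2)[of 0] by (simp add: P_def prod.lessThan_Suc_shift del: prod.lessThan_Suc)
  finally show "tu (P i) = P (i + 1) / z 0" .
qed

text \<open>If the sum vanished, then \<open>z (q - 2)\<close> would be a rational function of \<open>z 0, \<dots>, z (q - 3)\<close>.\<close>

lemma s_nonzero: "s \<noteq> 0"
proof
  assume s0: "s = 0"
  \<comment> \<open>The \<open>q\<close> places \<open>(i, 1)\<close> that held the
    \<open>y i\<close> now hold \<open>z 0\<close>, ..., \<open>z (q - 2)\<close> and, at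
    \<open>i = q - 1\<close>, \<open>y 0\<close>. The count stays \<open>q * m\<close>.\<close>
  define h where "h p = (if snd p = 1 then if fst p = q - 1 then y 0 else z (fst p) else Y (fst p) (snd p))" for p
  let ?J = "{..<q} \<times> {..<m}"
  have h: "h p \<in> dep_closure k (h ` J)" if "p \<in> J" for p J
    using that by (intro subsetD[OF dep_closure_incl]) auto
  have hz: "z i = h (i, 1)" if "i < q - 1" for i using that by (simp add: h_def)
  have hy: "y 0 = h (q - 1, 1)" by (simp add: h_def)
  have hY: "Y i l = h (i, l)" if "l \<noteq> 1" for i l using that by (simp add: h_def)
  have "h (q - 2, 1) \<notin> dep_closure k (h ` (?J - {(q - 2, 1)}))"
  proof (rule counting)
    fix i j assume "i < q" "j < m"
    then show "xx i j \<in> dep_closure k (h ` ?J)"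
    proof (rule generate_dep_closure[OF HOL.refl, rotated -2])
      show "z i \<in> dep_closure k (h ` ?J)" if "i < q - 1" for i
        unfolding hz[OF that] by (rule h) (use that m1 in auto)
      show "y 0 \<in> dep_closure k (h ` ?J)" unfolding hy by (rule h) (use q1 m1 in auto)
      show "Y i l \<in> dep_closure k (h ` ?J)" if "i < q" "l < m" "l \<noteq> 1" for i l
        unfolding hY[OF that(3)] by (rule h) (use that in auto)
    qed
  qed (use q1 m1 in auto)
  moreover have "z (q - 2) \<in> dep_closure k (h ` (?J - {(q - 2, 1)}))" (is "_ \<in> ?L")
  proof -
    note sL = subfield_dep_closure[of k "h ` (?J - {(q - 2, 1)})"]
    have "z i \<in> ?L" if i: "i < q - 2" for i
    proof -
      have "i < q - 1" using i by simp
      show ?thesis unfolding hz[OF \<open>i < q - 1\<close>] by (rule h) (use i m1 in auto)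
    qed
    then have PL: "P i \<in> ?L" if "i \<le> q - 2" for i
      unfolding P_def using that by (intro subfield_prod[OF sL]) auto
    have q2: "q = Suc (Suc (q - 2))" using q1 by simp
    have "s = (\<Sum>i\<le>q - 2. P i) + P (q - 2) * z (q - 2)"
      unfolding s_def by (subst q2) (simp add: P(5) lessThan_Suc_atMost[symmetric])
    then have "z (q - 2) = - (\<Sum>i\<le>q - 2. P i) / P (q - 2)"
      using s0 P(2)[of "q - 2"] by (simp add: field_simps eq_neg_iff_add_eq_0)
    moreover have "- (\<Sum>i\<le>q - 2. P i) / P (q - 2) \<in> ?L"
      using PL by (intro subfield_divide[OF sL] subfield_uminus[OF sL] subfield_sum[OF sL]) auto
    ultimately show ?thesis by simp
  qed
  moreover have "h (q - 2, 1) = z (q - 2)" by (rule hz[symmetric]) (use q1 in simp)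
  ultimately show False by simp
qed

definition "u i = P i / s"
definition "v l = dft q omega u l"

lemma s: "s \<in> K" "sg s = s" "tu s = s / z 0"
proof -
  show "s \<in> K" "sg s = s" using P by (auto simp: s_def sg.sum intro!: subfield_sum[OF sg.K])
  have "tu s = (\<Sum>i<q. P (Suc i)) / z 0" using P by (simp add: s_def tu.sum sum_divide_distrib)
  also have "(\<Sum>i<q. P (Suc i)) = s"
  proof -
    have "P 0 + (\<Sum>i<q. P (Suc i)) = s + P q"
      unfolding s_def sum.lessThan_Suc_shift[symmetric] by simp
    \<comment> \<open>The product of the \<open>z j\<close> over a period is 1, so shifting the
      index only permutes the summands of \<open>s\<close>.\<close>
    moreover have "P q = P 0" using prod_z by (simp add: P_def)
    ultimately show ?thesis by simp
  qed
  finally show "tu s = s / z 0" .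
qed

lemma u: "u i \<in> K" "u i \<noteq> 0" "sg (u i) = u i" "i < q \<Longrightarrow> tu (u i) = u ((i + 1) mod q)" "z i = u (Suc i) / u i"
proof -
  show "u i \<in> K" "u i \<noteq> 0" "sg (u i) = u i" "z i = u (Suc i) / u i"
    using P s s_nonzero by (auto simp: u_def sg.divide intro!: subfield_divide[OF sg.K])
  assume "i < q"
  have "tu (u i) = P (i + 1) / s" using P s z(2)[of 0] by (simp add: u_def tu.divide)
  also have "\<dots> = u ((i + 1) mod q)"
  proof (cases "i + 1 = q")
    case True
    then show ?thesis using prod_z by (simp add: u_def P_def)
  qed (use \<open>i < q\<close> in \<open>simp add: u_def\<close>)
  finally show "tu (u i) = u ((i + 1) mod q)" .
qed

lemma tu_dft:
  assumes "\<And>i. i < q \<Longrightarrow> h i \<in> K" "\<And>i. i < q \<Longrightarrow> tu (h i) = h ((i + 1) mod q)"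
  shows "tu (dft q omega h l) = omega ^ l * dft q omega h l"
proof -
  have "tu (dft q omega h l) = dft q omega (\<lambda>i. tu (h i)) l" by (rule tu.dft(1)[OF omega(2) assms(1)])
  also have "\<dots> = dft q omega (\<lambda>i. h ((i + 1) mod q)) l"
    unfolding dft_def using assms(2) by (intro sum.cong) auto
  also have "\<dots> = omega ^ l * dft q omega h l" using dft_shift[OF eps_pow(2), of h 1 l] q1 by simp
  finally show ?thesis .
qed

lemma sg_dft:
  assumes "\<And>i. i < q \<Longrightarrow> h i \<in> K" "\<And>i. i < q \<Longrightarrow> sg (h i) = h i"
  shows "sg (dft q omega h l) = dft q omega h l" "dft q omega h l \<in> K"
proof -
  show "dft q omega h l \<in> K" by (rule sg.dft(2)[OF omega(2) assms(1)])
  have "sg (dft q omega h l) = dft q omega (\<lambda>i. sg (h i)) l" by (rule sg.dft(1)[OF omega(2) assms(1)])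
  also have "\<dots> = dft q omega h l" unfolding dft_def using assms(2) by (intro sum.cong) auto
  finally show "sg (dft q omega h l) = dft q omega h l" .
qed

lemma v: "v l \<in> K" "sg (v l) = v l" "tu (v l) = omega ^ l * v l" "v 0 = 1"
proof -
  show "v l \<in> K" "sg (v l) = v l" "tu (v l) = omega ^ l * v l"
    unfolding v_def using u by (auto intro: tu_dft sg_dft)
  show "v 0 = 1" using s_nonzero by (simp add: v_def dft_def u_def s_def flip: sum_divide_distrib)
qed

lemma u_mem:
  assumes L: "subfield L amb" "k \<subseteq> L" "\<And>l. 0 < l \<Longrightarrow> l < q \<Longrightarrow> v l \<in> L" and i: "i < q"
  shows "u i \<in> L"
proof (rule dft_inverse_mem[OF L(1) omega(1) q0 _ _ i])
  show "omega \<in> L" using L omega by auto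
  show "dft q omega u l \<in> L" if "l < q" for l
    using L(3)[of l] that v(4) subfield_basics(2)[OF L(1)] by (cases "l = 0") (auto simp: v_def)
qed

lemma z_mem:
  assumes L: "subfield L amb" "k \<subseteq> L" "\<And>l. 0 < l \<Longrightarrow> l < q \<Longrightarrow> v l \<in> L" and i: "i < q - 1"
  shows "z i \<in> L"
  unfolding u(5) using i by (intro subfield_divide[OF L(1)] u_mem[OF L]) auto

text \<open>\<open>v 0 = 1\<close> takes no place, so \<open>v 1\<close>, ...,
  \<open>v (q - 1)\<close> leave the place \<open>(0, 1)\<close> to \<open>y 0\<close>. Fourier
  inversion recovers the \<open>u i\<close> and hence the \<open>z i\<close>, so \<open>v 1\<close>
  belongs to a family to which counting applies.\<close>

lemma v1_nonzero: "v 1 \<noteq> 0"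
proof -
  define h where "h p = (if snd p = 1 then if fst p = 0 then y 0 else v (fst p) else Y (fst p) (snd p))" for p
  let ?J = "{..<q} \<times> {..<m}"
  have h: "h p \<in> dep_closure k (h ` ?J)" if "p \<in> ?J" for p
    using that by (intro subsetD[OF dep_closure_incl]) auto
  have hv: "v i = h (i, 1)" if "0 < i" for i using that by (simp add: h_def)
  have hy: "y 0 = h (0, 1)" by (simp add: h_def)
  have hY: "Y i l = h (i, l)" if "l \<noteq> 1" for i l using that by (simp add: h_def)
  have "h (1, 1) \<noteq> 0"
  proof (rule counting_nonzero)
    fix i j assume "i < q" "j < m"
    then show "xx i j \<in> dep_closure k (h ` ?J)"
    proof (rule generate_dep_closure[OF HOL.refl, rotated -2])
      have vL: "v l \<in> dep_closure k (h ` ?J)" if "0 < l" "l < q" for l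
        unfolding hv[OF that(1)] by (rule h) (use that m1 in auto)
      show "z i \<in> dep_closure k (h ` ?J)" if "i < q - 1" for i
        by (rule z_mem[OF subfield_dep_closure k_dep_closure vL that])
      show "y 0 \<in> dep_closure k (h ` ?J)" unfolding hy by (rule h) (use q1 m1 in auto)
      show "Y i l \<in> dep_closure k (h ` ?J)" if "i < q" "l < m" "l \<noteq> 1" for i l
        unfolding hY[OF that(3)] by (rule h) (use that in auto)
    qed
  qed (use q1 m1 in auto)
  then show ?thesis by (simp add: h_def)
qed

end

section \<open>Generators of the fixed field\<close>

context metacyclic_action
begin

text \<open>A Bezout coefficient: with it \<open>g i ^ e0\<close> has the same sigma-eigenvalue as
  \<open>y i ^ d\<close>, which makes their quotient \<open>p i\<close> invariant.\<close>

definition "e0 = (SOME e. [(T - 1) * e = d] (mod m))"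

lemma e0: "[(T - 1) * e0 = d] (mod m)"
proof -
  have "\<exists>e. [(T - 1) * e = gcd (T - 1) m] (mod m)" by (rule cong_solve_nat)
  then have "\<exists>e. [(T - 1) * e = d] (mod m)" by (simp add: d_def gcd.commute)
  then show ?thesis unfolding e0_def by (rule someI_ex)
qed

definition "p i = y i ^ d / g i ^ e0"

lemma p: "p i \<in> K" "p i \<noteq> 0" "sg (p i) = p i" "tu (p i) = p (i + 1)" "p (i mod q) = p i"
proof -
  show "p i \<in> K" "p i \<noteq> 0" "tu (p i) = p (i + 1)" "p (i mod q) = p i"
    using y g by (auto simp: p_def tu.divide tu.power subfield_power[OF sg.K] intro!: subfield_divide[OF sg.K])
  have "[T ^ i * ((T - 1) * e0) = T ^ i * d] (mod m)" by (intro cong_mult e0) simp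
  then have *: "eps ^ (T ^ i * ((T - 1) * e0)) = eps ^ (T ^ i * d)" by (rule eps_pow_eq)
  have "sg (p i) = (eps ^ (T ^ i) * y i) ^ d / (eps ^ ((T - 1) * T ^ i) * g i) ^ e0"
    using y g by (simp add: p_def sg.divide sg.power subfield_power[OF sg.K] sg_g)
  also have "\<dots> = (eps ^ (T ^ i * d) * y i ^ d) / (eps ^ (T ^ i * ((T - 1) * e0)) * g i ^ e0)"
    by (simp only: power_mult_distrib power_mult[symmetric] mult.assoc mult.commute mult.left_commute)
  also have "\<dots> = p i" unfolding * using eps_nonzero by (simp add: p_def)
  finally show "sg (p i) = p i" .
qed

text \<open>Some resolvent of \<open>p\<close> is nonzero because \<open>p 0\<close> is a combination of them; it serves in place of the trace
  of \<open>p\<close>, which could vanish.\<close>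

definition "R l = dft q omega p l"
definition "l0 = (SOME l. R l \<noteq> 0)"

lemma R_nonzero: "R l0 \<noteq> 0"
proof -
  have "\<exists>l. R l \<noteq> 0"
  proof (rule ccontr)
    assume "\<not> ?thesis"
    then have "p 0 = 0" using dft_inverse[OF omega(1) q0, of 0 p] q1 by (simp add: R_def)
    then show False using p(2) by simp
  qed
  then show ?thesis unfolding l0_def by (rule someI_ex)
qed

lemma R: "R l \<in> K" "sg (R l) = R l" "tu (R l) = omega ^ l * R l"
  unfolding R_def using p by (auto intro: tu_dft sg_dft)

text \<open>Numerator and denominator have the same sigma-eigenvalue, the power of
  \<open>eps\<close> with exponent c T^i.\<close>

definition "Z i c = Y i c / y i ^ c"

lemma Z: "Z i c \<in> K" "sg (Z i c) = Z i c" "tu (Z i c) = Z (i + 1) c" "Z (i mod q) c = Z i c"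
proof -
  show "Z i c \<in> K" "tu (Z i c) = Z (i + 1) c" "Z (i mod q) c = Z i c"
    using y Y_K tu_Y Y_periodic
    by (auto simp: Z_def tu.divide tu.power subfield_power[OF sg.K] intro!: subfield_divide[OF sg.K])
  have "sg (Z i c) = (eps ^ (c * T ^ i) * Y i c) / (eps ^ (T ^ i) * y i) ^ c"
    using y Y_K by (simp add: Z_def sg.divide sg.power subfield_power[OF sg.K] sg_Y)
  also have "\<dots> = (eps ^ (c * T ^ i) * Y i c) / (eps ^ (c * T ^ i) * y i ^ c)"
    by (simp only: power_mult_distrib power_mult[symmetric] mult.commute)
  also have "\<dots> = Z i c" using eps_nonzero by (simp add: Z_def)
  finally show "sg (Z i c) = Z i c" .
qed

definition "W c l = dft q omega (\<lambda>i. Z i c) l"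

lemma W: "W c l \<in> K" "sg (W c l) = W c l" "tu (W c l) = omega ^ l * W c l"
  unfolding W_def using Z by (auto intro: tu_dft sg_dft)

text \<open>The slots \<open>(i, 1)\<close> that \<open>Y\<close> leaves free hold the invariants built from the \<open>y\<close>.\<close>

definition generator :: "nat \<times> nat \<Rightarrow> 'a" where
  "generator ic = (let i = fst ic; c = snd ic in
     if c \<noteq> 1 then W c i / v 1 ^ i else if i = 0 then R l0 / v 1 ^ l0
     else if i = 1 then v 1 ^ q else v i / v 1 ^ i)"

lemma semi_invariant_quotient:
  assumes "r \<in> K" "sg r = r" "tu r = omega ^ l * r"
  shows "r / v 1 ^ l \<in> K" "sg (r / v 1 ^ l) = r / v 1 ^ l" "tu (r / v 1 ^ l) = r / v 1 ^ l"
proof -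
  have om: "omega \<noteq> 0" using eps_pow(2) q1 by (auto simp: power_0_left)
  show "r / v 1 ^ l \<in> K" "sg (r / v 1 ^ l) = r / v 1 ^ l"
    using assms v by (auto simp: sg.divide sg.power subfield_power[OF sg.K] intro!: subfield_divide[OF sg.K])
  show "tu (r / v 1 ^ l) = r / v 1 ^ l"
    using assms v om by (simp add: tu.divide tu.power subfield_power[OF sg.K] power_mult_distrib)
qed

lemma generator: "generator ic \<in> K" "sg (generator ic) = generator ic" "tu (generator ic) = generator ic"
proof -
  have q: "v 1 ^ q \<in> K" "sg (v 1 ^ q) = v 1 ^ q" "tu (v 1 ^ q) = v 1 ^ q"
    using v eps_pow(2) by (simp_all add: sg.power tu.power subfield_power[OF sg.K] power_mult_distrib)
  show "generator ic \<in> K" "sg (generator ic) = generator ic" "tu (generator ic) = generator ic"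
    using semi_invariant_quotient[OF W] semi_invariant_quotient[OF R] semi_invariant_quotient[OF v(1-3)] q
    unfolding generator_def Let_def by presburger+
qed

section \<open>The Kummer tower between F and K\<close>

definition "S = generator ` ({..<q} \<times> {..<m})"
definition "F = adjoin k S"
text \<open>Each step adjoins a root: \<open>v 1 ^ q\<close>, \<open>g 0 ^ m'\<close> and
  \<open>y 0 ^ d\<close> lie in the field below. The order of the steps matters:
  \<open>g 0 ^ m'\<close> is expressed by the \<open>z i\<close>, which come from the
  \<open>v l\<close>, and \<open>y 0 ^ d\<close> is reached through the \<open>g i\<close>.\<close>

definition "E1 = adjoin F {v 1}"
definition "E2 = adjoin E1 {g 0}"
definition "E3 = adjoin E2 {y 0}"

lemma subfields: "subfield F amb" "subfield E1 amb" "subfield E2 amb" "subfield E3 amb"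
  by (simp_all add: F_def E1_def E2_def E3_def)

lemma chain: "k \<subseteq> F" "F \<subseteq> E1" "E1 \<subseteq> E2" "E2 \<subseteq> E3" "v 1 \<in> E1" "g 0 \<in> E2" "y 0 \<in> E3"
  by (auto simp: F_def E1_def E2_def E3_def intro: adjoin_base adjoin_incl)

lemma S_sub: "S \<subseteq> K" "S \<subseteq> F"
  using generator(1) by (auto simp: S_def F_def intro: adjoin_incl)

lemma semi_invariant_mem: "r / v 1 ^ l \<in> F \<Longrightarrow> r \<in> E1"
proof -
  assume "r / v 1 ^ l \<in> F"
  then have "(r / v 1 ^ l) * v 1 ^ l \<in> E1"
    using chain(2,5) subfields(2) by (intro subfield_basics(4) subfield_power) auto
  then show ?thesis using v1_nonzero by simp
qed

lemma generator_mem: "i < q \<Longrightarrow> c < m \<Longrightarrow> generator (i, c) \<in> F"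
  using S_sub(2) by (auto simp: S_def)

lemma v_E1: "0 < l \<Longrightarrow> l < q \<Longrightarrow> v l \<in> E1"
  using generator_mem[of l 1] m1 chain(5) semi_invariant_mem[of "v l" l]
  by (cases "l = 1") (auto simp: generator_def)

lemma R_E1: "R l0 \<in> E1"
  using generator_mem[of 0 1] q1 m1 semi_invariant_mem[of "R l0" l0] by (simp add: generator_def)

lemma z_E1: "i < q - 1 \<Longrightarrow> z i \<in> E1"
  using chain by (intro z_mem[OF subfields(2) _ v_E1]) auto

lemma Z_E1: "i < q \<Longrightarrow> c < m \<Longrightarrow> c \<noteq> 1 \<Longrightarrow> Z i c \<in> E1"
proof -
  assume ic: "i < q" "c < m" "c \<noteq> 1"
  have "W c l \<in> E1" if "l < q" for l
    using generator_mem[OF that ic(2)] ic(3) semi_invariant_mem[of "W c l" l] by (simp add: generator_def)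
  then show ?thesis
    using chain(1,2) omega(2) dft_inverse_mem[OF subfields(2) omega(1) q0 _ _ ic(1), of "\<lambda>i. Z i c"]
    by (auto simp: W_def)
qed

text \<open>Modulo the ideal (m', zeta - T) the power zeta^i is congruent to T^i. So for
  \<open>i < q - 1\<close> the ratio \<open>g i / g 0 ^ (T ^ i)\<close> is an invariant monomial and
  lies in \<open>E1\<close>; the last \<open>g\<close> comes from the product over a period.\<close>

lemma g_E2: "g i \<in> E2"
proof -
  have less: "g i \<in> E2" if i: "i < q - 1" for i
  proof -
    define e where "e j = (if j = i then 1 else 0) - (if j = 0 then int T ^ i else 0)" for j
    have "(\<Prod>j<q - 1. g j powi e j) \<in> E1"
    proof (rule monomial_mem[OF subfields(2) z_E1])
      have "e j * int T ^ j = (if j = i then int T ^ i else 0) - (if j = 0 then int T ^ i else 0)" for j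
        by (simp add: e_def left_diff_distrib)
      then have "(\<Sum>j<q - 1. e j * int T ^ j) = 0" using i by (simp add: sum_subtractf)
      then show "int m' dvd (\<Sum>j<q - 1. e j * int T ^ j)" by simp
    qed
    also have "(\<Prod>j<q - 1. g j powi e j) = g i / g 0 ^ (T ^ i)"
    proof -
      have "g j powi e j = (if j = i then g i else 1) / (if j = 0 then g 0 ^ (T ^ i) else 1)" for j
        using g(2) by (auto simp: e_def power_int_diff simp flip: of_nat_power)
      then show ?thesis using i by (simp add: prod_dividef)
    qed
    finally have "(g i / g 0 ^ (T ^ i)) * g 0 ^ (T ^ i) \<in> E2"
      using chain by (intro subfield_basics(4)[OF subfields(3)] subfield_power[OF subfields(3)]) auto
    then show ?thesis using g(2) by simp
  qed
  have last: "g (q - 1) \<in> E2"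
  proof -
    have "(\<Prod>j<q - 1. g j) * g (q - 1) = 1"
      using prod_g_period[of 0] q1 prod.lessThan_Suc[of g "q - 1"] by simp
    then have "g (q - 1) = inverse (\<Prod>j<q - 1. g j)" by (rule inverse_unique[symmetric])
    also have "\<dots> \<in> E2" using less by (intro subfield_inverse[OF subfields(3)] subfield_prod[OF subfields(3)]) auto
    finally show ?thesis .
  qed
  have "i mod q < q" using q1 by simp
  then have "g (i mod q) \<in> E2" using less[of "i mod q"] last by (cases "i mod q = q - 1") auto
  then show ?thesis by (simp only: g(4))
qed

text \<open>\<open>R l0\<close> is \<open>p 0\<close> times a combination of the ratios
  \<open>p i / p 0\<close>, which are rational in the \<open>g i\<close>. The combination is nonzero
  because \<open>R l0\<close> is, so \<open>p 0\<close> lies in \<open>E2\<close>, and with it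
  \<open>y 0 ^ d\<close>, which is \<open>p 0 * g 0 ^ e0\<close>.\<close>

lemma y0_power_E2: "y 0 ^ d \<in> E2"
proof -
  note sE = subfields(3)
  have "p i / p 0 \<in> E2" for i
  proof -
    have "y i / y 0 = (\<Prod>j<i. g j)" using prod_g[of 0 i] by simp
    then have yi: "y i / y 0 \<in> E2" using g_E2 by (auto intro: subfield_prod[OF sE])
    have "p i / p 0 = (y i / y 0) ^ d / (g i ^ e0 / g 0 ^ e0)"
      by (simp add: p_def power_divide)
    moreover have "g i ^ e0 / g 0 ^ e0 \<in> E2"
      by (intro subfield_divide[OF sE] subfield_power[OF sE] g_E2)
    ultimately show ?thesis by (simp only: subfield_divide[OF sE subfield_power[OF sE yi]])
  qed
  moreover have om: "omega ^ n \<in> E2" for n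
    using omega(2) chain by (intro subfield_power[OF sE]) auto
  ultimately have rho: "(\<Sum>j<q. omega ^ ((q - 1) * l0 * j) * (p j / p 0)) \<in> E2" (is "?rho \<in> _")
    by (intro subfield_sum[OF sE] subfield_basics(4)[OF sE])
  have "R l0 = ?rho * p 0"
    using p(2)[of 0] by (simp add: R_def dft_def sum_distrib_right)
  then have "p 0 = R l0 / ?rho" using R_nonzero by auto
  also have "\<dots> \<in> E2" using rho R_E1 chain(3) by (intro subfield_divide[OF sE]) auto
  finally have "p 0 * g 0 ^ e0 \<in> E2" using g_E2 by (intro subfield_basics(4)[OF sE] subfield_power[OF sE])
  then show ?thesis using g(2)[of 0] by (simp add: p_def)
qed

lemma g0_power_E1: "g 0 ^ m' \<in> E1"
  using q1 by (intro g_power_mem[OF subfields(2) z_E1]) auto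

lemma v1_power_F: "v 1 ^ q \<in> F"
  using generator_mem[of 1 1] q1 m1 by (simp add: generator_def)

lemma K_sub_E3: "K \<subseteq> E3"
  unfolding K_gen
proof (rule adjoin_least[OF subfields(4)])
  show "k \<subseteq> E3" using chain by auto
  have gE: "g i \<in> E3" for i using g_E2 chain(4) by auto
  have "Y i l \<in> E3" if il: "i < q" "l < m" "l \<noteq> 1" for i l
  proof -
    have "Z i l \<in> E3" using Z_E1[OF il] chain by auto
    moreover have "y i \<in> E3" by (rule y_mem[OF subfields(4) gE chain(7)])
    ultimately have "Z i l * y i ^ l \<in> E3" by (intro subfield_basics(4)[OF subfields(4)] subfield_power[OF subfields(4)])
    then show ?thesis using y(2)[of i] by (simp add: Z_def)
  qed
  then have "xx i j \<in> E3" if "i < q" "j < m" for i j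
    by (rule generate[OF subfields(4) \<open>k \<subseteq> E3\<close> gE chain(7) _ that])
  then show "(\<lambda>(i, j). xx i j) ` ({..<q} \<times> {..<m}) \<subseteq> E3" by auto
qed

lemma sub_K: "F \<subseteq> K" "E1 \<subseteq> K" "E2 \<subseteq> K"
proof -
  show F: "F \<subseteq> K" unfolding F_def by (rule adjoin_least[OF sg.K sg.kK S_sub(1)])
  show E1: "E1 \<subseteq> K" unfolding E1_def by (rule adjoin_least[OF sg.K F]) (use v in simp)
  show "E2 \<subseteq> K" unfolding E2_def by (rule adjoin_least[OF sg.K E1]) (use g in simp)
qed

lemma F_fixed:
  assumes "r \<in> F"
  shows "sg r = r" "tu r = r"
proof -
  have S: "sg s = s" "tu s = s" if "s \<in> S" for s using that generator by (auto simp: S_def)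
  show "sg r = r" by (rule sg.adjoin_eqI[OF sg.id_endo S_sub(1) S(1)]) (use assms in \<open>auto simp: F_def\<close>)
  show "tu r = r" by (rule tu.adjoin_eqI[OF tu.id_endo S_sub(1) S(2)]) (use assms in \<open>auto simp: F_def\<close>)
qed

lemma E1_fixed: "r \<in> E1 \<Longrightarrow> sg r = r"
  unfolding E1_def by (rule sg.adjoin_fixed[OF sub_K(1) F_fixed(1)]) (use v in auto)

lemma fixed_sub_F:
  assumes r: "r \<in> K" "sg r = r" "tu r = r"
  shows "r \<in> F"
proof -
  have dm: "of_nat d \<noteq> (0 :: 'a)" "of_nat m' \<noteq> (0 :: 'a)"
    using m0 arg_cong[OF d_m'(1), of "of_nat :: nat \<Rightarrow> 'a"] by auto
  interpret pw: field_endo k K "sg ^^ m'" by (rule sg.funpow_endo)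
  have pw_eigen: "(sg ^^ m') w = (c ^ m') * w" if "w \<in> K" "sg w = c * w" "c \<in> k" for w c
    using sg.funpow_eigen[OF that] .
  have epsk: "eps ^ n \<in> k" for n by (rule subfield_power[OF sg.k eps(2)])
  have pw_fix: "(sg ^^ n) w = w" if "sg w = w" for n w by (induction n) (auto simp: that)
  have "r \<in> E2"
  \<comment> \<open>Sigma itself may move \<open>g 0\<close>, but \<open>sg ^^ m'\<close> fixes it,
    as \<open>m\<close> divides m'(T - 1), and therefore fixes all of \<open>E2\<close>. It
    multiplies \<open>y 0\<close> by \<open>eps ^ m'\<close>, which has order
    \<open>d\<close>.\<close>
  proof (rule pw.cyclic_descent[OF subfields(3) sub_K(3) _ y(1), where c = "eps ^ m'" and n = d])
    show "(sg ^^ m') b = b" if "b \<in> E2" for b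
      using that unfolding E2_def
    proof (rule pw.adjoin_fixed[OF sub_K(2), rotated -1])
      show "(sg ^^ m') b = b" if "b \<in> E1" for b by (rule pw_fix[OF E1_fixed[OF that]])
      have "(sg ^^ m') (g 0) = (eps ^ (T - 1)) ^ m' * g 0"
        by (rule pw_eigen) (use g sg_g[of 0] epsk in auto)
      also have "(eps ^ (T - 1)) ^ m' = eps ^ 0"
        unfolding power_mult[symmetric] using m_dvd by (intro eps_pow_eq) (simp add: cong_0_iff mult.commute)
      finally show "(sg ^^ m') s = s" if "s \<in> {g 0}" for s using that by simp
    qed (use g in auto)
    show "(sg ^^ m') (y 0) = eps ^ m' * y 0" by (rule pw_eigen) (use y y(3)[of 0] eps in auto)
    show "eps ^ m' \<in> E2" using epsk chain by auto
    have "gcd m m' = m'" using d_m'(1) by (metis dvd_triv_left gcd_nat.absorb2)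
    moreover have "m div m' = d" using d_m'(1,3) by (metis nonzero_mult_div_cancel_left less_numeral_extra(3))
    ultimately show "primitive_root_of_unity d (eps ^ m')" using primitive_root_power[OF eps(1), of m'] by simp
    show "(sg ^^ m') r = r" by (rule pw_fix[OF r(2)])
    show "r \<in> adjoin E2 {y 0}" using K_sub_E3 r(1) by (auto simp: E3_def)
  qed (use dm y0_power_E2 in auto)
  have "r \<in> E1"
  \<comment> \<open>One level lower sigma itself serves: it fixes \<open>E1\<close>, and
    \<open>eps ^ (T - 1)\<close> has order m / gcd(m, T - 1), which is \<open>m'\<close>.\<close>
  proof (rule sg.cyclic_descent[OF subfields(2) sub_K(2) E1_fixed g(1), where c = "eps ^ (T - 1)" and n = m'])
    show "primitive_root_of_unity m' (eps ^ (T - 1))"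
      using primitive_root_power[OF eps(1), of "T - 1"] by (simp add: m'_def d_def)
    show "sg (g 0) = eps ^ (T - 1) * g 0" using sg_g[of 0] by simp
    show "eps ^ (T - 1) \<in> E1" using epsk chain by auto
    show "r \<in> adjoin E1 {g 0}" using \<open>r \<in> E2\<close> by (simp add: E2_def)
  qed (use dm g0_power_E1 r in auto)
  show "r \<in> F"
  proof (rule tu.cyclic_descent[OF subfields(1) sub_K(1) F_fixed(2) v(1), where c = omega and n = q])
    show "tu (v 1) = omega * v 1" using v(3)[of 1] by simp
    show "omega \<in> F" using omega(2) chain by auto
    show "r \<in> adjoin F {v 1}" using \<open>r \<in> E1\<close> by (simp add: E1_def)
  qed (use omega q0 v1_power_F r in auto)
qed

text \<open>Up the tower, each adjoined element is a root of one already algebraic over k(S). So all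
  variables are algebraic over it, while \<open>S\<close> has at most \<open>q * m\<close>
  elements.\<close>

lemma S_independent: "alg_independent k (\<lambda>s. s) S"
proof (rule alg_independentI[OF sg.k])
  show "finite S" by (simp add: S_def)
  let ?L = "dep_closure k S"
  note sL = subfield_dep_closure[of k S]
  have F: "F \<subseteq> ?L" unfolding F_def by (rule adjoin_dep_closure)
  have "v 1 \<in> ?L" using dep_closure_root[of "v 1" q k S] v1_power_F F q1 by auto
  then have E1: "E1 \<subseteq> ?L" unfolding E1_def using F by (intro adjoin_least[OF sL]) auto
  have "g 0 \<in> ?L" using dep_closure_root[of "g 0" m' k S] g0_power_E1 E1 d_m'(3) by auto
  then have E2: "E2 \<subseteq> ?L" unfolding E2_def using E1 by (intro adjoin_least[OF sL]) auto
  have "y 0 \<in> ?L" using dep_closure_root[of "y 0" d k S] y0_power_E2 E2 d_m'(2) by auto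
  then have "E3 \<subseteq> ?L" unfolding E3_def using E2 by (intro adjoin_least[OF sL]) auto
  then have "K \<subseteq> ?L" using K_sub_E3 by auto
  then have I: "(\<lambda>(i, j). xx i j) ` ({..<q} \<times> {..<m}) \<subseteq> ?L" using xx_K by auto
  have "card S \<le> q * m"
    unfolding S_def using card_image_le[of "{..<q} \<times> {..<m}" generator] by simp
  then show "\<forall>s\<in>S. s \<notin> dep_closure k (S - {s})"
    using generators_independent[OF _ ind(2) \<open>finite S\<close> _ I] ind(1) by simp
qed

lemma fixed_purely_transcendental: "purely_transcendental k {r \<in> K. sg r = r \<and> tu r = r}"
  unfolding purely_transcendental_def
proof (intro exI conjI)
  show "alg_independent k (\<lambda>s. s) S" by (rule S_independent)
  show "{r \<in> K. sg r = r \<and> tu r = r} = adjoin k S"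
    using fixed_sub_F F_fixed sub_K(1) by (auto simp: F_def)
qed

end

section \<open>Noether's problem for the group\<close>

lemma variable_action_endo:
  assumes k: "subfield k amb" and K: "K = adjoin k S" and act: "variable_action k G x K act" and h: "h \<in> carrier G"
  shows "field_endo k K (act h)"
proof -
  have "act h \<in> Ring.ring_hom (amb\<lparr>carrier := K\<rparr>) (amb\<lparr>carrier := K\<rparr>)" "\<forall>c\<in>k. act h c = c"
    using act h by (auto simp: variable_action_def ring_iso_def)
  then show ?thesis
    using k by (auto simp: field_endo_def Ring.ring_hom_def K intro: adjoin_base)
qed

text \<open>\<open>act\<close> is specified for each group element separately. It respects products
  because an endomorphism over \<open>k\<close> is determined on \<open>K\<close> by its values on
  the variables; invariance under the two generators then spreads by the induction rule.\<close>

lemma fixed_field_generators: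
  assumes G: "group G" and k: "subfield k amb" and K: "K = adjoin k (x ` carrier G)"
    and act: "variable_action k G x K act" and gens: "s \<in> carrier G" "u \<in> carrier G"
    and induct: "\<And>h P. h \<in> carrier G \<Longrightarrow> P \<one>\<^bsub>G\<^esub> \<Longrightarrow> (\<And>h. h \<in> carrier G \<Longrightarrow> P h \<Longrightarrow> P (s \<otimes>\<^bsub>G\<^esub> h)) \<Longrightarrow>
      (\<And>h. h \<in> carrier G \<Longrightarrow> P h \<Longrightarrow> P (u \<otimes>\<^bsub>G\<^esub> h)) \<Longrightarrow> P h"
  shows "fixed_field G K act = {r \<in> K. act s r = r \<and> act u r = r}"
proof -
  interpret G: group G by fact
  note endo = variable_action_endo[OF k K act]
  have xK: "x ` carrier G \<subseteq> K" by (auto simp: K intro: adjoin_incl)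
  have act_x: "act h (x g) = x (h \<otimes>\<^bsub>G\<^esub> g)" if "h \<in> carrier G" "g \<in> carrier G" for h g
    using act that by (simp add: variable_action_def)
  have one: "act \<one>\<^bsub>G\<^esub> r = r" if "r \<in> K" for r
  proof (rule field_endo.adjoin_eqI[OF endo[OF G.one_closed] field_endo.id_endo[OF endo[OF G.one_closed]] xK])
    show "act \<one>\<^bsub>G\<^esub> w = w" if "w \<in> x ` carrier G" for w
      using that by (auto simp: act_x)
  qed (use that K in simp)
  have comp: "act (g \<otimes>\<^bsub>G\<^esub> h) r = act g (act h r)" if gh: "g \<in> carrier G" "h \<in> carrier G" and r: "r \<in> K" for g h r
  proof (rule field_endo.adjoin_eqI[OF endo[OF G.m_closed[OF gh]] field_endo.comp_endo[OF endo[OF gh(1)] endo[OF gh(2)]] xK])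
    fix w assume "w \<in> x ` carrier G"
    then show "act (g \<otimes>\<^bsub>G\<^esub> h) w = act g (act h w)" using gh by (auto simp: act_x G.m_assoc)
  qed (use r K in simp)
  have "act h r = r" if r: "r \<in> K" "act s r = r" "act u r = r" and h: "h \<in> carrier G" for h r
    by (rule induct[OF h, of "\<lambda>h. act h r = r"]) (use r gens in \<open>simp_all add: one comp\<close>)
  then show ?thesis using gens by (auto simp: fixed_field_def)
qed

theorem theorem4p6:
  fixes m q :: nat and t m' b :: int and a :: "nat \<Rightarrow> int" and \<zeta> :: complex
    and k K :: "'a::field set" and x :: "gens word set \<Rightarrow> 'a"
    and act :: "gens word set \<Rightarrow> 'a \<Rightarrow> 'a"
  assumes "m > 0" and "prime q"
    and "gcd t (int m) = 1" and "ord m (nat (t mod int m)) = q"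
    and "m' = int m div gcd (int m) (t - 1)"
    and "b * m' = (\<Sum>i\<le>q-2. a i * t ^ i)"
    and "primitive_root_of_unity q \<zeta>"
    and "field_norm \<rat> (adjoin \<rat> {\<zeta>}) (\<Sum>i\<le>q-2. of_int (a i) * \<zeta> ^ i)
           \<in> {of_int m', - of_int m'}"
    and "contains_root_of_unity k m" and "contains_root_of_unity k q"
    and "rational_function_field k x (carrier (G_mq m q t)) K"
    and "variable_action k (G_mq m q t) x K act"
  shows "purely_transcendental k (fixed_field (G_mq m q t) K act)"
proof -
  define T where "T = nat (t mod int m)"
  have q1: "q > 1" using assms(2) prime_gt_1_nat by blast
  have Tq: "[T ^ q = 1] (mod m)" using ord[of T m] assms(4) by (simp add: T_def)
  have Tt: "[int T = t] (mod int m)" using assms(1) by (simp add: T_def cong_def)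
  \<comment> \<open>If \<open>T\<close> were congruent to 1 its order would be 1, not a prime. This
    also excludes \<open>m = 1\<close>, where all residues agree.\<close>
  have T1: "\<not> [T = 1] (mod m)"
    using ord_eq_Suc_0_iff[of m T] assms(4) q1 by (auto simp: T_def)
  then have m1: "m > 1" using assms(1) by (cases "m = 1") (auto simp: cong_def)
  have "T \<noteq> 0"
  proof
    assume "T = 0"
    then have "[0 = 1] (mod m)" using Tq q1 by (simp add: power_0_left)
    then show False using m1 by (simp add: cong_def)
  qed
  then have "T > 1" using T1 by (cases "T = 1") auto
  have "[int T ^ q = 1] (mod int m)" using Tq unfolding cong_int_iff[symmetric] by simp
  then have tq: "[t ^ q = 1] (mod int m)" using cong_pow[OF Tt, of q] cong_sym cong_trans by blast
  have "q > 0" using q1 by simp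
  note G = assms(1) \<open>q > 0\<close> tq
  \<comment> \<open>\<open>t\<close> is replaced by its residue \<open>T\<close>, so that exponents
    become natural numbers; the gcd with \<open>m\<close>, and with it \<open>m'\<close>, stays the
    same.\<close>
  have "[t - 1 = int T - 1] (mod int m)" using Tt by (intro cong_diff) (auto intro: cong_sym)
  then have "gcd (t - 1) (int m) = gcd (int T - 1) (int m)" by (rule cong_gcd_eq)
  also have "int T - 1 = int (T - 1)" using \<open>T > 1\<close> by simp
  finally have gcd: "gcd (int m) (t - 1) = int (gcd m (T - 1))" by (simp only: gcd.commute gcd_int_int_eq)
  have m': "m' = int (m div gcd m (T - 1))" unfolding assms(5) gcd by (simp add: zdiv_int)
  have "m' * gcd (int m) (t - 1) = int m" by (simp add: assms(5))
  then have "m' dvd int m" by (metis dvd_triv_left)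
  then have "[int T = t] (mod m')" using Tt cong_dvd_modulus by blast
  then have "[(\<Sum>i\<le>q - 2. a i * int T ^ i) = (\<Sum>i\<le>q - 2. a i * t ^ i)] (mod m')"
    by (intro cong_sum cong_mult cong_pow) auto
  then have a_dvd: "m' dvd (\<Sum>i\<le>q - 2. a i * int T ^ i)"
    using assms(6) by (metis cong_dvd_iff dvd_triv_right)
  obtain eps omega where eps: "eps \<in> k" "primitive_root_of_unity m eps"
    and omega: "omega \<in> k" "primitive_root_of_unity q omega"
    using assms(9,10) by (auto simp: contains_root_of_unity_def)
  \<comment> \<open>The convention on the characteristic makes \<open>m\<close> and \<open>q\<close>
    invertible in the field, as Fourier inversion and averaging require.\<close>
  have nz: "of_nat n \<noteq> (0 :: 'a)" if "contains_root_of_unity k n" "n > 0" for n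
    using that by (auto simp: contains_root_of_unity_def of_nat_eq_0_iff_char_dvd)
  have k: "subfield k amb" and ind: "alg_independent k x (carrier (G_mq m q t))"
    and K: "K = adjoin k (x ` carrier (G_mq m q t))"
    using assms(11) by (auto simp: rational_function_field_def)
  let ?el = "G_elem m q t"
  have el: "(\<lambda>(i, j). ?el i j) ` ({..<q} \<times> {..<m}) = carrier (G_mq m q t)"
    "card (carrier (G_mq m q t)) = q * m"
    using G_elem_bij[OF G] bij_betw_same_card[OF G_elem_bij[OF G]] by (auto simp: bij_betw_def)
  have el_mem: "?el i j \<in> carrier (G_mq m q t)" if "i < q" "j < m" for i j
    unfolding el(1)[symmetric] using that by auto
  have x_el: "(\<lambda>(i, j). x (?el i j)) ` ({..<q} \<times> {..<m}) = x ` carrier (G_mq m q t)"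
    unfolding el(1)[symmetric] by (simp add: image_image case_prod_unfold)
  note fam = alg_independent_family[OF k ind]
  note endo = variable_action_endo[OF k K assms(12)]
  note gens = G_gens_carrier[OF G]
  have act_x: "act h (x g) = x (h \<otimes>\<^bsub>G_mq m q t\<^esub> g)"
    if "h \<in> carrier (G_mq m q t)" "g \<in> carrier (G_mq m q t)" for h g
    using assms(12) that by (simp add: variable_action_def)
  have tn: "t_nat m t = T" by (simp add: t_nat_def[OF G] T_def)
  have "metacyclic_action k K (act (G_sigma m q t)) (act (G_tau m q t)) m q T (\<lambda>i j. x (?el i j)) eps omega a \<zeta>"
  proof (intro metacyclic_action.intro metacyclic_action_axioms.intro)
    show "field_endo k K (act (G_sigma m q t))" "field_endo k K (act (G_tau m q t))"
      by (intro endo gens)+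
    show "of_nat m \<noteq> (0 :: 'a)" "of_nat q \<noteq> (0 :: 'a)" using nz assms(9,10) m1 q1 by auto
    show "K = adjoin k ((\<lambda>(i, j). x (?el i j)) ` ({..<q} \<times> {..<m}))" unfolding x_el by (rule K)
    show "card ((\<lambda>(i, j). x (?el i j)) ` ({..<q} \<times> {..<m})) = q * m"
      unfolding x_el card_image[OF fam(1)] by (rule el(2))
    show "\<forall>s\<in>(\<lambda>(i, j). x (?el i j)) ` ({..<q} \<times> {..<m}).
        s \<notin> dep_closure k ((\<lambda>(i, j). x (?el i j)) ` ({..<q} \<times> {..<m}) - {s})"
      unfolding x_el by (rule fam(2))
    show "act (G_sigma m q t) (x (?el i j)) = x (?el i ((j + T ^ i) mod m))" if "i < q" "j < m" for i j
      by (simp add: act_x gens el_mem that G_sigma_elem[OF G] tn)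
    show "act (G_tau m q t) (x (?el i j)) = x (?el ((i + 1) mod q) j)" if "i < q" "j < m" for i j
      by (simp only: act_x gens el_mem that G_tau_elem[OF G])
    show "int (m div gcd m (T - 1)) dvd (\<Sum>i\<le>q - 2. a i * int T ^ i)" using a_dvd unfolding m' .
    show "field_norm \<rat> (adjoin \<rat> {\<zeta>}) (\<Sum>i\<le>q - 2. of_int (a i) * \<zeta> ^ i)
        \<in> {of_int (int (m div gcd m (T - 1))), - of_int (int (m div gcd m (T - 1)))}"
      using assms(8) unfolding m' .
  qed (use assms m1 \<open>T > 1\<close> Tq eps omega in auto)
  then have "purely_transcendental k {r \<in> K. act (G_sigma m q t) r = r \<and> act (G_tau m q t) r = r}"
    by (rule metacyclic_action.fixed_purely_transcendental)
  moreover have "fixed_field (G_mq m q t) K act = {r \<in> K. act (G_sigma m q t) r = r \<and> act (G_tau m q t) r = r}"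
  proof (rule fixed_field_generators[OF _ k K assms(12) gens])
    show "group (G_mq m q t)" unfolding G_mq_def by (rule group_presented_group)
    show "P h" if "h \<in> carrier (G_mq m q t)" "P \<one>\<^bsub>G_mq m q t\<^esub>"
      "\<And>h. h \<in> carrier (G_mq m q t) \<Longrightarrow> P h \<Longrightarrow> P (G_sigma m q t \<otimes>\<^bsub>G_mq m q t\<^esub> h)"
      "\<And>h. h \<in> carrier (G_mq m q t) \<Longrightarrow> P h \<Longrightarrow> P (G_tau m q t \<otimes>\<^bsub>G_mq m q t\<^esub> h)" for h P
      using that by (rule G_induct[OF G])
  qed
  ultimately show ?thesis by simp
qed

end
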